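(* Let $T>0$ and $\alpha\in(0,1)$, let $H_i(v,m)=g_i(v)\int_{\mathbb T^d}f_i(v)\,m\,dx$, $i=1,2$, with $f_1,f_2,g_1,g_2$ satisfying the Hamiltonian assumption (see context) with constants $c_h,\tilde c_h$ and exponents $p_h,\tilde p_h$, and let $G$ satisfy the payoff assumption (see context). Let $\mathcal{BM}(\mathbb T^d)$ denote the space of bounded Radon measures on $\mathbb T^d$. Let $\{m_0^n\}_{n\in\mathbb N}\subset\mathcal{BM}(\mathbb T^d)$ and assume that for some $m_0\in\mathcal{BM}(\mathbb T^d)$, $m_0^n$ converges to $m_0$ weak-$*$ in $\mathcal{BM}(\mathbb T^d)$. Let $(v^n,m^n)$ and $(v^\infty,m^\infty)$ in $(\mathcal B_{\alpha T})^d\times\mathcal{PM}^\alpha$ be corresponding mild solutions (see context) with initial data $m_0^n$ and $m_0$, respectively, and assume that they are uniformly bounded: for some $M>0$, $\|v^j\|_{(\mathcal B_{\alpha T})^d}\le M$ and $\|m^j\|_{\mathcal{PM}^\alpha}\le M$ for all $j\in\mathbb N\cup\{\infty\}$. There exist thresholds $\epsilon>0$ (depending on $M$, on the constants and exponents associated to the bounds for $H_1,H_2$, on $G$, and on $d$ and $\alpha$) and $\delta>0$ (depending on $M$, on the exponents $p_h,\tilde p_h$, on $G$, and on $d$ and $\alpha$) such that, if one of the following two smallness conditions holds: (Case 1) $p_{f_i}+p_{g_i}>0$, $p_{f_i}+\tilde p_{g_i}>0$ and $\tilde p_{f_i}+p_{g_i}>0$ for $i=1,2$, and $\|v^j\|_{(\mathcal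 B_{\alpha T})^d}<\epsilon$ for all $j\in\mathbb N\cup\{\infty\}$; or (Case 2) $c_{f_1}c_{g_1}+\tilde c_{f_1}c_{g_1}+c_{f_1}\tilde c_{g_1}+c_{f_2}c_{g_2}+\tilde c_{f_2}c_{g_2}+c_{f_2}\tilde c_{g_2}<\delta$; then the sequence $v^n$ converges uniformly to $v^\infty$ on $\mathbb T^d\times[0,T]$, and at every time $t\in[0,T]$, $m^n(\cdot,t)$ converges weak-$*$ in $\mathcal{BM}(\mathbb T^d)$ to $m^\infty(\cdot,t)$.
   Context: Setting: $\mathbb T^d$ is $[0,2\pi]^d$ with periodic boundary conditions. Functions and distributions on $\mathbb T^d$ are real-valued and written as $f(x)=\sum_{k\in\mathbb Z^d}f_ke^{ik\cdot x}$; if $f$ depends also on $t\in[0,T]$ then $f_k=f_k(t)$, assumed measurable in $t$. $|k|$ is the Euclidean norm. For $\beta\ge0$, $\alpha\ge 0$, define spaces by finiteness of the norms $$\|f\|_{PM^\beta}=\sup_{k}e^{\beta|k|}|f_k|,\qquad \|f\|_{\mathcal{PM}^\alpha}=\sup_k\sup_{t\in[0,T]}e^{\alpha t|k|}|f_k(t)|,$$ $$\|f\|_{\mathcal B_\beta}=\sum_k\sup_{t\in[0,T]}e^{\beta|k|}|f_k(t)|,\qquad \|f\|_{B_{1,\beta}}=\sum_k(1+|k|)e^{\beta|k|}|f_k|.$$ Elements of $PM^\beta$ and $\mathcal{PM}^\alpha$ are identified with their Fourier coefficients; a bounded measure $\mu$ is identified with the element of $PM^0$ with coefficients $\int e^{-ik\cdot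 x}\,d\mu(x)$, and a function with its density with respect to normalized Lebesgue measure. The norm on $(\mathcal B_\beta)^d$ is the sum of the norms of the components. Products of a function and a pseudomeasure are defined by convolution of Fourier coefficients. The integral is normalized: at each time, $\int_{\mathbb T^d}f\,m\,dx=\sum_{k}f_k m_{-k}$. Weak-$*$ convergence in $\mathcal{BM}(\mathbb T^d)$ means convergence of the pairing with every $\phi\in C(\mathbb T^d)$. Hamiltonians: $f_1,f_2,g_1$ are scalar-valued and $g_2$ is $\mathbb R^d$-valued functions of $v\in\mathbb R^d$, acting on functions by composition; $H_i(v,m)=g_i(v)\int_{\mathbb T^d}f_i(v)\,m\,dx$ (the integral is a function of $t$ only), so $H_1$ is scalar-valued and $H_2$ is $\mathbb R^d$-valued. Hamiltonian assumption: for any $T>0$ and any $\alpha\in[0,1)$, $f_1,f_2,g_1$ map $(\mathcal B_{\alpha T})^d$ to $\mathcal B_{\alpha T}$ and $g_2$ maps $(\mathcal B_{\alpha T})^d$ to $(\mathcal B_{\alpha T})^d$. For all $h\in\{f_1,f_2,g_1,g_2\}$ there exist $c_h>0$, $p_h\ge0$, $\tilde c_h>0$, $\tilde p_h\ge0$ such that for all $v,v_1,v_2\in(\mathcal B_{\alpha T})^d$, $$\|h(v)\|\le c_h\|v\|_{(\mathcal B_{\alpha T})^d}^{p_h},\qquad \|h(v_1)-h(v_2)\|\le\tilde c_h\|v_1-v_2\|_{(\mathcal B_{\alpha T})^d}\left(\|v_1\|_{(\mathcal B_{\alpha T})^d}^{\tilde p_h}+\|v_2\|_{(\mathcal B_{\alpha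 T})^d}^{\tilde p_h}\right),$$ the norms on the left-hand sides being those of $\mathcal B_{\alpha T}$ or $(\mathcal B_{\alpha T})^d$ as appropriate. Payoff assumption: for each $m\in PM^{\alpha T}$, $G(m,\cdot)\in B_{1,\alpha T}$. There exist non-decreasing continuous functions $\Psi_1,\Psi_2:\mathbb R_+\to\mathbb R_+$ and constants $c_G>0,\tilde c_G>0$ such that for all $m,m_1,m_2\in PM^{\alpha T}$, $$\|G(m,\cdot)\|_{B_{1,\alpha T}}\le c_G\|m\|_{PM^{\alpha T}}\Psi_1(\|m\|_{PM^{\alpha T}}),$$ $$\|G(m_1,\cdot)-G(m_2,\cdot)\|_{B_{1,\alpha T}}\le\tilde c_G\|m_1-m_2\|_{PM^{\alpha T}}\Psi_2(\|m_1\|_{PM^{\alpha T}}+\|m_2\|_{PM^{\alpha T}}).$$ Mild solution with initial data $m_0$: $e^{\Delta t}$ is the heat semigroup, multiplying the $k$-th Fourier coefficient by $e^{-|k|^2t}$. A mild solution is a pair $(v,m)\in(\mathcal B_{\alpha T})^d\times\mathcal{PM}^\alpha$ such that for all $t\in[0,T]$ (integrals understood coefficientwise) $$m(\cdot,t)=e^{\Delta t}m_0-\int_0^te^{\Delta(t-s)}\mathrm{div}\big(mH_2(v,m)\big)(\cdot,s)\,ds,$$ $$v(\cdot,t)=e^{\Delta(T-t)}\nabla G(m(\cdot,T),\cdot)+\int_t^Te^{\Delta(s-t)}\nabla\big(H_1(v,m)\big)(\cdot,s)\,ds.$$ *)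

theory Defs
  imports "HOL-Analysis.Analysis"
begin

text \<open>
  Functions and pseudomeasures on the torus are handled through their Fourier coefficients,
  indexed by \<^typ>\<open>int ^ 'd\<close>. Everything that depends on time is only ever inspected for
  times in \<open>[0, T]\<close>.
\<close>

type_synonym 'd coeffs = "int ^ 'd \<Rightarrow> complex"
type_synonym 'd vcoeffs = "int ^ 'd \<Rightarrow> complex ^ 'd"

definition freq :: "int ^ 'd \<Rightarrow> real ^ 'd::finite" where
  "freq k = (\<chi> i. real_of_int (k $ i))"

abbreviation knorm :: "int ^ 'd::finite \<Rightarrow> real" where
  "knorm k \<equiv> norm (freq k)"


section \<open>Spaces\<close>

text \<open>The Fourier coefficients of a real-valued function or distribution.\<close>

definition real_coeffs :: "'d::finite coeffs \<Rightarrow> bool" where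
  "real_coeffs a \<longleftrightarrow> (\<forall>k. a (- k) = cnj (a k))"

definition real_measurable_coeffs :: "real \<Rightarrow> (real \<Rightarrow> 'd::finite coeffs) \<Rightarrow> bool" where
  "real_measurable_coeffs T f \<longleftrightarrow>
     (\<forall>t\<in>{0..T}. real_coeffs (f t)) \<and>
     (\<forall>k. (\<lambda>t. f t k) \<in> borel_measurable (lebesgue_on {0..T}))"

text \<open>
  Norms are real-valued; the membership predicates say that the suprema and sums in
  them are finite.
\<close>

definition in_PM :: "real \<Rightarrow> 'd::finite coeffs \<Rightarrow> bool" where
  "in_PM \<beta> a \<longleftrightarrow> real_coeffs a \<and> bdd_above (range (\<lambda>k. exp (\<beta> * knorm k) * cmod (a k)))"

definition norm_PM :: "real \<Rightarrow> 'd::finite coeffs \<Rightarrow> real" where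
  "norm_PM \<beta> a = (SUP k. exp (\<beta> * knorm k) * cmod (a k))"

text \<open>The time-dependent space, whose weight \<open>exp (\<alpha> t |k|)\<close> grows with \<open>t\<close>.\<close>

definition in_PMt :: "real \<Rightarrow> real \<Rightarrow> (real \<Rightarrow> 'd::finite coeffs) \<Rightarrow> bool" where
  "in_PMt \<alpha> T f \<longleftrightarrow> real_measurable_coeffs T f \<and>
     bdd_above ((\<lambda>(k, t). exp (\<alpha> * t * knorm k) * cmod (f t k)) ` (UNIV \<times> {0..T}))"

definition norm_PMt :: "real \<Rightarrow> real \<Rightarrow> (real \<Rightarrow> 'd::finite coeffs) \<Rightarrow> real" where
  "norm_PMt \<alpha> T f = (SUP (k, t)\<in>UNIV \<times> {0..T}. exp (\<alpha> * t * knorm k) * cmod (f t k))"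

definition in_B :: "real \<Rightarrow> real \<Rightarrow> (real \<Rightarrow> 'd::finite coeffs) \<Rightarrow> bool" where
  "in_B \<beta> T f \<longleftrightarrow> real_measurable_coeffs T f \<and>
     (\<forall>k. bdd_above ((\<lambda>t. exp (\<beta> * knorm k) * cmod (f t k)) ` {0..T})) \<and>
     (\<lambda>k. SUP t\<in>{0..T}. exp (\<beta> * knorm k) * cmod (f t k)) summable_on UNIV"

definition norm_B :: "real \<Rightarrow> real \<Rightarrow> (real \<Rightarrow> 'd::finite coeffs) \<Rightarrow> real" where
  "norm_B \<beta> T f = (\<Sum>\<^sub>\<infinity>k. SUP t\<in>{0..T}. exp (\<beta> * knorm k) * cmod (f t k))"

definition in_Bvec :: "real \<Rightarrow> real \<Rightarrow> (real \<Rightarrow> 'd::finite vcoeffs) \<Rightarrow> bool" where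
  "in_Bvec \<beta> T v \<longleftrightarrow> (\<forall>i. in_B \<beta> T (\<lambda>t k. v t k $ i))"

definition norm_Bvec :: "real \<Rightarrow> real \<Rightarrow> (real \<Rightarrow> 'd::finite vcoeffs) \<Rightarrow> real" where
  "norm_Bvec \<beta> T v = (\<Sum>i\<in>UNIV. norm_B \<beta> T (\<lambda>t k. v t k $ i))"

definition in_B1 :: "real \<Rightarrow> 'd::finite coeffs \<Rightarrow> bool" where
  "in_B1 \<beta> a \<longleftrightarrow> real_coeffs a \<and>
     (\<lambda>k. (1 + knorm k) * exp (\<beta> * knorm k) * cmod (a k)) summable_on UNIV"

definition norm_B1 :: "real \<Rightarrow> 'd::finite coeffs \<Rightarrow> real" where
  "norm_B1 \<beta> a = (\<Sum>\<^sub>\<infinity>k. (1 + knorm k) * exp (\<beta> * knorm k) * cmod (a k))"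


section \<open>Functions and Fourier coefficients\<close>

text \<open>
  The function with the given coefficients; under \<^const>\<open>real_coeffs\<close> the complex sum is
  real, so \<^const>\<open>Re\<close> only changes the type.
\<close>

definition synth :: "'d::finite coeffs \<Rightarrow> real ^ 'd \<Rightarrow> real" where
  "synth a x = Re (\<Sum>\<^sub>\<infinity>k. a k * cis (freq k \<bullet> x))"

definition vsynth :: "'d::finite vcoeffs \<Rightarrow> real ^ 'd \<Rightarrow> real ^ 'd" where
  "vsynth a x = (\<chi> i. synth (\<lambda>k. a k $ i) x)"

text \<open>A fundamental domain of the torus; it carries the measures on the torus.\<close>

definition torus_cell :: "(real ^ 'd::finite) set" where
  "torus_cell = {x. \<forall>i. 0 \<le> x $ i \<and> x $ i < 2 * pi}"

definition fourier_coeff :: "(real ^ 'd::finite \<Rightarrow> real) \<Rightarrow> 'd coeffs" where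
  "fourier_coeff u k =
     (LINT x:torus_cell|lborel. complex_of_real (u x) * cis (- (freq k \<bullet> x)))
       / (2 * pi) ^ CARD('d)"

text \<open>Coefficients of \<open>x \<mapsto> h (v (x, t))\<close>, for scalar-valued and for vector-valued \<open>h\<close>.\<close>

definition compose :: "(real ^ 'd::finite \<Rightarrow> real) \<Rightarrow> (real \<Rightarrow> 'd vcoeffs) \<Rightarrow> real \<Rightarrow> 'd coeffs" where
  "compose h v t = fourier_coeff (\<lambda>x. h (vsynth (v t) x))"

definition vcompose ::
    "(real ^ 'd::finite \<Rightarrow> real ^ 'd) \<Rightarrow> (real \<Rightarrow> 'd vcoeffs) \<Rightarrow> real \<Rightarrow> 'd vcoeffs" where
  "vcompose h v t k = (\<chi> i. compose (\<lambda>y. h y $ i) v t k)"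

definition pairing :: "'d::finite coeffs \<Rightarrow> 'd coeffs \<Rightarrow> complex" where
  "pairing a b = (\<Sum>\<^sub>\<infinity>k. a k * b (- k))"

definition conv :: "'d::finite coeffs \<Rightarrow> 'd coeffs \<Rightarrow> 'd coeffs" where
  "conv a b k = (\<Sum>\<^sub>\<infinity>j. a j * b (k - j))"

definition vconv :: "'d::finite coeffs \<Rightarrow> 'd vcoeffs \<Rightarrow> 'd vcoeffs" where
  "vconv a b k = (\<chi> i. conv a (\<lambda>j. b j $ i) k)"

definition grad_coeffs :: "'d::finite coeffs \<Rightarrow> 'd vcoeffs" where
  "grad_coeffs a k = (\<chi> i. \<i> * of_int (k $ i) * a k)"

definition div_coeffs :: "'d::finite vcoeffs \<Rightarrow> 'd coeffs" where
  "div_coeffs a k = (\<Sum>i\<in>UNIV. \<i> * of_int (k $ i) * a k $ i)"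

definition heat ::
    "real \<Rightarrow> (int ^ 'd::finite \<Rightarrow> 'b::real_vector) \<Rightarrow> int ^ 'd \<Rightarrow> 'b" where
  "heat t a k = exp (- ((knorm k)\<^sup>2 * t)) *\<^sub>R a k"


section \<open>Hamiltonians and payoff\<close>

definition ham ::
    "(real ^ 'd::finite \<Rightarrow> real) \<Rightarrow> (real ^ 'd \<Rightarrow> real) \<Rightarrow>
     (real \<Rightarrow> 'd vcoeffs) \<Rightarrow> (real \<Rightarrow> 'd coeffs) \<Rightarrow> real \<Rightarrow> 'd coeffs" where
  "ham f g v m t k = compose g v t k * pairing (compose f v t) (m t)"

definition vham ::
    "(real ^ 'd::finite \<Rightarrow> real) \<Rightarrow> (real ^ 'd \<Rightarrow> real ^ 'd) \<Rightarrow>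
     (real \<Rightarrow> 'd vcoeffs) \<Rightarrow> (real \<Rightarrow> 'd coeffs) \<Rightarrow> real \<Rightarrow> 'd vcoeffs" where
  "vham f g v m t k = (\<chi> i. vcompose g v t k $ i * pairing (compose f v t) (m t))"

text \<open>Powers with real exponent and \<open>0\<^sup>0 = 1\<close> (whereas \<open>0 powr 0 = 0\<close>).\<close>

definition rpow :: "real \<Rightarrow> real \<Rightarrow> real" where
  "rpow x p = (if p = 0 then 1 else x powr p)"

text \<open>
  The second conjunct makes sure that \<^const>\<open>compose\<close> yields the coefficients of a
  representation \<open>h (v (x, t)) = (\<Sum>k. h\<^sub>k(t) exp (i k \<cdot> x))\<close>, and not a default value of the
  integral.
\<close>

definition maps_B :: "real \<Rightarrow> real \<Rightarrow> (real ^ 'd::finite \<Rightarrow> real) \<Rightarrow> bool" where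
  "maps_B \<beta> T h \<longleftrightarrow>
     (\<forall>v. in_Bvec \<beta> T v \<longrightarrow>
        in_B \<beta> T (compose h v) \<and>
        (\<forall>t\<in>{0..T}. \<forall>x. synth (compose h v t) x = h (vsynth (v t) x)))"

definition vmaps_B :: "real \<Rightarrow> real \<Rightarrow> (real ^ 'd::finite \<Rightarrow> real ^ 'd) \<Rightarrow> bool" where
  "vmaps_B \<beta> T h \<longleftrightarrow> (\<forall>i. maps_B \<beta> T (\<lambda>y. h y $ i))"

definition ham_bounds ::
    "real \<Rightarrow> real \<Rightarrow> (real ^ 'd::finite \<Rightarrow> real) \<Rightarrow> real \<Rightarrow> real \<Rightarrow> real \<Rightarrow> real \<Rightarrow> bool" where
  "ham_bounds \<beta> T h c p ct pt \<longleftrightarrow>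
     c > 0 \<and> p \<ge> 0 \<and> ct > 0 \<and> pt \<ge> 0 \<and>
     (\<forall>v. in_Bvec \<beta> T v \<longrightarrow>
        norm_B \<beta> T (compose h v) \<le> c * rpow (norm_Bvec \<beta> T v) p) \<and>
     (\<forall>v1 v2. in_Bvec \<beta> T v1 \<longrightarrow> in_Bvec \<beta> T v2 \<longrightarrow>
        norm_B \<beta> T (\<lambda>t k. compose h v1 t k - compose h v2 t k)
          \<le> ct * norm_Bvec \<beta> T (\<lambda>t k. v1 t k - v2 t k)
              * (rpow (norm_Bvec \<beta> T v1) pt + rpow (norm_Bvec \<beta> T v2) pt))"

definition vham_bounds ::
    "real \<Rightarrow> real \<Rightarrow> (real ^ 'd::finite \<Rightarrow> real ^ 'd) \<Rightarrow> real \<Rightarrow> real \<Rightarrow> real \<Rightarrow> real \<Rightarrow> bool" where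
  "vham_bounds \<beta> T h c p ct pt \<longleftrightarrow>
     c > 0 \<and> p \<ge> 0 \<and> ct > 0 \<and> pt \<ge> 0 \<and>
     (\<forall>v. in_Bvec \<beta> T v \<longrightarrow>
        norm_Bvec \<beta> T (vcompose h v) \<le> c * rpow (norm_Bvec \<beta> T v) p) \<and>
     (\<forall>v1 v2. in_Bvec \<beta> T v1 \<longrightarrow> in_Bvec \<beta> T v2 \<longrightarrow>
        norm_Bvec \<beta> T (\<lambda>t k. vcompose h v1 t k - vcompose h v2 t k)
          \<le> ct * norm_Bvec \<beta> T (\<lambda>t k. v1 t k - v2 t k)
              * (rpow (norm_Bvec \<beta> T v1) pt + rpow (norm_Bvec \<beta> T v2) pt))"

text \<open>Labels for the four functions, used to index their constants and exponents.\<close>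

datatype ham_label = F1 | F2 | G1 | G2

definition hamiltonian_at ::
    "real \<Rightarrow> real \<Rightarrow>
     (real ^ 'd::finite \<Rightarrow> real) \<Rightarrow> (real ^ 'd \<Rightarrow> real) \<Rightarrow>
     (real ^ 'd \<Rightarrow> real) \<Rightarrow> (real ^ 'd \<Rightarrow> real ^ 'd) \<Rightarrow>
     (ham_label \<Rightarrow> real) \<Rightarrow> (ham_label \<Rightarrow> real) \<Rightarrow> (ham_label \<Rightarrow> real) \<Rightarrow> (ham_label \<Rightarrow> real) \<Rightarrow> bool"
  where
  "hamiltonian_at T \<alpha> f1 f2 g1 g2 c p ct pt \<longleftrightarrow>
     maps_B (\<alpha> * T) T f1 \<and> maps_B (\<alpha> * T) T f2 \<and>
     maps_B (\<alpha> * T) T g1 \<and> vmaps_B (\<alpha> * T) T g2 \<and>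
     ham_bounds (\<alpha> * T) T f1 (c F1) (p F1) (ct F1) (pt F1) \<and>
     ham_bounds (\<alpha> * T) T f2 (c F2) (p F2) (ct F2) (pt F2) \<and>
     ham_bounds (\<alpha> * T) T g1 (c G1) (p G1) (ct G1) (pt G1) \<and>
     vham_bounds (\<alpha> * T) T g2 (c G2) (p G2) (ct G2) (pt G2)"

definition hamiltonian_assumption ::
    "(real ^ 'd::finite \<Rightarrow> real) \<Rightarrow> (real ^ 'd \<Rightarrow> real) \<Rightarrow>
     (real ^ 'd \<Rightarrow> real) \<Rightarrow> (real ^ 'd \<Rightarrow> real ^ 'd) \<Rightarrow> bool" where
  "hamiltonian_assumption f1 f2 g1 g2 \<longleftrightarrow>
     (\<forall>T>0. \<forall>\<alpha>\<in>{0..<1}. \<exists>c p ct pt. hamiltonian_at T \<alpha> f1 f2 g1 g2 c p ct pt)"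

definition payoff_assumption ::
    "real \<Rightarrow> real \<Rightarrow> ('d::finite coeffs \<Rightarrow> 'd coeffs) \<Rightarrow>
     real \<Rightarrow> real \<Rightarrow> (real \<Rightarrow> real) \<Rightarrow> (real \<Rightarrow> real) \<Rightarrow> bool" where
  "payoff_assumption T \<alpha> G cG ctG \<Psi>1 \<Psi>2 \<longleftrightarrow>
     cG > 0 \<and> ctG > 0 \<and>
     (\<forall>\<Psi>\<in>{\<Psi>1, \<Psi>2}. continuous_on {0..} \<Psi> \<and> mono_on {0..} \<Psi> \<and> (\<forall>r\<ge>0. \<Psi> r \<ge> 0)) \<and>
     (\<forall>m. in_PM (\<alpha> * T) m \<longrightarrow>
        in_B1 (\<alpha> * T) (G m) \<and>
        norm_B1 (\<alpha> * T) (G m) \<le> cG * norm_PM (\<alpha> * T) m * \<Psi>1 (norm_PM (\<alpha> * T) m)) \<and>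
     (\<forall>m1 m2. in_PM (\<alpha> * T) m1 \<longrightarrow> in_PM (\<alpha> * T) m2 \<longrightarrow>
        norm_B1 (\<alpha> * T) (\<lambda>k. G m1 k - G m2 k)
          \<le> ctG * norm_PM (\<alpha> * T) (\<lambda>k. m1 k - m2 k)
               * \<Psi>2 (norm_PM (\<alpha> * T) m1 + norm_PM (\<alpha> * T) m2))"


section \<open>Mild solutions\<close>

definition mild_solution ::
    "real \<Rightarrow> real \<Rightarrow>
     (real ^ 'd::finite \<Rightarrow> real) \<Rightarrow> (real ^ 'd \<Rightarrow> real) \<Rightarrow>
     (real ^ 'd \<Rightarrow> real) \<Rightarrow> (real ^ 'd \<Rightarrow> real ^ 'd) \<Rightarrow>
     ('d coeffs \<Rightarrow> 'd coeffs) \<Rightarrow> 'd coeffs \<Rightarrow>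
     (real \<Rightarrow> 'd vcoeffs) \<Rightarrow> (real \<Rightarrow> 'd coeffs) \<Rightarrow> bool" where
  "mild_solution T \<alpha> f1 f2 g1 g2 G m0 v m \<longleftrightarrow>
     in_Bvec (\<alpha> * T) T v \<and> in_PMt \<alpha> T m \<and>
     (\<forall>t\<in>{0..T}. \<forall>k.
        m t k = heat t m0 k
          - integral {0..t} (\<lambda>s. heat (t - s) (div_coeffs (vconv (m s) (vham f2 g2 v m s))) k) \<and>
        v t k = heat (T - t) (grad_coeffs (G (m T))) k
          + integral {t..T} (\<lambda>s. heat (s - t) (grad_coeffs (ham f1 g1 v m s)) k))"


section \<open>Bounded Radon measures on the torus\<close>

text \<open>
  A bounded real (signed) Radon measure is given as a difference \<open>fst \<mu> - snd \<mu>\<close> of two finite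
  Borel measures; by the Jordan decomposition every such measure arises in this way. Finite
  Borel measures on the torus are automatically regular. The map from \<^const>\<open>torus_cell\<close> onto
  the torus is a Borel isomorphism.
\<close>

type_synonym 'd smeasure = "(real ^ 'd) measure \<times> (real ^ 'd) measure"

definition torus_measure :: "(real ^ 'd::finite) measure \<Rightarrow> bool" where
  "torus_measure M \<longleftrightarrow> finite_measure M \<and> sets M = sets (restrict_space borel torus_cell)"

definition BM :: "'d::finite smeasure set" where
  "BM = {\<mu>. torus_measure (fst \<mu>) \<and> torus_measure (snd \<mu>)}"

definition smeasure_integral ::
    "'d::finite smeasure \<Rightarrow> (real ^ 'd \<Rightarrow> 'b::{banach, second_countable_topology}) \<Rightarrow> 'b" where
  "smeasure_integral \<mu> \<phi> = integral\<^sup>L (fst \<mu>) \<phi> - integral\<^sup>L (snd \<mu>) \<phi>"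

definition smeasure_coeffs :: "'d::finite smeasure \<Rightarrow> 'd coeffs" where
  "smeasure_coeffs \<mu> k = smeasure_integral \<mu> (\<lambda>x. cis (- (freq k \<bullet> x)))"

definition torus_continuous :: "(real ^ 'd::finite \<Rightarrow> real) set" where
  "torus_continuous =
     {\<phi>. continuous_on UNIV \<phi> \<and> (\<forall>x i. \<phi> (x + (2 * pi) *\<^sub>R axis i 1) = \<phi> x)}"

definition weak_star :: "(nat \<Rightarrow> 'd::finite smeasure) \<Rightarrow> 'd smeasure \<Rightarrow> bool" where
  "weak_star \<mu>s \<mu> \<longleftrightarrow>
     (\<forall>\<phi>\<in>torus_continuous. (\<lambda>n. smeasure_integral (\<mu>s n) \<phi>) \<longlonglongrightarrow> smeasure_integral \<mu> \<phi>)"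

text \<open>
  The same for pseudomeasures: they have to be (coefficients of) bounded measures, which are then
  uniquely determined as measures.
\<close>

definition weak_star_coeffs :: "(nat \<Rightarrow> 'd::finite coeffs) \<Rightarrow> 'd coeffs \<Rightarrow> bool" where
  "weak_star_coeffs as a \<longleftrightarrow>
     (\<exists>\<mu>s \<mu>. (\<forall>n. \<mu>s n \<in> BM \<and> smeasure_coeffs (\<mu>s n) = as n) \<and>
             \<mu> \<in> BM \<and> smeasure_coeffs \<mu> = a \<and> weak_star \<mu>s \<mu>)"

end

theory Submission
  imports Defs
begin

text \<open>
  Weak-* convergence of the initial measures says, at the level of Fourier coefficients, only that
  each coefficient converges, with a bound that is uniform in the frequency. The pseudomeasure norm
  of the difference of the initial data need not tend to zero, so a contraction estimate in the
  norms of \<open>v\<close> and \<open>m\<close> alone proves nothing. The proof keeps the frequencies apart. With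
  \<open>A n k = sup\<^sub>t exp (\<alpha> t |k|) |m\<^sup>n\<^sub>k(t) - m\<^sub>k(t)|\<close> and \<open>D n\<close> the norm of \<open>v\<^sup>n - v\<close>, it bounds the upper limit
  in \<open>n\<close> of \<open>D n\<close> and of every single \<open>A n k\<close> by one constant \<open>C\<close>, and shows that \<open>C\<close> may be
  replaced by \<open>C / 2\<close> if the Hamiltonians are weak enough. Iteration gives the limit zero.

  Four points make the halving step work.

  \<^item> Differences are split so that \<open>m\<^sup>n - m\<close> only ever meets factors taken from the limit solution:
    \<open>m\<^sup>n H\<^sup>n - m H = (m\<^sup>n - m) H + m\<^sup>n (H\<^sup>n - H)\<close>, and likewise for the pairing inside \<open>H\<close>. Then
    \<open>m\<^sup>n - m\<close> enters through sums \<open>\<Sum>j. A n j w(j)\<close> with a summable weight \<open>w\<close> independent of \<open>n\<close>,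
    and the upper limit passes through such sums by dominated convergence (\<open>asymp_le_infsum\<close>).

  \<^item> The factor \<open>|k|\<close> lost to a derivative is recovered from the heat kernel. Against the growing
    weight \<open>exp (\<alpha> t |k|)\<close> the gain is \<open>|k| / (|k|\<^sup>2 - \<alpha> |k|) \<le> 1 / (1 - \<alpha>)\<close>, whatever \<open>T\<close> is
    (\<open>forward_diff_le\<close>, \<open>backward_diff_le\<close>). Hence the thresholds do not involve \<open>T\<close>.

  \<^item> The payoff is only Lipschitz for the pseudomeasure norm at time \<open>T\<close>, a supremum over all
    frequencies. There the supremum is harmless: at high frequencies the datum is damped by
    \<open>exp (\<alpha> T |k| - |k|\<^sup>2 T)\<close> and the Duhamel term by \<open>1 / (|k| - \<alpha>)\<close>, uniformly in \<open>n\<close>, so only finitely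
    many frequencies matter (\<open>high_frequencies\<close>, \<open>asymp_terminal\<close>).

  \<^item> The constant of the payoff need not be small, since it multiplies the difference of the terminal
    densities, which carries the small factor of \<open>H\<^sub>2\<close> (\<open>asymp_D\<close>).

  Smallness is measured by \<open>interaction_strength\<close>, a sum of products of bounds on a ball of radius
  \<open>R\<close>. It is small because of the powers of \<open>R = \<epsilon>\<close> in the first case and because of the
  constants, with \<open>R = M\<close>, in the second.

  Once \<open>D\<close> tends to zero, \<open>v\<^sup>n\<close> converges uniformly, the norm dominating the supremum of the Fourier
  series. For \<open>t > 0\<close> the coefficients decay exponentially, so \<open>m\<^sup>n(t)\<close> is a measure with continuous
  density, and \<open>\<Sum>k. A n k exp (- \<alpha> t |k|)\<close> tends to zero: the densities converge uniformly, which is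
  stronger than weak-* convergence. At \<open>t = 0\<close> the claim is the hypothesis on the initial data.
\<close>

section \<open>Asymptotic upper bounds\<close>

text \<open>
  The relation \<open>limsup X \<le> c\<close>, stated without extended reals.
\<close>

definition asymp_le :: "(nat \<Rightarrow> real) \<Rightarrow> real \<Rightarrow> bool" where
  "asymp_le X c \<longleftrightarrow> (\<forall>\<eta>>0. \<forall>\<^sub>F n in sequentially. X n \<le> c + \<eta>)"

lemma asymp_leI_le: "(\<And>n. X n \<le> c) \<Longrightarrow> asymp_le X c"
  unfolding asymp_le_def by (force intro: always_eventually less_imp_le add_increasing2)

lemma asymp_le_trans:
  assumes "asymp_le X c" "\<And>n. Y n \<le> X n" "c \<le> c'"
  shows "asymp_le Y c'"
  unfolding asymp_le_def
proof (intro allI impI)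
  fix \<eta> :: real assume "\<eta> > 0"
  then have "\<forall>\<^sub>F n in sequentially. X n \<le> c + \<eta>"
    using assms(1) by (auto simp: asymp_le_def)
  then show "\<forall>\<^sub>F n in sequentially. Y n \<le> c' + \<eta>"
  proof eventually_elim
    case (elim n)
    then show ?case using assms(2)[of n] assms(3) by linarith
  qed
qed

lemma asymp_le_add:
  assumes "asymp_le X a" "asymp_le Y b"
  shows "asymp_le (\<lambda>n. X n + Y n) (a + b)"
  unfolding asymp_le_def
proof (intro allI impI)
  fix \<eta> :: real assume "\<eta> > 0"
  then have "\<forall>\<^sub>F n in sequentially. X n \<le> a + \<eta>/2" "\<forall>\<^sub>F n in sequentially. Y n \<le> b + \<eta>/2"
    using assms by (auto simp: asymp_le_def)
  then show "\<forall>\<^sub>F n in sequentially. X n + Y n \<le> a + b + \<eta>"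
    by eventually_elim (simp add: field_simps)
qed

lemma asymp_le_cmult:
  assumes "asymp_le X a" "0 \<le> c"
  shows "asymp_le (\<lambda>n. c * X n) (c * a)"
proof (cases "c = 0")
  case True
  then show ?thesis by (simp add: asymp_leI_le)
next
  case False
  show ?thesis
    unfolding asymp_le_def
  proof (intro allI impI)
    fix \<eta> :: real assume "\<eta> > 0"
    then have "\<forall>\<^sub>F n in sequentially. X n \<le> a + \<eta>/c"
      using assms False by (auto simp: asymp_le_def)
    then show "\<forall>\<^sub>F n in sequentially. c * X n \<le> c * a + \<eta>"
      by eventually_elim (use assms(2) False in \<open>simp add: field_simps\<close>)
  qed
qed

lemma asymp_le_sum:
  assumes "\<And>i. i \<in> I \<Longrightarrow> asymp_le (X i) (c i)"
  shows "asymp_le (\<lambda>n. \<Sum>i\<in>I. X i n) (\<Sum>i\<in>I. c i)"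
proof (cases "finite I")
  case True
  then show ?thesis using assms
    by induct (auto intro: asymp_le_add asymp_leI_le)
qed (simp add: asymp_leI_le)

lemma asymp_le_tendsto_0:
  assumes "X \<longlonglongrightarrow> 0" shows "asymp_le X 0"
  unfolding asymp_le_def
proof (intro allI impI)
  fix \<eta> :: real assume "\<eta> > 0"
  then have "\<forall>\<^sub>F n in sequentially. X n < \<eta>" using order_tendstoD(2)[OF assms] by blast
  then show "\<forall>\<^sub>F n in sequentially. X n \<le> 0 + \<eta>" by eventually_elim simp
qed

lemma asymp_le_all_tendsto_0:
  assumes "\<And>j. asymp_le X (c / 2 ^ j)" "\<And>n. 0 \<le> X n"
  shows "X \<longlonglongrightarrow> 0"
proof (rule LIMSEQ_I)
  fix r :: real assume r: "r > 0"
  have "(\<lambda>j. c * (1/2) ^ j) \<longlonglongrightarrow> c * 0"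
    by (intro tendsto_mult tendsto_const LIMSEQ_realpow_zero) auto
  then have "\<forall>\<^sub>F j in sequentially. c * (1/2) ^ j < r/2"
    using r by (intro order_tendstoD(2)[where y=0]) auto
  then obtain j where "c / 2 ^ j < r/2"
    by (auto simp: eventually_sequentially power_divide)
  moreover have "\<forall>\<^sub>F n in sequentially. X n \<le> c / 2 ^ j + r/3"
    using assms(1)[of j] r by (simp add: asymp_le_def)
  ultimately have "\<forall>\<^sub>F n in sequentially. norm (X n - 0) < r"
    by (auto elim!: eventually_mono simp: assms(2)) (use r in linarith)
  then show "\<exists>no. \<forall>n\<ge>no. norm (X n - 0) < r"
    by (simp add: eventually_sequentially)
qed

lemma nonneg_summable_tail:
  fixes w :: "'a \<Rightarrow> real"
  assumes "w summable_on UNIV" "\<And>k. 0 \<le> w k" "\<eta> > 0"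
  obtains F where "finite F" "infsum w (-F) \<le> \<eta>"
proof -
  obtain F where F: "finite F" "dist (sum w F) (infsum w UNIV) \<le> \<eta>"
    using infsum_finite_approximation[OF assms(1,3)] by blast
  have "infsum w UNIV = infsum w F + infsum w (-F)"
    using F(1) assms(1)
    by (subst infsum_Un_disjoint[symmetric]) (auto intro: summable_on_subset_banach)
  with F show ?thesis by (intro that[of F]) (auto simp: dist_real_def)
qed

lemma bounded_mult_summable:
  fixes w a :: "'a \<Rightarrow> real"
  assumes "w summable_on A" "\<And>k. k \<in> A \<Longrightarrow> 0 \<le> w k" "\<And>k. k \<in> A \<Longrightarrow> 0 \<le> a k" "\<And>k. k \<in> A \<Longrightarrow> a k \<le> C"
  shows "(\<lambda>k. a k * w k) summable_on A" "infsum (\<lambda>k. a k * w k) A \<le> C * infsum w A"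
proof -
  have s: "(\<lambda>k. C * w k) summable_on A"
    using assms(1) by (rule summable_on_cmult_right)
  show 1: "(\<lambda>k. a k * w k) summable_on A"
    by (rule summable_on_comparison_test[OF s]) (auto intro!: mult_right_mono mult_nonneg_nonneg assms)
  have "infsum (\<lambda>k. a k * w k) A \<le> infsum (\<lambda>k. C * w k) A"
    by (rule infsum_mono[OF 1 s]) (auto intro!: mult_right_mono assms)
  also have "\<dots> = C * infsum w A" by (simp add: infsum_cmult_right')
  finally show "infsum (\<lambda>k. a k * w k) A \<le> C * infsum w A" .
qed

text \<open>
  Reverse Fatou: the upper limit passes under a sum with a summable weight, because the terms are
  uniformly bounded. Outside a finite set the weight carries little mass, and on the finite set the
  bounds hold simultaneously from some index on.
\<close>

lemma asymp_le_infsum: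
  fixes w :: "'a \<Rightarrow> real" and A :: "nat \<Rightarrow> 'a \<Rightarrow> real"
  assumes A: "\<And>k. asymp_le (\<lambda>n. A n k) c" "\<And>n k. 0 \<le> A n k" "\<And>n k. A n k \<le> B"
    and w: "w summable_on UNIV" "\<And>k. 0 \<le> w k"
  shows "asymp_le (\<lambda>n. \<Sum>\<^sub>\<infinity>k. A n k * w k) (c * infsum w UNIV)"
  unfolding asymp_le_def
proof (intro allI impI)
  fix \<eta> :: real assume \<eta>: "\<eta> > 0"
  define W where "W = infsum w UNIV"
  have W0: "0 \<le> W" unfolding W_def by (intro infsum_nonneg w)
  have B0: "0 \<le> B" using A(2,3)[of 0 undefined] by linarith
  \<comment> \<open>The bound \<open>c\<close> dominates the upper limit of a nonnegative sequence.\<close>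
  have c0: "0 \<le> c"
  proof (rule field_le_epsilon)
    fix e :: real assume "e > 0"
    then have "\<forall>\<^sub>F n in sequentially. A n undefined \<le> c + e"
      using A(1)[of undefined] by (auto simp: asymp_le_def)
    then obtain n where "A n undefined \<le> c + e"
      by (auto simp: eventually_sequentially)
    then show "0 \<le> c + e" using A(2)[of n undefined] by linarith
  qed
  obtain F where F: "finite F" "infsum w (-F) \<le> \<eta> / (2 * (B + 1))"
    using nonneg_summable_tail[OF w, of "\<eta> / (2 * (B + 1))"] \<eta> B0 by auto
  define e where "e = \<eta> / (2 * (W + 1))"
  have e0: "e > 0" using \<eta> W0 by (simp add: e_def)
  have tail: "B * infsum w (-F) \<le> \<eta> / 2"
  proof -
    have "B * infsum w (-F) \<le> B * (\<eta> / (2 * (B + 1)))" by (rule mult_left_mono[OF F(2) B0])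
    also have "\<dots> \<le> \<eta> / 2" using B0 \<eta> by (simp add: field_simps)
    finally show ?thesis .
  qed
  have eW: "e * W \<le> \<eta> / 2" using W0 \<eta> by (simp add: e_def field_simps)
  have "\<forall>\<^sub>F n in sequentially. \<forall>k\<in>F. A n k \<le> c + e"
    using F(1) A(1) e0 by (simp add: eventually_ball_finite asymp_le_def)
  then show "\<forall>\<^sub>F n in sequentially. (\<Sum>\<^sub>\<infinity>k. A n k * w k) \<le> c * infsum w UNIV + \<eta>"
  proof eventually_elim
    case (elim n)
    have sF: "w summable_on -F" "(\<lambda>k. A n k * w k) summable_on -F"
      using bounded_mult_summable(1)[OF w(1), of "A n" B] A w
      by (auto intro: summable_on_subset_banach)
    have "(\<Sum>\<^sub>\<infinity>k. A n k * w k) = (\<Sum>k\<in>F. A n k * w k) + (\<Sum>\<^sub>\<infinity>k\<in>-F. A n k * w k)"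
      using F(1) sF infsum_Un_disjoint[of "\<lambda>k. A n k * w k" F "-F"] by simp
    also have "(\<Sum>k\<in>F. A n k * w k) \<le> (\<Sum>k\<in>F. (c + e) * w k)"
      using elim w by (intro sum_mono mult_right_mono) auto
    also have "\<dots> \<le> (c + e) * W"
      unfolding W_def sum_distrib_left[symmetric]
      using c0 e0 by (intro mult_left_mono finite_sum_le_infsum w F) auto
    also have "(\<Sum>\<^sub>\<infinity>k\<in>-F. A n k * w k) \<le> B * infsum w (-F)"
      by (rule bounded_mult_summable(2)[OF sF(1)]) (auto simp: A w)
    finally show ?case using tail eW by (simp add: W_def algebra_simps)
  qed
qed

lemma asymp_le_infsum_bij:
  fixes w :: "'b \<Rightarrow> real" and A :: "nat \<Rightarrow> 'a \<Rightarrow> real"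
  assumes "\<And>k. asymp_le (\<lambda>n. A n k) c" "\<And>n k. 0 \<le> A n k" "\<And>n k. A n k \<le> B"
    and "w summable_on UNIV" "\<And>k. 0 \<le> w k" and \<sigma>: "bij \<sigma>"
  shows "asymp_le (\<lambda>n. \<Sum>\<^sub>\<infinity>k. A n k * w (\<sigma> k)) (c * infsum w UNIV)"
proof -
  have "infsum w UNIV = (\<Sum>\<^sub>\<infinity>k. w (\<sigma> k))"
    using infsum_reindex_bij_betw[OF \<sigma>, of w] by simp
  moreover have "(\<lambda>k. w (\<sigma> k)) summable_on UNIV"
    using summable_on_reindex_bij_betw[OF \<sigma>, of w] assms(4) by simp
  ultimately show ?thesis
    using asymp_le_infsum[of A c B "\<lambda>k. w (\<sigma> k)"] assms by simp
qed

section \<open>The frequency lattice\<close>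

lemma freq_0 [simp]: "freq 0 = 0"
  and freq_uminus: "freq (- k) = - freq k"
  and freq_diff: "freq (j - k) = freq j - freq k"
  by (simp_all add: freq_def vec_eq_iff)

lemma knorm_triangle: "knorm k \<le> knorm j + knorm (k - j)"
  using norm_triangle_ineq[of "freq j" "freq (k - j)"] by (simp add: freq_diff)

lemma component_le_knorm: "\<bar>real_of_int (k $ i)\<bar> \<le> knorm k"
  using component_le_norm_cart[of "freq k" i] by (simp add: freq_def)

lemma knorm_ge_1: "k \<noteq> 0 \<Longrightarrow> 1 \<le> knorm k"
proof -
  assume "k \<noteq> 0"
  then obtain i where "k $ i \<noteq> 0" by (auto simp: vec_eq_iff)
  then have "1 \<le> \<bar>real_of_int (k $ i)\<bar>" by linarith
  with component_le_knorm[of k i] show ?thesis by linarith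
qed

lemma finite_knorm_le: "finite {k :: int ^ 'd::finite. knorm k \<le> R}"
proof -
  let ?I = "{- \<lceil>\<bar>R\<bar>\<rceil>..\<lceil>\<bar>R\<bar>\<rceil>}"
  have "{k :: int ^ 'd. knorm k \<le> R} \<subseteq> {k. \<forall>i. k $ i \<in> ?I}"
  proof (clarsimp)
    fix k :: "int ^ 'd" and i assume "knorm k \<le> R"
    then have "\<bar>real_of_int (k $ i)\<bar> \<le> \<bar>R\<bar>" using component_le_knorm[of k i] by linarith
    then show "- \<lceil>\<bar>R\<bar>\<rceil> \<le> k $ i \<and> k $ i \<le> \<lceil>\<bar>R\<bar>\<rceil>" by linarith
  qed
  moreover have "finite {k :: int ^ 'd. \<forall>i. k $ i \<in> ?I}"
  proof -
    have "{k :: int ^ 'd. \<forall>i. k $ i \<in> ?I} \<subseteq> vec_lambda ` (PiE UNIV (\<lambda>_. ?I))"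
    proof
      fix k :: "int ^ 'd" assume "k \<in> {k. \<forall>i. k $ i \<in> ?I}"
      then have "($) k \<in> PiE UNIV (\<lambda>_. ?I)" by auto
      then show "k \<in> vec_lambda ` (PiE UNIV (\<lambda>_. ?I))"
        by (intro image_eqI[of _ _ "($) k"]) (simp_all add: vec_nth_inverse)
    qed
    then show ?thesis by (rule finite_subset) (simp add: finite_PiE)
  qed
  ultimately show ?thesis by (rule finite_subset)
qed

lemma infinite_lattice: "infinite (UNIV :: (int ^ 'd::finite) set)"
proof
  assume fin: "finite (UNIV :: (int ^ 'd) set)"
  have "inj (\<lambda>n::int. (\<chi> i. n) :: int ^ 'd)" by (auto intro!: injI simp: vec_eq_iff)
  then have "finite (UNIV :: int set)"
    by (rule finite_imageD[rotated]) (rule finite_subset[OF subset_UNIV fin])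
  then show False by simp
qed

lemma sum_abs_components_le_knorm: "(\<Sum>i\<in>UNIV. \<bar>real_of_int (k $ i)\<bar>) \<le> real CARD('d) * knorm (k :: int ^ 'd::finite)"
proof -
  have "(\<Sum>i\<in>UNIV. \<bar>real_of_int (k $ i)\<bar>) \<le> (\<Sum>i\<in>(UNIV :: 'd set). knorm k)"
    by (intro sum_mono component_le_knorm)
  then show ?thesis by simp
qed

lemma exp_int_summable:
  assumes "c > 0"
  shows "(\<lambda>j::int. exp (- (c * \<bar>real_of_int j\<bar>))) summable_on UNIV"
proof -
  let ?f = "\<lambda>j::int. exp (- (c * \<bar>real_of_int j\<bar>))"
  have geom: "(\<lambda>n::nat. exp (- c) ^ n) summable_on UNIV"
    using assms by (intro norm_summable_imp_summable_on) (simp add: summable_geometric)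
  have eq: "exp (- c) ^ n = exp (- (c * real n))" for n
    by (simp add: exp_of_nat_mult[symmetric] mult.commute)
  have "?f summable_on range int"
    using geom by (subst summable_on_reindex) (auto simp: o_def eq)
  moreover have "?f summable_on range (\<lambda>n. - int n)"
    using geom by (subst summable_on_reindex) (auto simp: o_def eq inj_def)
  ultimately have "?f summable_on (range int \<union> range (\<lambda>n. - int n))"
    by (rule summable_on_union)
  moreover have "range int \<union> range (\<lambda>n. - int n) = UNIV"
  proof (intro set_eqI iffI UNIV_I)
    fix x :: int show "x \<in> range int \<union> range (\<lambda>n. - int n)"
      by (cases x rule: int_cases2) auto
  qed
  ultimately show ?thesis by simp
qed

text \<open>
  The sum of the moduli of the components is at most the dimension times the Euclidean norm. So the
  exponential is bounded by a product of one-dimensional ones, whose sums over a box factorise.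
\<close>

lemma exp_knorm_summable:
  assumes c: "c > 0"
  shows "(\<lambda>k :: int ^ 'd::finite. exp (- (c * knorm k))) summable_on UNIV"
proof -
  define c' where "c' = c / CARD('d)"
  have c': "c' > 0" using c by (simp add: c'_def)
  let ?g = "\<lambda>j::int. exp (- (c' * \<bar>real_of_int j\<bar>))"
  define S where "S = infsum ?g UNIV"
  have le: "exp (- (c * knorm k)) \<le> (\<Prod>i\<in>UNIV. ?g (k $ i))" for k :: "int ^ 'd"
  proof -
    have "c' * (\<Sum>i\<in>UNIV. \<bar>real_of_int (k $ i)\<bar>) \<le> c' * (real CARD('d) * knorm k)"
      using c' by (intro mult_left_mono sum_abs_components_le_knorm) auto
    also have "\<dots> = c * knorm k" by (simp add: c'_def)
    finally have "exp (- (c * knorm k)) \<le> exp (- (\<Sum>i\<in>UNIV. c' * \<bar>real_of_int (k $ i)\<bar>))"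
      by (simp add: sum_distrib_left)
    also have "\<dots> = (\<Prod>i\<in>UNIV. ?g (k $ i))"
      by (simp add: sum_negf[symmetric] exp_sum)
    finally show ?thesis .
  qed
  show ?thesis
  proof (rule nonneg_bdd_above_summable_on)
    show "bdd_above (sum (\<lambda>k :: int ^ 'd. exp (- (c * knorm k))) ` {F. F \<subseteq> UNIV \<and> finite F})"
    proof (rule bdd_aboveI2)
      fix F :: "(int ^ 'd) set" assume "F \<in> {F. F \<subseteq> UNIV \<and> finite F}"
      then have fin: "finite F" by simp
      define I where "I = (\<Union>k\<in>F. range (($) k))"
      have finI: "finite I" using fin by (simp add: I_def)
      have "(\<Sum>k\<in>F. exp (- (c * knorm k))) \<le> (\<Sum>k\<in>F. \<Prod>i\<in>UNIV. ?g (k $ i))"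
        by (intro sum_mono le)
      also have "\<dots> = (\<Sum>h\<in>($) ` F. \<Prod>i\<in>UNIV. ?g (h i))"
        by (subst sum.reindex) (auto simp: inj_on_def vec_eq_iff)
      also have "\<dots> \<le> (\<Sum>h\<in>PiE (UNIV :: 'd set) (\<lambda>_. I). \<Prod>i\<in>UNIV. ?g (h i))"
        by (intro sum_mono2) (auto simp: finite_PiE finI, auto simp: I_def intro!: prod_nonneg)
      also have "\<dots> = (\<Prod>i\<in>(UNIV::'d set). \<Sum>j\<in>I. ?g j)"
        by (subst prod_sum_PiE) (auto simp: finI)
      also have "\<dots> \<le> (\<Prod>i\<in>(UNIV::'d set). S)"
        unfolding S_def using exp_int_summable[OF c'] finI
        by (intro prod_mono conjI sum_nonneg finite_sum_le_infsum) auto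
      finally show "(\<Sum>k\<in>F. exp (- (c * knorm k))) \<le> S ^ CARD('d)" by simp
    qed
  qed simp
qed

section \<open>Norms through majorants of the Fourier coefficients\<close>

text \<open>
  The summand of \<^const>\<open>norm_B\<close>. It serves as a time-independent majorant of the coefficients,
  and all estimates below are carried out on such majorants.
\<close>

definition coeff_sup :: "real \<Rightarrow> real \<Rightarrow> (real \<Rightarrow> 'd::finite coeffs) \<Rightarrow> int ^ 'd \<Rightarrow> real" where
  "coeff_sup \<beta> T f k = (SUP t\<in>{0..T}. exp (\<beta> * knorm k) * cmod (f t k))"

lemma norm_B_eq: "norm_B \<beta> T f = infsum (coeff_sup \<beta> T f) UNIV"
  by (simp add: norm_B_def coeff_sup_def[abs_def])

lemma in_B_measurable: "in_B \<beta> T f \<Longrightarrow> (\<lambda>t. f t k) \<in> borel_measurable (lebesgue_on {0..T})"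
  by (simp add: in_B_def real_measurable_coeffs_def)

lemma in_B_summable: "in_B \<beta> T f \<Longrightarrow> coeff_sup \<beta> T f summable_on UNIV"
  by (simp add: in_B_def coeff_sup_def[abs_def])

lemma le_coeff_sup:
  assumes "in_B \<beta> T f" "t \<in> {0..T}"
  shows "exp (\<beta> * knorm k) * cmod (f t k) \<le> coeff_sup \<beta> T f k"
  unfolding coeff_sup_def using assms by (intro cSUP_upper) (auto simp: in_B_def)

lemma coeff_sup_nonneg: "in_B \<beta> T f \<Longrightarrow> 0 \<le> T \<Longrightarrow> 0 \<le> coeff_sup \<beta> T f k"
  by (rule order_trans[OF _ le_coeff_sup[of \<beta> T f 0]]) auto

lemma cmod_le_coeff_sup:
  assumes "in_B \<beta> T f" "t \<in> {0..T}" "0 \<le> \<beta>"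
  shows "cmod (f t k) \<le> coeff_sup \<beta> T f k"
proof -
  have "1 * cmod (f t k) \<le> exp (\<beta> * knorm k) * cmod (f t k)"
    using assms by (intro mult_right_mono) auto
  with le_coeff_sup[OF assms(1,2), of k] show ?thesis by linarith
qed

lemma norm_B_nonneg: "in_B \<beta> T f \<Longrightarrow> 0 \<le> T \<Longrightarrow> 0 \<le> norm_B \<beta> T f"
  unfolding norm_B_eq by (intro infsum_nonneg coeff_sup_nonneg)

lemma majorant_norm_B:
  assumes T: "0 \<le> T" and le: "\<And>t k. t \<in> {0..T} \<Longrightarrow> exp (\<beta> * knorm k) * cmod (f t k) \<le> w k"
    and w: "w summable_on UNIV"
  shows "norm_B \<beta> T f \<le> infsum w UNIV"
proof -
  have b: "bdd_above ((\<lambda>t. exp (\<beta> * knorm k) * cmod (f t k)) ` {0..T})" for k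
    by (rule bdd_aboveI2[where M = "w k"]) (rule le)
  have le': "coeff_sup \<beta> T f k \<le> w k" for k
    unfolding coeff_sup_def using T by (intro cSUP_least le) auto
  have nn: "0 \<le> coeff_sup \<beta> T f k" for k
    unfolding coeff_sup_def using T by (intro cSUP_upper2[OF b, of 0]) auto
  have "coeff_sup \<beta> T f summable_on UNIV"
    by (rule summable_on_comparison_test[OF w]) (auto intro: le' nn)
  then show ?thesis
    unfolding norm_B_eq using w by (rule infsum_mono) (rule le')
qed

lemma in_B_diff:
  assumes f: "in_B \<beta> T f" and g: "in_B \<beta> T g" and T: "0 \<le> T"
  shows "in_B \<beta> T (\<lambda>t k. f t k - g t k)"
proof -
  let ?w = "\<lambda>k. coeff_sup \<beta> T f k + coeff_sup \<beta> T g k"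
  have le: "exp (\<beta> * knorm k) * cmod (f t k - g t k) \<le> ?w k" if "t \<in> {0..T}" for t k
  proof -
    have "exp (\<beta> * knorm k) * cmod (f t k - g t k)
        \<le> exp (\<beta> * knorm k) * (cmod (f t k) + cmod (g t k))"
      by (intro mult_left_mono norm_triangle_ineq4) auto
    with le_coeff_sup[OF f that, of k] le_coeff_sup[OF g that, of k] show ?thesis
      by (simp add: distrib_left)
  qed
  have w: "?w summable_on UNIV" using f g by (intro summable_on_add in_B_summable)
  have b: "bdd_above ((\<lambda>t. exp (\<beta> * knorm k) * cmod (f t k - g t k)) ` {0..T})" for k
    by (rule bdd_aboveI2[where M = "?w k"]) (rule le)
  have "(\<lambda>k. SUP t\<in>{0..T}. exp (\<beta> * knorm k) * cmod (f t k - g t k)) summable_on UNIV"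
  proof (rule summable_on_comparison_test[OF w])
    fix k
    show "(SUP t\<in>{0..T}. exp (\<beta> * knorm k) * cmod (f t k - g t k)) \<le> ?w k"
      using T by (intro cSUP_least le) auto
    show "0 \<le> (SUP t\<in>{0..T}. exp (\<beta> * knorm k) * cmod (f t k - g t k))"
      using T by (intro cSUP_upper2[OF b, of 0]) auto
  qed
  moreover have "real_measurable_coeffs T (\<lambda>t k. f t k - g t k)"
    using f g by (auto simp: in_B_def real_measurable_coeffs_def real_coeffs_def
        intro!: borel_measurable_diff)
  ultimately show ?thesis using b by (simp add: in_B_def)
qed

lemma norm_Bvec_nonneg: "in_Bvec \<beta> T v \<Longrightarrow> 0 \<le> T \<Longrightarrow> 0 \<le> norm_Bvec \<beta> T v"
  unfolding norm_Bvec_def in_Bvec_def by (intro sum_nonneg norm_B_nonneg) auto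

lemma in_Bvec_diff:
  assumes "in_Bvec \<beta> T v" "in_Bvec \<beta> T w" "0 \<le> T"
  shows "in_Bvec \<beta> T (\<lambda>t k. v t k - w t k)"
  using assms unfolding in_Bvec_def by (auto intro: in_B_diff)

lemma norm_B_diff_le:
  assumes f: "in_B \<beta> T f" and g: "in_B \<beta> T g" and T: "0 \<le> T"
  shows "norm_B \<beta> T (\<lambda>t k. f t k - g t k) \<le> norm_B \<beta> T f + norm_B \<beta> T g"
proof -
  have "norm_B \<beta> T (\<lambda>t k. f t k - g t k) \<le> (\<Sum>\<^sub>\<infinity>k. coeff_sup \<beta> T f k + coeff_sup \<beta> T g k)"
  proof (rule majorant_norm_B[OF T])
    fix t k assume t: "t \<in> {0..T}"
    have "exp (\<beta> * knorm k) * cmod (f t k - g t k)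
        \<le> exp (\<beta> * knorm k) * (cmod (f t k) + cmod (g t k))"
      by (intro mult_left_mono norm_triangle_ineq4) auto
    with le_coeff_sup[OF f t, of k] le_coeff_sup[OF g t, of k]
    show "exp (\<beta> * knorm k) * cmod (f t k - g t k) \<le> coeff_sup \<beta> T f k + coeff_sup \<beta> T g k"
      by (simp add: distrib_left)
  qed (intro summable_on_add in_B_summable f g)
  also have "\<dots> = norm_B \<beta> T f + norm_B \<beta> T g"
    unfolding norm_B_eq by (intro infsum_add in_B_summable f g)
  finally show ?thesis .
qed

lemma norm_Bvec_diff_le:
  assumes "in_Bvec \<beta> T v" "in_Bvec \<beta> T w" "0 \<le> T"
  shows "norm_Bvec \<beta> T (\<lambda>t k. v t k - w t k) \<le> norm_Bvec \<beta> T v + norm_Bvec \<beta> T w"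
  using assms unfolding norm_Bvec_def in_Bvec_def
  by (auto simp: sum.distrib[symmetric] intro!: sum_mono norm_B_diff_le)

lemma in_PMt_measurable: "in_PMt \<alpha> T m \<Longrightarrow> (\<lambda>t. m t k) \<in> borel_measurable (lebesgue_on {0..T})"
  by (simp add: in_PMt_def real_measurable_coeffs_def)

lemma in_PMt_real: "in_PMt \<alpha> T m \<Longrightarrow> t \<in> {0..T} \<Longrightarrow> real_coeffs (m t)"
  by (simp add: in_PMt_def real_measurable_coeffs_def)

lemma le_norm_PMt:
  assumes "in_PMt \<alpha> T m" "t \<in> {0..T}"
  shows "exp (\<alpha> * t * knorm k) * cmod (m t k) \<le> norm_PMt \<alpha> T m"
proof -
  have "(\<lambda>(k, t). exp (\<alpha> * t * knorm k) * cmod (m t k)) (k, t) \<le> norm_PMt \<alpha> T m"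
    unfolding norm_PMt_def using assms by (intro cSUP_upper) (auto simp: in_PMt_def)
  then show ?thesis by simp
qed

lemma cmod_le_norm_PMt:
  assumes "in_PMt \<alpha> T m" "t \<in> {0..T}" "0 \<le> \<alpha>"
  shows "cmod (m t k) \<le> norm_PMt \<alpha> T m"
proof -
  have "1 * cmod (m t k) \<le> exp (\<alpha> * t * knorm k) * cmod (m t k)"
    using assms by (intro mult_right_mono) auto
  with le_norm_PMt[OF assms(1,2), of k] show ?thesis by linarith
qed

lemma in_PM_of_in_PMt:
  assumes "in_PMt \<alpha> T m" "0 \<le> T"
  shows "in_PM (\<alpha> * T) (m T)" "norm_PM (\<alpha> * T) (m T) \<le> norm_PMt \<alpha> T m"
proof -
  have *: "exp (\<alpha> * T * knorm k) * cmod (m T k) \<le> norm_PMt \<alpha> T m" for k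
    using assms by (intro le_norm_PMt) auto
  then show "in_PM (\<alpha> * T) (m T)"
    unfolding in_PM_def using in_PMt_real[OF assms(1), of T] assms(2)
    by (auto intro!: bdd_aboveI2)
  show "norm_PM (\<alpha> * T) (m T) \<le> norm_PMt \<alpha> T m"
    unfolding norm_PM_def by (intro cSUP_least *) auto
qed

section \<open>Pairings and convolutions\<close>

lemma infsum_mult_majorant:
  fixes f g :: "'a \<Rightarrow> complex"
  assumes w: "w summable_on UNIV" and f: "\<And>k. cmod (f k) \<le> w k"
    and g: "\<And>k. cmod (g k) \<le> a k" "\<And>k. a k \<le> C"
  shows "(\<lambda>k. g k * f k) summable_on UNIV" "cmod (\<Sum>\<^sub>\<infinity>k. g k * f k) \<le> (\<Sum>\<^sub>\<infinity>k. a k * w k)"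
proof -
  have w0: "0 \<le> w k" for k using f[of k] norm_ge_zero order_trans by blast
  have a0: "0 \<le> a k" for k using g(1)[of k] norm_ge_zero order_trans by blast
  have s: "(\<lambda>k. a k * w k) summable_on UNIV"
    by (rule bounded_mult_summable(1)[OF w, of _ C]) (auto simp: w0 a0 g)
  have le: "cmod (g k * f k) \<le> a k * w k" for k
    unfolding norm_mult by (intro mult_mono f g a0) auto
  have "(\<lambda>k. cmod (g k * f k)) summable_on UNIV"
    by (rule summable_on_comparison_test[OF s]) (auto intro: le)
  then show "(\<lambda>k. g k * f k) summable_on UNIV" by (rule abs_summable_summable)
  then show "cmod (\<Sum>\<^sub>\<infinity>k. g k * f k) \<le> (\<Sum>\<^sub>\<infinity>k. a k * w k)"
    by (rule norm_infsum_le[OF has_sum_infsum has_sum_infsum[OF s]]) (rule le)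
qed

lemma bij_uminus_lattice: "bij (uminus :: int ^ 'd \<Rightarrow> int ^ 'd)"
  by (rule bij_uminus)

lemma bij_reflect: "bij (\<lambda>j. k - j :: int ^ 'd)"
  by (rule o_bij[of "\<lambda>j. k - j"]) auto

lemma summable_on_reflect:
  fixes w :: "int ^ 'd \<Rightarrow> real"
  shows "w summable_on UNIV \<Longrightarrow> (\<lambda>j. w (k - j)) summable_on UNIV"
  using summable_on_reindex_bij_betw[OF bij_reflect, of w k] by simp

lemma infsum_reflect:
  fixes w :: "int ^ 'd \<Rightarrow> real"
  shows "(\<Sum>\<^sub>\<infinity>j. w (k - j)) = infsum w UNIV"
  using infsum_reindex_bij_betw[OF bij_reflect, of w k] by simp

lemma pairing_bound:
  assumes w: "w summable_on UNIV" and f: "\<And>k. cmod (f k) \<le> w k"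
    and g: "\<And>k. cmod (m k) \<le> a k" "\<And>k. a k \<le> C"
  shows "(\<lambda>k. f k * m (- k)) summable_on UNIV"
    "cmod (pairing f m) \<le> (\<Sum>\<^sub>\<infinity>k. a (- k) * w k)"
    "cmod (pairing f m) \<le> C * infsum w UNIV"
proof -
  have w0: "0 \<le> w k" for k using f[of k] norm_ge_zero order_trans by blast
  have a0: "0 \<le> a k" for k using g(1)[of k] norm_ge_zero order_trans by blast
  note * = infsum_mult_majorant[OF w f, of "\<lambda>k. m (- k)" "\<lambda>k. a (- k)" C]
  show "(\<lambda>k. f k * m (- k)) summable_on UNIV" using *(1) g by (simp add: mult.commute)
  show 1: "cmod (pairing f m) \<le> (\<Sum>\<^sub>\<infinity>k. a (- k) * w k)"
    using *(2) g by (simp add: pairing_def mult.commute)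
  also have "\<dots> \<le> C * infsum w UNIV"
    by (rule bounded_mult_summable(2)[OF w]) (auto simp: w0 a0 g)
  finally show "cmod (pairing f m) \<le> C * infsum w UNIV" .
qed

lemma conv_bound:
  assumes w: "w summable_on UNIV" and h: "\<And>k. cmod (h k) \<le> w k"
    and m: "\<And>k. cmod (m k) \<le> a k" "\<And>k. a k \<le> C"
  shows "(\<lambda>j. m j * h (k - j)) summable_on UNIV"
    "cmod (conv m h k) \<le> C * infsum w UNIV"
proof -
  have w0: "0 \<le> w k" for k using h[of k] norm_ge_zero order_trans by blast
  have a0: "0 \<le> a k" for k using m(1)[of k] norm_ge_zero order_trans by blast
  note * = infsum_mult_majorant[OF summable_on_reflect[OF w, of k], of "\<lambda>j. h (k - j)" m a C]
  show "(\<lambda>j. m j * h (k - j)) summable_on UNIV" using * h m by simp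
  have "cmod (conv m h k) \<le> (\<Sum>\<^sub>\<infinity>j. a j * w (k - j))"
    using * h m by (simp add: conv_def)
  also have "\<dots> \<le> C * (\<Sum>\<^sub>\<infinity>j. w (k - j))"
    by (rule bounded_mult_summable(2)[OF summable_on_reflect[OF w]]) (auto simp: w0 a0 m)
  finally show "cmod (conv m h k) \<le> C * infsum w UNIV" by (simp add: infsum_reflect)
qed

text \<open>
  The exponential weight is submultiplicative along \<open>k = j + (k - j)\<close>, and the factor \<open>h\<close> has the full
  weight \<open>exp (\<alpha> T |k|)\<close> to spare, since \<open>s \<le> T\<close>. So the convolution keeps the weight at time \<open>s\<close>.
\<close>

lemma weighted_conv_bound:
  fixes h m :: "'d::finite coeffs"
  assumes s: "0 \<le> s" "s \<le> T" and \<alpha>: "0 \<le> \<alpha>"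
    and w: "w summable_on UNIV" and h: "\<And>k. exp (\<alpha> * T * knorm k) * cmod (h k) \<le> w k"
    and m: "\<And>k. exp (\<alpha> * s * knorm k) * cmod (m k) \<le> a k" "\<And>k. a k \<le> C"
  shows "exp (\<alpha> * s * knorm k) * cmod (conv m h k) \<le> (\<Sum>\<^sub>\<infinity>j. a j * w (k - j))"
proof -
  let ?m = "\<lambda>j. of_real (exp (\<alpha> * s * knorm j)) * m j"
  let ?h = "\<lambda>j. of_real (exp (\<alpha> * s * (knorm k - knorm j))) * h (k - j)"
  have "exp (\<alpha> * s * (knorm k - knorm j)) \<le> exp (\<alpha> * T * knorm (k - j))" for j
  proof -
    have "\<alpha> * s * (knorm k - knorm j) \<le> \<alpha> * s * knorm (k - j)"
      using knorm_triangle[of k j] s \<alpha> by (intro mult_left_mono) auto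
    also have "\<dots> \<le> \<alpha> * T * knorm (k - j)"
      using s \<alpha> by (intro mult_right_mono mult_left_mono) auto
    finally show ?thesis by simp
  qed
  then have h': "cmod (?h j) \<le> w (k - j)" for j
    using order_trans[OF mult_right_mono h[of "k - j"], of "exp (\<alpha> * s * (knorm k - knorm j))"]
    by (simp add: norm_mult)
  have "cmod (\<Sum>\<^sub>\<infinity>j. ?m j * ?h j) \<le> (\<Sum>\<^sub>\<infinity>j. a j * w (k - j))"
    by (rule infsum_mult_majorant(2)[OF summable_on_reflect[OF w] h', of ?m a C])
       (use m in \<open>auto simp: norm_mult\<close>)
  also have "(\<lambda>j. ?m j * ?h j) = (\<lambda>j. of_real (exp (\<alpha> * s * knorm k)) * (m j * h (k - j)))"
  proof
    fix j :: "int ^ 'd"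
    have "exp (\<alpha> * s * knorm k) = exp (\<alpha> * s * knorm j) * exp (\<alpha> * s * (knorm k - knorm j))"
      by (simp add: exp_add[symmetric] algebra_simps)
    then show "?m j * ?h j = of_real (exp (\<alpha> * s * knorm k)) * (m j * h (k - j))" by simp
  qed
  finally show ?thesis by (simp add: infsum_cmult_right' conv_def norm_mult)
qed

lemma conv_diff:
  assumes w: "wa summable_on UNIV" "\<And>k. cmod (ha k) \<le> wa k" "wb summable_on UNIV" "\<And>k. cmod (hb k) \<le> wb k"
    and m: "\<And>k. cmod (ma k) \<le> C" "\<And>k. cmod (mb k) \<le> C"
  shows "conv ma ha k - conv mb hb k = conv (\<lambda>j. ma j - mb j) hb k + conv ma (\<lambda>j. ha j - hb j) k"
proof -
  have d: "cmod (ma j - mb j) \<le> C + C" for j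
    using norm_triangle_ineq4[of "ma j" "mb j"] m[of j] by linarith
  have e: "cmod (ha j - hb j) \<le> wa j + wb j" for j
    using norm_triangle_ineq4[of "ha j" "hb j"] w(2,4)[of j] by linarith
  have s: "(\<lambda>j. ma j * ha (k - j)) summable_on UNIV" "(\<lambda>j. mb j * hb (k - j)) summable_on UNIV"
    "(\<lambda>j. (ma j - mb j) * hb (k - j)) summable_on UNIV"
    "(\<lambda>j. ma j * (ha (k - j) - hb (k - j))) summable_on UNIV"
    using conv_bound(1)[OF w(1,2), of ma "\<lambda>_. C" C k] conv_bound(1)[OF w(3,4), of mb "\<lambda>_. C" C k]
      conv_bound(1)[OF w(3,4), of "\<lambda>j. ma j - mb j" "\<lambda>_. C + C" "C + C" k]
      conv_bound(1)[OF summable_on_add[OF w(1,3)] e, of ma "\<lambda>_. C" C k] m d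
    by auto
  have "(\<Sum>\<^sub>\<infinity>j. ma j * ha (k - j)) + (\<Sum>\<^sub>\<infinity>j. - (mb j * hb (k - j)))
      = (\<Sum>\<^sub>\<infinity>j. ma j * ha (k - j) + - (mb j * hb (k - j)))"
    using s by (subst infsum_add) (auto simp: summable_on_uminus)
  also have "\<dots> = (\<Sum>\<^sub>\<infinity>j. (ma j - mb j) * hb (k - j) + ma j * (ha (k - j) - hb (k - j)))"
    by (simp add: algebra_simps)
  also have "\<dots> = (\<Sum>\<^sub>\<infinity>j. (ma j - mb j) * hb (k - j)) + (\<Sum>\<^sub>\<infinity>j. ma j * (ha (k - j) - hb (k - j)))"
    using s by (intro infsum_add)
  finally show ?thesis by (simp add: conv_def infsum_uminus)
qed

lemma pairing_diff_left:
  assumes w: "wa summable_on UNIV" "\<And>k. cmod (fa k) \<le> wa k" "wb summable_on UNIV" "\<And>k. cmod (fb k) \<le> wb k"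
    and m: "\<And>k. cmod (m k) \<le> C"
  shows "pairing fa m - pairing fb m = pairing (\<lambda>j. fa j - fb j) m"
proof -
  have s: "(\<lambda>k. fa k * m (- k)) summable_on UNIV" "(\<lambda>k. fb k * m (- k)) summable_on UNIV"
    using pairing_bound(1)[OF w(1,2), of m "\<lambda>_. C" C] pairing_bound(1)[OF w(3,4), of m "\<lambda>_. C" C] m
    by auto
  have "pairing (\<lambda>j. fa j - fb j) m = (\<Sum>\<^sub>\<infinity>k. fa k * m (- k) + - (fb k * m (- k)))"
    by (simp add: pairing_def left_diff_distrib)
  also have "\<dots> = (\<Sum>\<^sub>\<infinity>k. fa k * m (- k)) + (\<Sum>\<^sub>\<infinity>k. - (fb k * m (- k)))"
    using s by (intro infsum_add) (auto simp: summable_on_uminus)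
  finally show ?thesis by (simp add: pairing_def infsum_uminus)
qed

lemma pairing_diff_right:
  assumes w: "w summable_on UNIV" "\<And>k. cmod (f k) \<le> w k"
    and m: "\<And>k. cmod (ma k) \<le> C" "\<And>k. cmod (mb k) \<le> C"
  shows "pairing f ma - pairing f mb = pairing f (\<lambda>j. ma j - mb j)"
proof -
  have s: "(\<lambda>k. f k * ma (- k)) summable_on UNIV" "(\<lambda>k. f k * mb (- k)) summable_on UNIV"
    using pairing_bound(1)[OF w, of ma "\<lambda>_. C" C] pairing_bound(1)[OF w, of mb "\<lambda>_. C" C] m
    by auto
  have "pairing f (\<lambda>j. ma j - mb j) = (\<Sum>\<^sub>\<infinity>k. f k * ma (- k) + - (f k * mb (- k)))"
    by (simp add: pairing_def right_diff_distrib)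
  also have "\<dots> = (\<Sum>\<^sub>\<infinity>k. f k * ma (- k)) + (\<Sum>\<^sub>\<infinity>k. - (f k * mb (- k)))"
    using s by (intro infsum_add) (auto simp: summable_on_uminus)
  finally show ?thesis by (simp add: pairing_def infsum_uminus)
qed

lemma pairing_term_bound:
  assumes f: "in_B \<beta> T f" "0 \<le> \<beta>" and t: "t \<in> {0..T}" and m: "\<And>k. cmod (m k) \<le> C"
  shows "cmod (pairing (f t) m) \<le> C * norm_B \<beta> T f"
  unfolding norm_B_eq
  by (rule pairing_bound(3)[OF in_B_summable[OF f(1)], of _ _ "\<lambda>_. C"])
     (auto intro: cmod_le_coeff_sup f t m)

lemma ham_coeff_bound:
  assumes "in_B \<beta> T f" "in_B \<beta> T g" "0 \<le> \<beta>" and t: "t \<in> {0..T}" and m: "\<And>k. cmod (m k) \<le> C"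
  shows "exp (\<beta> * knorm k) * cmod (g t k * pairing (f t) m) \<le> coeff_sup \<beta> T g k * (C * norm_B \<beta> T f)"
proof -
  have "exp (\<beta> * knorm k) * cmod (g t k * pairing (f t) m)
      = (exp (\<beta> * knorm k) * cmod (g t k)) * cmod (pairing (f t) m)"
    by (simp add: norm_mult)
  also have "\<dots> \<le> coeff_sup \<beta> T g k * (C * norm_B \<beta> T f)"
    using t by (intro mult_mono le_coeff_sup pairing_term_bound coeff_sup_nonneg assms) auto
  finally show ?thesis .
qed

text \<open>
  The product \<open>g \<langle>f, m\<rangle>\<close> is changed one factor at a time, \<open>g\<close> first, then \<open>f\<close>, then \<open>m\<close>. In this order
  the difference of the densities is tested only against \<open>fb\<close> and multiplied only by \<open>gb\<close>, which
  will be the data of the limit solution.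
\<close>

lemma ham_diff_coeff_bound:
  assumes f: "in_B \<beta> T fa" "in_B \<beta> T fb" and g: "in_B \<beta> T ga" "in_B \<beta> T gb" and \<beta>: "0 \<le> \<beta>"
    and t: "t \<in> {0..T}" and m: "\<And>k. cmod (ma k) \<le> C" "\<And>k. cmod (mb k) \<le> C"
    and A: "\<And>k. cmod (ma k - mb k) \<le> A k" "\<And>k. A k \<le> B"
  shows "exp (\<beta> * knorm k) * cmod (ga t k * pairing (fa t) ma - gb t k * pairing (fb t) mb)
    \<le> coeff_sup \<beta> T (\<lambda>t k. ga t k - gb t k) k * (C * norm_B \<beta> T fa)
      + coeff_sup \<beta> T gb k * (C * norm_B \<beta> T (\<lambda>t k. fa t k - fb t k)
          + (\<Sum>\<^sub>\<infinity>j. A (- j) * coeff_sup \<beta> T fb j))"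
proof -
  have T: "0 \<le> T" using t by auto
  define e where "e = exp (\<beta> * knorm k)"
  define \<delta>g where "\<delta>g = ga t k - gb t k"
  define q where "q = (\<Sum>\<^sub>\<infinity>j. A (- j) * coeff_sup \<beta> T fb j)"
  note sf = in_B_summable[OF f(1)] cmod_le_coeff_sup[OF f(1) t \<beta>]
    in_B_summable[OF f(2)] cmod_le_coeff_sup[OF f(2) t \<beta>]
  have e1: "pairing (fa t) ma - pairing (fb t) ma = pairing (\<lambda>j. fa t j - fb t j) ma"
    by (rule pairing_diff_left[OF sf m(1)])
  have e2: "pairing (fb t) ma - pairing (fb t) mb = pairing (fb t) (\<lambda>j. ma j - mb j)"
    by (rule pairing_diff_right[OF sf(3,4) m])
  have b1: "cmod (pairing (\<lambda>j. fa t j - fb t j) ma) \<le> C * norm_B \<beta> T (\<lambda>t k. fa t k - fb t k)"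
    by (rule pairing_term_bound[OF in_B_diff[OF f T] \<beta> t m(1)])
  have b2: "cmod (pairing (fb t) (\<lambda>j. ma j - mb j)) \<le> q"
    unfolding q_def by (rule pairing_bound(2)[OF sf(3,4) A])
  have b3: "cmod (pairing (fa t) ma) \<le> C * norm_B \<beta> T fa"
    by (rule pairing_term_bound[OF f(1) \<beta> t m(1)])
  have d1: "e * cmod \<delta>g \<le> coeff_sup \<beta> T (\<lambda>t k. ga t k - gb t k) k"
    unfolding e_def \<delta>g_def using le_coeff_sup[OF in_B_diff[OF g T] t] by simp
  have d2: "e * cmod (gb t k) \<le> coeff_sup \<beta> T gb k"
    unfolding e_def by (rule le_coeff_sup[OF g(2) t])
  have "ga t k * pairing (fa t) ma - gb t k * pairing (fb t) mb
      = \<delta>g * pairing (fa t) ma + gb t k * ((pairing (fa t) ma - pairing (fb t) ma)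
          + (pairing (fb t) ma - pairing (fb t) mb))"
    by (simp add: \<delta>g_def algebra_simps)
  also have "cmod \<dots> \<le> cmod \<delta>g * cmod (pairing (fa t) ma)
      + cmod (gb t k) * (cmod (pairing (\<lambda>j. fa t j - fb t j) ma) + cmod (pairing (fb t) (\<lambda>j. ma j - mb j)))"
    unfolding e1 e2
    by (rule order_trans[OF norm_triangle_ineq])
       (auto simp: norm_mult intro!: add_mono mult_left_mono norm_triangle_ineq)
  finally have "e * cmod (ga t k * pairing (fa t) ma - gb t k * pairing (fb t) mb)
     \<le> e * (cmod \<delta>g * cmod (pairing (fa t) ma)
      + cmod (gb t k) * (cmod (pairing (\<lambda>j. fa t j - fb t j) ma) + cmod (pairing (fb t) (\<lambda>j. ma j - mb j))))"
    by (rule mult_left_mono) (simp add: e_def)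
  also have "\<dots> = (e * cmod \<delta>g) * cmod (pairing (fa t) ma)
      + (e * cmod (gb t k)) * (cmod (pairing (\<lambda>j. fa t j - fb t j) ma) + cmod (pairing (fb t) (\<lambda>j. ma j - mb j)))"
    by (simp add: algebra_simps)
  also have "\<dots> \<le> coeff_sup \<beta> T (\<lambda>t k. ga t k - gb t k) k * (C * norm_B \<beta> T fa)
      + coeff_sup \<beta> T gb k * (C * norm_B \<beta> T (\<lambda>t k. fa t k - fb t k) + q)"
    using b1 b2 b3 d1 d2 T
    by (intro add_mono mult_mono coeff_sup_nonneg in_B_diff f g) auto
  finally show ?thesis by (simp add: e_def q_def)
qed

section \<open>Measurability and the heat kernel\<close>

text \<open>
  Measurability in time is what makes the Duhamel integrands integrable. Without integrability the
  difference of two Henstock-Kurzweil integrals could not be merged into one.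
\<close>

lemma borel_measurable_infsum_lattice:
  fixes f :: "'a \<Rightarrow> int ^ 'd::finite \<Rightarrow> complex"
  assumes m: "\<And>k. (\<lambda>s. f s k) \<in> borel_measurable N"
    and s: "\<And>s. s \<in> space N \<Longrightarrow> f s summable_on UNIV"
  shows "(\<lambda>s. \<Sum>\<^sub>\<infinity>k. f s k) \<in> borel_measurable N"
proof -
  define \<phi> where "\<phi> = from_nat_into (UNIV :: (int ^ 'd) set)"
  have \<phi>: "bij \<phi>"
    unfolding \<phi>_def by (rule bij_betw_from_nat_into) (auto simp: infinite_lattice)
  show ?thesis
  proof (rule borel_measurable_LIMSEQ_metric)
    show "(\<lambda>s. \<Sum>i<n. f s (\<phi> i)) \<in> borel_measurable N" for n
      by (intro borel_measurable_sum m)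
    fix s assume "s \<in> space N"
    then have "(f s has_sum (\<Sum>\<^sub>\<infinity>k. f s k)) UNIV"
      by (intro has_sum_infsum s)
    then have "((\<lambda>i. f s (\<phi> i)) has_sum (\<Sum>\<^sub>\<infinity>k. f s k)) UNIV"
      using has_sum_reindex_bij_betw[OF \<phi>, of "f s"] by simp
    then show "(\<lambda>n. \<Sum>i<n. f s (\<phi> i)) \<longlonglongrightarrow> (\<Sum>\<^sub>\<infinity>k. f s k)"
      using has_sum_imp_sums sums_def by blast
  qed
qed

lemma integrable_on_of_bounded_measurable:
  fixes F :: "real \<Rightarrow> complex"
  assumes F: "F \<in> borel_measurable (lebesgue_on {0..T})" and ab: "0 \<le> a" "b \<le> T"
    and le: "\<And>s. s \<in> {a..b} \<Longrightarrow> cmod (F s) \<le> C"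
  shows "F integrable_on {a..b}"
proof (rule measurable_bounded_by_integrable_imp_integrable)
  show "F \<in> borel_measurable (lebesgue_on {a..b})"
    using ab by (intro measurable_restrict_mono[OF F]) auto
  show "(\<lambda>_. C) integrable_on {a..b}" by (rule integrable_const_ivl)
qed (use le in auto)

lemma integral_exp_kernel_le:
  fixes F :: "real \<Rightarrow> complex"
  assumes "a \<le> b" "0 < \<rho>" "0 \<le> C" "F integrable_on {a..b}"
    and le: "\<And>s. s \<in> {a..b} \<Longrightarrow> cmod (F s) \<le> C * exp (- (\<rho> * (b - s)))"
  shows "cmod (integral {a..b} F) \<le> C / \<rho>"
proof -
  let ?P = "\<lambda>s. C / \<rho> * exp (- (\<rho> * (b - s)))"
  have "((\<lambda>s. C * exp (- (\<rho> * (b - s)))) has_integral (?P b - ?P a)) {a..b}"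
    using assms(1,2)
    by (intro fundamental_theorem_of_calculus)
       (auto intro!: derivative_eq_intros simp flip: has_real_derivative_iff_has_vector_derivative)
  then have I: "(\<lambda>s. C * exp (- (\<rho> * (b - s)))) integrable_on {a..b}"
    "integral {a..b} (\<lambda>s. C * exp (- (\<rho> * (b - s)))) = ?P b - ?P a"
    using integral_unique by blast+
  have "cmod (integral {a..b} F) \<le> ?P b - ?P a"
    unfolding I(2)[symmetric] by (rule integral_norm_bound_integral[OF assms(4) I(1) le])
  also have "\<dots> \<le> C / \<rho>" using assms(2,3) by simp
  finally show ?thesis .
qed

lemma integral_exp_kernel_le':
  fixes F :: "real \<Rightarrow> complex"
  assumes "a \<le> b" "0 < \<rho>" "0 \<le> C" "F integrable_on {a..b}"
    and le: "\<And>s. s \<in> {a..b} \<Longrightarrow> cmod (F s) \<le> C * exp (- (\<rho> * (s - a)))"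
  shows "cmod (integral {a..b} F) \<le> C / \<rho>"
proof -
  let ?P = "\<lambda>s. - (C / \<rho>) * exp (- (\<rho> * (s - a)))"
  have "((\<lambda>s. C * exp (- (\<rho> * (s - a)))) has_integral (?P b - ?P a)) {a..b}"
    using assms(1,2)
    by (intro fundamental_theorem_of_calculus)
       (auto intro!: derivative_eq_intros simp flip: has_real_derivative_iff_has_vector_derivative)
  then have I: "(\<lambda>s. C * exp (- (\<rho> * (s - a)))) integrable_on {a..b}"
    "integral {a..b} (\<lambda>s. C * exp (- (\<rho> * (s - a)))) = ?P b - ?P a"
    using integral_unique by blast+
  have "cmod (integral {a..b} F) \<le> ?P b - ?P a"
    unfolding I(2)[symmetric] by (rule integral_norm_bound_integral[OF assms(4) I(1) le])
  also have "\<dots> \<le> C / \<rho>" using assms(2,3) by simp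
  finally show ?thesis .
qed

lemma ham_measurable:
  assumes f: "in_B \<beta> T f" and g: "in_B \<beta> T g" and \<beta>: "0 \<le> \<beta>"
    and m: "in_PMt \<alpha> T m" and \<alpha>: "0 \<le> \<alpha>"
  shows "(\<lambda>s. g s k * pairing (f s) (m s)) \<in> borel_measurable (lebesgue_on {0..T})"
proof -
  have "(\<lambda>s. pairing (f s) (m s)) \<in> borel_measurable (lebesgue_on {0..T})"
    unfolding pairing_def
  proof (rule borel_measurable_infsum_lattice)
    fix s assume "s \<in> space (lebesgue_on {0..T})"
    then have s: "s \<in> {0..T}" by simp
    show "(\<lambda>k. f s k * m s (- k)) summable_on UNIV"
      by (rule pairing_bound(1)[OF in_B_summable[OF f] cmod_le_coeff_sup[OF f s \<beta>],
            of "m s" "\<lambda>_. norm_PMt \<alpha> T m"])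
         (auto intro: cmod_le_norm_PMt[OF m s \<alpha>])
  qed (intro borel_measurable_times in_B_measurable[OF f] in_PMt_measurable[OF m])
  then show ?thesis by (intro borel_measurable_times in_B_measurable[OF g])
qed

lemma conv_measurable:
  assumes h: "\<And>k. (\<lambda>s. h s k) \<in> borel_measurable (lebesgue_on {0..T})"
    and w: "w summable_on UNIV" "\<And>s k. s \<in> {0..T} \<Longrightarrow> cmod (h s k) \<le> w k"
    and m: "in_PMt \<alpha> T m" and \<alpha>: "0 \<le> \<alpha>"
  shows "(\<lambda>s. conv (m s) (h s) k) \<in> borel_measurable (lebesgue_on {0..T})"
  unfolding conv_def
proof (rule borel_measurable_infsum_lattice)
  fix s assume "s \<in> space (lebesgue_on {0..T})"
  then have s: "s \<in> {0..T}" by simp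
  show "(\<lambda>j. m s j * h s (k - j)) summable_on UNIV"
    by (rule conv_bound(1)[OF w(1) w(2)[OF s], of "m s" "\<lambda>_. norm_PMt \<alpha> T m"])
       (auto intro: cmod_le_norm_PMt[OF m s \<alpha>])
qed (intro borel_measurable_times h in_PMt_measurable[OF m])

section \<open>Stability estimates for two mild solutions\<close>

text \<open>
  The part of \<^const>\<open>norm_PMt\<close> belonging to one frequency.
\<close>

definition weighted_sup :: "real \<Rightarrow> real \<Rightarrow> (real \<Rightarrow> 'd::finite coeffs) \<Rightarrow> int ^ 'd \<Rightarrow> real" where
  "weighted_sup \<alpha> T f k = (SUP t\<in>{0..T}. exp (\<alpha> * t * knorm k) * cmod (f t k))"

text \<open>
  Bound for the norm of the composition with the function labelled \<open>h\<close>, on the ball of radius \<open>R\<close>.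
\<close>

definition size_bound :: "(ham_label \<Rightarrow> real) \<Rightarrow> (ham_label \<Rightarrow> real) \<Rightarrow> real \<Rightarrow> ham_label \<Rightarrow> real" where
  "size_bound c p R h = c h * rpow R (p h)"

text \<open>
  The corresponding Lipschitz constant on that ball; both powers in the hypothesis are at most
  the power of \<open>R\<close>, hence the factor 2.
\<close>

definition lipschitz_bound :: "(ham_label \<Rightarrow> real) \<Rightarrow> (ham_label \<Rightarrow> real) \<Rightarrow> real \<Rightarrow> ham_label \<Rightarrow> real" where
  "lipschitz_bound ct pt R h = ct h * (2 * rpow R (pt h))"

lemma rpow_mono: "0 \<le> x \<Longrightarrow> x \<le> y \<Longrightarrow> 0 \<le> p \<Longrightarrow> rpow x p \<le> rpow y p"
  by (auto simp: rpow_def intro!: powr_mono2)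

lemma rpow_nonneg: "0 \<le> rpow x p"
  by (auto simp: rpow_def)

lemma div_coeffs_vconv: "div_coeffs (vconv a b) k = (\<Sum>i\<in>UNIV. \<i> * of_int (k $ i) * conv a (\<lambda>j. b j $ i) k)"
  by (simp add: div_coeffs_def vconv_def)

lemma vham_component: "vham f g v m t k $ i = ham f (\<lambda>y. g y $ i) v m t k"
  by (simp add: vham_def ham_def vcompose_def)

text \<open>
  The gradient is multiplication by a fixed vector, so the vector-valued integral of the backward
  equation reduces to the integral of a scalar.
\<close>

lemma grad_coeffs_integral:
  fixes F :: "real \<Rightarrow> 'd::finite coeffs"
  assumes "(\<lambda>s. heat (r s) (F s) k) integrable_on S"
  shows "integral S (\<lambda>s. heat (r s) (grad_coeffs (F s)) k) $ i
    = \<i> * of_int (k $ i) * integral S (\<lambda>s. heat (r s) (F s) k)"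
proof -
  \<comment> \<open>The map that turns a scalar coefficient into its gradient.\<close>
  define L :: "complex \<Rightarrow> complex ^ 'd" where "L z = (\<chi> i. \<i> * of_int (k $ i) * z)" for z
  have "linear L"
    by (rule linearI) (simp_all add: L_def vec_eq_iff algebra_simps)
  then have L: "bounded_linear L" by (rule linear_conv_bounded_linear[THEN iffD1])
  have "(\<lambda>s. heat (r s) (grad_coeffs (F s)) k) = L \<circ> (\<lambda>s. heat (r s) (F s) k)"
    by (auto simp: fun_eq_iff L_def heat_def grad_coeffs_def vec_eq_iff)
  then show ?thesis
    using integral_linear[OF assms L] by (simp add: L_def)
qed

text \<open>
  Two mild solutions with the same Hamiltonians and payoff. Solution \<open>a\<close> will be a member of the
  sequence and solution \<open>b\<close> the limit; the estimates are arranged so that the weights in front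
  of \<open>A\<close> depend on \<open>b\<close> only.
\<close>

locale mild_pair =
  fixes T \<alpha> R M cG ctG :: real and \<Psi>1 \<Psi>2 :: "real \<Rightarrow> real"
    and G :: "'d::finite coeffs \<Rightarrow> 'd coeffs"
    and f1 f2 g1 :: "real ^ 'd \<Rightarrow> real" and g2 :: "real ^ 'd \<Rightarrow> real ^ 'd"
    and c p ct pt :: "ham_label \<Rightarrow> real"
    and \<mu>a \<mu>b :: "'d coeffs" and va vb :: "real \<Rightarrow> 'd vcoeffs" and ma mb :: "real \<Rightarrow> 'd coeffs"
  assumes T: "0 < T" and \<alpha>: "0 < \<alpha>" "\<alpha> < 1"
    and hamiltonian: "hamiltonian_at T \<alpha> f1 f2 g1 g2 c p ct pt"
    and payoff: "payoff_assumption T \<alpha> G cG ctG \<Psi>1 \<Psi>2"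
    and sol_a: "mild_solution T \<alpha> f1 f2 g1 g2 G \<mu>a va ma"
    and sol_b: "mild_solution T \<alpha> f1 f2 g1 g2 G \<mu>b vb mb"
    and va_le: "norm_Bvec (\<alpha> * T) T va \<le> R" and vb_le: "norm_Bvec (\<alpha> * T) T vb \<le> R"
    and ma_le: "norm_PMt \<alpha> T ma \<le> M" and mb_le: "norm_PMt \<alpha> T mb \<le> M"
begin

abbreviation "\<beta> \<equiv> \<alpha> * T"

lemma \<beta>: "0 \<le> \<beta>" and T0: "0 \<le> T" and \<alpha>0: "0 \<le> \<alpha>"
  using T \<alpha> by auto

lemma in_va: "in_Bvec \<beta> T va" and in_vb: "in_Bvec \<beta> T vb"
  and in_ma: "in_PMt \<alpha> T ma" and in_mb: "in_PMt \<alpha> T mb"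
  using sol_a sol_b by (auto simp: mild_solution_def)

lemma cmod_ma_le: "t \<in> {0..T} \<Longrightarrow> cmod (ma t k) \<le> M"
  and cmod_mb_le: "t \<in> {0..T} \<Longrightarrow> cmod (mb t k) \<le> M"
  using cmod_le_norm_PMt[OF in_ma, of t k] cmod_le_norm_PMt[OF in_mb, of t k] ma_le mb_le \<alpha> by force+

lemma M0: "0 \<le> M"
  using order_trans[OF norm_ge_zero cmod_ma_le[of 0 0]] T by auto

definition D where "D = norm_Bvec \<beta> T (\<lambda>t k. va t k - vb t k)"

definition A where "A = weighted_sup \<alpha> T (\<lambda>t k. ma t k - mb t k)"

lemma D0: "0 \<le> D"
  unfolding D_def using in_va in_vb T0 by (intro norm_Bvec_nonneg in_Bvec_diff)

lemma R0: "0 \<le> R"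
  using norm_Bvec_nonneg[OF in_va T0] va_le by linarith

lemma D_le: "D \<le> 2 * R"
  unfolding D_def using norm_Bvec_diff_le[OF in_va in_vb T0] va_le vb_le by linarith

lemma weighted_diff_le_2M:
  assumes "t \<in> {0..T}"
  shows "exp (\<alpha> * t * knorm k) * cmod (ma t k - mb t k) \<le> 2 * M"
proof -
  have "exp (\<alpha> * t * knorm k) * cmod (ma t k - mb t k)
      \<le> exp (\<alpha> * t * knorm k) * (cmod (ma t k) + cmod (mb t k))"
    by (intro mult_left_mono norm_triangle_ineq4) auto
  with le_norm_PMt[OF in_ma assms, of k] le_norm_PMt[OF in_mb assms, of k] ma_le mb_le
  show ?thesis by (simp add: distrib_left)
qed

lemma le_A: "t \<in> {0..T} \<Longrightarrow> exp (\<alpha> * t * knorm k) * cmod (ma t k - mb t k) \<le> A k"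
  unfolding A_def weighted_sup_def
  by (intro cSUP_upper bdd_aboveI2[where M = "2 * M"] weighted_diff_le_2M)

lemma A_leI: "(\<And>t. t \<in> {0..T} \<Longrightarrow> exp (\<alpha> * t * knorm k) * cmod (ma t k - mb t k) \<le> X) \<Longrightarrow> A k \<le> X"
  unfolding A_def weighted_sup_def using T by (intro cSUP_least) auto

lemma A_le: "A k \<le> 2 * M"
  by (intro A_leI weighted_diff_le_2M)

lemma cmod_diff_le_A:
  assumes "t \<in> {0..T}" shows "cmod (ma t k - mb t k) \<le> A k"
proof -
  have "1 * cmod (ma t k - mb t k) \<le> exp (\<alpha> * t * knorm k) * cmod (ma t k - mb t k)"
    using assms \<alpha> by (intro mult_right_mono) auto
  with le_A[OF assms, of k] show ?thesis by linarith
qed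

lemma A0: "0 \<le> A k"
  using order_trans[OF norm_ge_zero cmod_diff_le_A[of 0]] T by auto

abbreviation "bnd \<equiv> size_bound c p R"
abbreviation "lip \<equiv> lipschitz_bound ct pt R"

lemma scalar_bounds:
  assumes "ham_bounds \<beta> T h (c l) (p l) (ct l) (pt l)"
  shows "norm_B \<beta> T (compose h va) \<le> bnd l" "norm_B \<beta> T (compose h vb) \<le> bnd l"
    "norm_B \<beta> T (\<lambda>t k. compose h va t k - compose h vb t k) \<le> lip l * D"
    "0 \<le> bnd l" "0 \<le> lip l"
proof -
  have nn: "0 \<le> norm_Bvec \<beta> T va" "0 \<le> norm_Bvec \<beta> T vb"
    using norm_Bvec_nonneg in_va in_vb T0 by blast+
  have c: "c l > 0" "p l \<ge> 0" "ct l > 0" "pt l \<ge> 0" using assms by (auto simp: ham_bounds_def)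
  have r: "c l * rpow (norm_Bvec \<beta> T va) (p l) \<le> bnd l" "c l * rpow (norm_Bvec \<beta> T vb) (p l) \<le> bnd l"
    unfolding size_bound_def using c nn va_le vb_le by (auto intro!: mult_left_mono rpow_mono)
  show "norm_B \<beta> T (compose h va) \<le> bnd l" "norm_B \<beta> T (compose h vb) \<le> bnd l"
    using assms in_va in_vb r by (force simp: ham_bounds_def)+
  have "norm_B \<beta> T (\<lambda>t k. compose h va t k - compose h vb t k)
    \<le> ct l * D * (rpow (norm_Bvec \<beta> T va) (pt l) + rpow (norm_Bvec \<beta> T vb) (pt l))"
    using assms in_va in_vb by (simp add: ham_bounds_def D_def)
  also have "\<dots> \<le> ct l * D * (rpow R (pt l) + rpow R (pt l))"
    using c nn va_le vb_le D0 by (intro mult_left_mono add_mono rpow_mono) auto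
  finally show "norm_B \<beta> T (\<lambda>t k. compose h va t k - compose h vb t k) \<le> lip l * D"
    by (simp add: lipschitz_bound_def algebra_simps)
  show "0 \<le> bnd l" "0 \<le> lip l"
    using c by (auto simp: size_bound_def lipschitz_bound_def rpow_nonneg)
qed

lemma vector_bounds:
  assumes "vham_bounds \<beta> T h (c l) (p l) (ct l) (pt l)"
  shows "norm_Bvec \<beta> T (vcompose h vb) \<le> bnd l"
    "norm_Bvec \<beta> T (\<lambda>t k. vcompose h va t k - vcompose h vb t k) \<le> lip l * D"
    "0 \<le> bnd l" "0 \<le> lip l"
proof -
  have nn: "0 \<le> norm_Bvec \<beta> T va" "0 \<le> norm_Bvec \<beta> T vb"
    using norm_Bvec_nonneg in_va in_vb T0 by blast+
  have c: "c l > 0" "p l \<ge> 0" "ct l > 0" "pt l \<ge> 0" using assms by (auto simp: vham_bounds_def)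
  have r: "c l * rpow (norm_Bvec \<beta> T vb) (p l) \<le> bnd l"
    unfolding size_bound_def using c nn va_le vb_le by (auto intro!: mult_left_mono rpow_mono)
  show "norm_Bvec \<beta> T (vcompose h vb) \<le> bnd l"
    using assms in_vb r by (force simp: vham_bounds_def)
  have "norm_Bvec \<beta> T (\<lambda>t k. vcompose h va t k - vcompose h vb t k)
    \<le> ct l * D * (rpow (norm_Bvec \<beta> T va) (pt l) + rpow (norm_Bvec \<beta> T vb) (pt l))"
    using assms in_va in_vb by (simp add: vham_bounds_def D_def)
  also have "\<dots> \<le> ct l * D * (rpow R (pt l) + rpow R (pt l))"
    using c nn va_le vb_le D0 by (intro mult_left_mono add_mono rpow_mono) auto
  finally show "norm_Bvec \<beta> T (\<lambda>t k. vcompose h va t k - vcompose h vb t k) \<le> lip l * D"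
    by (simp add: lipschitz_bound_def algebra_simps)
  show "0 \<le> bnd l" "0 \<le> lip l"
    using c by (auto simp: size_bound_def lipschitz_bound_def rpow_nonneg)
qed

lemma bounds:
  shows "ham_bounds \<beta> T f1 (c F1) (p F1) (ct F1) (pt F1)"
    and "ham_bounds \<beta> T f2 (c F2) (p F2) (ct F2) (pt F2)"
    and "ham_bounds \<beta> T g1 (c G1) (p G1) (ct G1) (pt G1)"
    and "vham_bounds \<beta> T g2 (c G2) (p G2) (ct G2) (pt G2)"
  using hamiltonian by (auto simp: hamiltonian_at_def)

lemmas bounds_nonneg =
  scalar_bounds(4,5)[OF bounds(1)] scalar_bounds(4,5)[OF bounds(2)]
  scalar_bounds(4,5)[OF bounds(3)] vector_bounds(3,4)[OF bounds(4)]

abbreviation g2c :: "'d \<Rightarrow> real ^ 'd \<Rightarrow> real" where "g2c i y \<equiv> g2 y $ i"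

lemma in_B_compose:
  assumes "in_Bvec \<beta> T v"
  shows "in_B \<beta> T (compose f1 v)" "in_B \<beta> T (compose f2 v)" "in_B \<beta> T (compose g1 v)"
    "in_B \<beta> T (compose (g2c i) v)"
  using hamiltonian assms by (auto simp: hamiltonian_at_def maps_B_def vmaps_B_def)

text \<open>
  Majorant of the pairing of \<open>f(vb)\<close> with \<open>ma - mb\<close>. It is kept as a sum instead of being estimated by
  the supremum of \<open>A\<close>, in order to pass to the upper limit frequency by frequency.
\<close>

definition fluct :: "(real ^ 'd \<Rightarrow> real) \<Rightarrow> real" where
  "fluct f = (\<Sum>\<^sub>\<infinity>j. A (- j) * coeff_sup \<beta> T (compose f vb) j)"

lemma fluct_bounds:
  assumes "in_B \<beta> T (compose f vb)"
  shows "0 \<le> fluct f" "fluct f \<le> 2 * M * norm_B \<beta> T (compose f vb)"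
  unfolding fluct_def norm_B_eq
  using assms T0 A0 A_le
  by (auto intro!: infsum_nonneg mult_nonneg_nonneg coeff_sup_nonneg bounded_mult_summable(2) in_B_summable)

definition ham_diff_majorant :: "(real ^ 'd \<Rightarrow> real) \<Rightarrow> (real ^ 'd \<Rightarrow> real) \<Rightarrow> ham_label \<Rightarrow> int ^ 'd \<Rightarrow> real" where
  "ham_diff_majorant f g l k =
     coeff_sup \<beta> T (\<lambda>t k. compose g va t k - compose g vb t k) k * (M * bnd l)
     + coeff_sup \<beta> T (compose g vb) k * (M * (lip l * D) + fluct f)"

lemma ham_diff_le_majorant:
  assumes b: "ham_bounds \<beta> T f (c l) (p l) (ct l) (pt l)"
    and f: "in_B \<beta> T (compose f va)" "in_B \<beta> T (compose f vb)"
    and g: "in_B \<beta> T (compose g va)" "in_B \<beta> T (compose g vb)" and t: "t \<in> {0..T}"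
  shows "exp (\<beta> * knorm k) * cmod (ham f g va ma t k - ham f g vb mb t k) \<le> ham_diff_majorant f g l k"
proof -
  have "exp (\<beta> * knorm k) * cmod (ham f g va ma t k - ham f g vb mb t k)
    \<le> coeff_sup \<beta> T (\<lambda>t k. compose g va t k - compose g vb t k) k * (M * norm_B \<beta> T (compose f va))
      + coeff_sup \<beta> T (compose g vb) k * (M * norm_B \<beta> T (\<lambda>t k. compose f va t k - compose f vb t k)
          + fluct f)"
    unfolding ham_def fluct_def
    by (rule ham_diff_coeff_bound[OF f g \<beta> t])
       (auto intro: cmod_ma_le cmod_mb_le t cmod_diff_le_A A_le)
  also have "\<dots> \<le> ham_diff_majorant f g l k"
    unfolding ham_diff_majorant_def
    using scalar_bounds[OF b] M0 T0 g by (intro add_mono mult_left_mono coeff_sup_nonneg in_B_diff) auto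
  finally show ?thesis .
qed

lemma ham_diff_majorant_summable:
  assumes g: "in_B \<beta> T (compose g va)" "in_B \<beta> T (compose g vb)"
  shows "ham_diff_majorant f g l summable_on UNIV"
    "infsum (ham_diff_majorant f g l) UNIV
      = norm_B \<beta> T (\<lambda>t k. compose g va t k - compose g vb t k) * (M * bnd l)
        + norm_B \<beta> T (compose g vb) * (M * (lip l * D) + fluct f)"
proof -
  note s = in_B_summable[OF in_B_diff[OF g T0]] in_B_summable[OF g(2)]
  have s': "(\<lambda>k. coeff_sup \<beta> T (\<lambda>t k. compose g va t k - compose g vb t k) k * (M * bnd l)) summable_on UNIV"
    "(\<lambda>k. coeff_sup \<beta> T (compose g vb) k * (M * (lip l * D) + fluct f)) summable_on UNIV"
    using s by (auto intro: summable_on_cmult_left)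
  show "ham_diff_majorant f g l summable_on UNIV"
    unfolding ham_diff_majorant_def[abs_def] by (rule summable_on_add[OF s'])
  show "infsum (ham_diff_majorant f g l) UNIV
      = norm_B \<beta> T (\<lambda>t k. compose g va t k - compose g vb t k) * (M * bnd l)
        + norm_B \<beta> T (compose g vb) * (M * (lip l * D) + fluct f)"
    unfolding ham_diff_majorant_def[abs_def] norm_B_eq
    by (subst infsum_add[OF s']) (simp add: infsum_cmult_left')
qed

lemma ham_diff_majorant_nonneg:
  assumes "ham_bounds \<beta> T f (c l) (p l) (ct l) (pt l)"
    "in_B \<beta> T (compose f va)" "in_B \<beta> T (compose f vb)"
    "in_B \<beta> T (compose g va)" "in_B \<beta> T (compose g vb)"
  shows "0 \<le> ham_diff_majorant f g l k"
  by (rule order_trans[OF _ ham_diff_le_majorant[OF assms, of 0]]) (use T0 in auto)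

definition ham_diff_bound :: "(real ^ 'd \<Rightarrow> real) \<Rightarrow> ham_label \<Rightarrow> ham_label \<Rightarrow> real" where
  "ham_diff_bound f l l' = lip l' * D * (M * bnd l) + bnd l' * (M * (lip l * D) + fluct f)"

lemma ham1_diff_bound: "infsum (ham_diff_majorant f1 g1 F1) UNIV \<le> ham_diff_bound f1 F1 G1"
  unfolding ham_diff_majorant_summable(2)[OF in_B_compose(3)[OF in_va] in_B_compose(3)[OF in_vb]] ham_diff_bound_def
  using bounds_nonneg M0 D0 fluct_bounds(1)[OF in_B_compose(1)[OF in_vb]]
  by (intro add_mono mult_right_mono scalar_bounds[OF bounds(3)]) auto

lemma ham2_diff_bound: "(\<Sum>i\<in>UNIV. infsum (ham_diff_majorant f2 (g2c i) F2) UNIV) \<le> ham_diff_bound f2 F2 G2"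
proof -
  have "(\<Sum>i\<in>UNIV. infsum (ham_diff_majorant f2 (g2c i) F2) UNIV)
    = norm_Bvec \<beta> T (\<lambda>t k. vcompose g2 va t k - vcompose g2 vb t k) * (M * bnd F2)
      + norm_Bvec \<beta> T (vcompose g2 vb) * (M * (lip F2 * D) + fluct f2)"
    by (simp add: ham_diff_majorant_summable(2)[OF in_B_compose(4)[OF in_va] in_B_compose(4)[OF in_vb]]
        norm_Bvec_def vcompose_def sum.distrib sum_distrib_right)
  also have "\<dots> \<le> ham_diff_bound f2 F2 G2"
    unfolding ham_diff_bound_def
    using bounds_nonneg M0 D0 fluct_bounds(1)[OF in_B_compose(2)[OF in_vb]]
    by (intro add_mono mult_right_mono vector_bounds[OF bounds(4)]) auto
  finally show ?thesis .
qed

text \<open>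
  Majorant of the difference of the fluxes \<open>m H\<^sub>2\<close> at frequency \<open>k\<close>: the convolution is the effect of
  \<open>ma - mb\<close> on the limit Hamiltonian, the last term the effect of the change of the Hamiltonian.
\<close>

definition flux_bound :: "int ^ 'd \<Rightarrow> real" where
  "flux_bound k = (\<Sum>i\<in>UNIV. \<Sum>\<^sub>\<infinity>j. A j * (coeff_sup \<beta> T (compose (g2c i) vb) (k - j) * (M * bnd F2)))
     + M * ham_diff_bound f2 F2 G2"

lemma ham_component_bound:
  assumes v: "in_Bvec \<beta> T v" and f: "norm_B \<beta> T (compose f2 v) \<le> bnd F2"
    and m: "\<And>t k. t \<in> {0..T} \<Longrightarrow> cmod (m t k) \<le> M" and t: "t \<in> {0..T}"
  shows "exp (\<beta> * knorm k) * cmod (ham f2 (g2c i) v m t k)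
    \<le> coeff_sup \<beta> T (compose (g2c i) v) k * (M * bnd F2)"
proof -
  have "exp (\<beta> * knorm k) * cmod (ham f2 (g2c i) v m t k)
    \<le> coeff_sup \<beta> T (compose (g2c i) v) k * (M * norm_B \<beta> T (compose f2 v))"
    unfolding ham_def by (rule ham_coeff_bound[OF in_B_compose(2)[OF v] in_B_compose(4)[OF v] \<beta> t m[OF t]])
  also have "\<dots> \<le> coeff_sup \<beta> T (compose (g2c i) v) k * (M * bnd F2)"
    using f M0 T0 by (intro mult_left_mono coeff_sup_nonneg in_B_compose v)
  finally show ?thesis .
qed

lemma le_weighted: "cmod z \<le> exp (\<beta> * knorm k) * cmod z"
proof -
  have "1 * cmod z \<le> exp (\<beta> * knorm k) * cmod z"
    using \<beta> by (intro mult_right_mono) auto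
  then show ?thesis by simp
qed

text \<open>
  The factor \<open>|k|\<close> comes from the divergence; the heat kernel absorbs it in \<open>forward_diff_le\<close>.
\<close>

lemma flux_diff_le:
  assumes s: "s \<in> {0..T}"
  shows "exp (\<alpha> * s * knorm k) * cmod (div_coeffs (vconv (ma s) (vham f2 g2 va ma s)) k
      - div_coeffs (vconv (mb s) (vham f2 g2 vb mb s)) k) \<le> knorm k * flux_bound k"
proof -
  let ?ha = "\<lambda>i. ham f2 (g2c i) va ma s" and ?hb = "\<lambda>i. ham f2 (g2c i) vb mb s"
  let ?wa = "\<lambda>i k. coeff_sup \<beta> T (compose (g2c i) va) k * (M * bnd F2)"
  let ?wb = "\<lambda>i k. coeff_sup \<beta> T (compose (g2c i) vb) k * (M * bnd F2)"
  let ?e = "exp (\<alpha> * s * knorm k)"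
  define X where "X i = conv (ma s) (?ha i) k - conv (mb s) (?hb i) k" for i
  have s': "0 \<le> s" "s \<le> T" using s by auto
  have sw: "?wa i summable_on UNIV" "?wb i summable_on UNIV" for i
    using in_va in_vb by (auto intro!: summable_on_cmult_left in_B_summable in_B_compose)
  have wa: "exp (\<beta> * knorm j) * cmod (?ha i j) \<le> ?wa i j" for i j
    by (rule ham_component_bound[OF in_va scalar_bounds(1)[OF bounds(2)] cmod_ma_le s])
  have wb: "exp (\<beta> * knorm j) * cmod (?hb i j) \<le> ?wb i j" for i j
    by (rule ham_component_bound[OF in_vb scalar_bounds(2)[OF bounds(2)] cmod_mb_le s])
  have X: "?e * cmod (X i) \<le> (\<Sum>\<^sub>\<infinity>j. A j * ?wb i (k - j))
      + M * infsum (ham_diff_majorant f2 (g2c i) F2) UNIV" for i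
  proof -
    have maj: "exp (\<beta> * knorm j) * cmod (?ha i j - ?hb i j) \<le> ham_diff_majorant f2 (g2c i) F2 j" for j
      by (rule ham_diff_le_majorant[OF bounds(2) _ _ _ _ s]) (intro in_B_compose in_va in_vb)+
    have nn: "0 \<le> ham_diff_majorant f2 (g2c i) F2 j" for j
      by (rule ham_diff_majorant_nonneg[OF bounds(2)]) (auto intro: in_B_compose in_va in_vb)
    have sm: "ham_diff_majorant f2 (g2c i) F2 summable_on UNIV"
      by (intro ham_diff_majorant_summable(1) in_B_compose in_va in_vb)
    have "X i = conv (\<lambda>j. ma s j - mb s j) (?hb i) k + conv (ma s) (\<lambda>j. ?ha i j - ?hb i j) k"
      unfolding X_def
      by (rule conv_diff[OF sw(1) _ sw(2) _ cmod_ma_le[OF s] cmod_mb_le[OF s]])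
         (rule order_trans[OF le_weighted wa] order_trans[OF le_weighted wb])+
    then have "cmod (X i) \<le> cmod (conv (\<lambda>j. ma s j - mb s j) (?hb i) k)
        + cmod (conv (ma s) (\<lambda>j. ?ha i j - ?hb i j) k)"
      by (simp add: norm_triangle_ineq)
    then have "?e * cmod (X i) \<le> ?e * (cmod (conv (\<lambda>j. ma s j - mb s j) (?hb i) k)
        + cmod (conv (ma s) (\<lambda>j. ?ha i j - ?hb i j) k))"
      by (rule mult_left_mono) simp
    also have "\<dots> = ?e * cmod (conv (\<lambda>j. ma s j - mb s j) (?hb i) k)
        + ?e * cmod (conv (ma s) (\<lambda>j. ?ha i j - ?hb i j) k)" by (simp add: distrib_left)
    also have "\<dots> \<le> (\<Sum>\<^sub>\<infinity>j. A j * ?wb i (k - j))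
        + (\<Sum>\<^sub>\<infinity>j. M * ham_diff_majorant f2 (g2c i) F2 (k - j))"
    proof (rule add_mono)
      show "?e * cmod (conv (\<lambda>j. ma s j - mb s j) (?hb i) k) \<le> (\<Sum>\<^sub>\<infinity>j. A j * ?wb i (k - j))"
        by (rule weighted_conv_bound[OF s' \<alpha>0, where C = "2 * M"])
           (use s sw wb le_A A_le in auto)
      show "?e * cmod (conv (ma s) (\<lambda>j. ?ha i j - ?hb i j) k)
        \<le> (\<Sum>\<^sub>\<infinity>j. M * ham_diff_majorant f2 (g2c i) F2 (k - j))"
        by (rule weighted_conv_bound[OF s' \<alpha>0, where C = M])
           (use sm maj order_trans[OF le_norm_PMt[OF in_ma s] ma_le] in auto)
    qed
    also have "(\<Sum>\<^sub>\<infinity>j. M * ham_diff_majorant f2 (g2c i) F2 (k - j))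
        = M * infsum (ham_diff_majorant f2 (g2c i) F2) UNIV"
      by (simp add: infsum_cmult_right' infsum_reflect)
    finally show ?thesis .
  qed
  have "div_coeffs (vconv (ma s) (vham f2 g2 va ma s)) k - div_coeffs (vconv (mb s) (vham f2 g2 vb mb s)) k
      = (\<Sum>i\<in>UNIV. \<i> * of_int (k $ i) * X i)"
    by (simp add: div_coeffs_vconv vham_component X_def sum_subtractf[symmetric] right_diff_distrib)
  also have "cmod \<dots> \<le> (\<Sum>i\<in>UNIV. knorm k * cmod (X i))"
    by (rule sum_norm_le) (auto simp: norm_mult intro!: mult_right_mono component_le_knorm)
  finally have "?e * cmod (div_coeffs (vconv (ma s) (vham f2 g2 va ma s)) k
      - div_coeffs (vconv (mb s) (vham f2 g2 vb mb s)) k) \<le> ?e * (\<Sum>i\<in>UNIV. knorm k * cmod (X i))"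
    by (rule mult_left_mono) simp
  also have "\<dots> = knorm k * (\<Sum>i\<in>UNIV. ?e * cmod (X i))"
    by (simp add: sum_distrib_left mult_ac)
  also have "\<dots> \<le> knorm k * (\<Sum>i\<in>UNIV. (\<Sum>\<^sub>\<infinity>j. A j * ?wb i (k - j))
      + M * infsum (ham_diff_majorant f2 (g2c i) F2) UNIV)"
    by (intro mult_left_mono sum_mono X) auto
  also have "\<dots> \<le> knorm k * flux_bound k"
    unfolding flux_bound_def sum.distrib sum_distrib_left[symmetric]
    using M0 by (intro mult_left_mono add_left_mono ham2_diff_bound) auto
  finally show ?thesis .
qed

lemma flux_bound_nonneg: "0 \<le> flux_bound k"
proof -
  have "0 \<le> ham_diff_bound f2 F2 G2"
    unfolding ham_diff_bound_def
    using bounds_nonneg M0 D0 fluct_bounds(1)[OF in_B_compose(2)[OF in_vb]] by auto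
  then show ?thesis
    unfolding flux_bound_def using A0 M0 T0 bounds_nonneg
    by (auto intro!: add_nonneg_nonneg sum_nonneg infsum_nonneg mult_nonneg_nonneg coeff_sup_nonneg in_B_compose in_vb)
qed

lemma flux_integrable:
  assumes v: "in_Bvec \<beta> T v" and m: "in_PMt \<alpha> T m" and t: "t \<in> {0..T}"
  shows "(\<lambda>s. heat (t - s) (div_coeffs (vconv (m s) (vham f2 g2 v m s))) k) integrable_on {0..t}"
proof -
  let ?N = "norm_PMt \<alpha> T m"
  let ?w = "\<lambda>i k. coeff_sup \<beta> T (compose (g2c i) v) k * (?N * norm_B \<beta> T (compose f2 v))"
  have sw: "?w i summable_on UNIV" for i
    by (intro summable_on_cmult_left in_B_summable in_B_compose v)
  have hw: "cmod (ham f2 (g2c i) v m s k) \<le> ?w i k" if "s \<in> {0..T}" for i s k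
    by (rule order_trans[OF le_weighted], unfold ham_def,
        rule ham_coeff_bound[OF in_B_compose(2)[OF v] in_B_compose(4)[OF v] \<beta> that])
       (rule cmod_le_norm_PMt[OF m that \<alpha>0])
  have hm: "(\<lambda>s. ham f2 (g2c i) v m s k) \<in> borel_measurable (lebesgue_on {0..T})" for i k
    unfolding ham_def by (rule ham_measurable[OF in_B_compose(2)[OF v] in_B_compose(4)[OF v] \<beta> m \<alpha>0])
  have cm: "(\<lambda>s. conv (m s) (ham f2 (g2c i) v m s) k) \<in> borel_measurable (lebesgue_on {0..T})" for i
    by (rule conv_measurable[OF hm sw hw m \<alpha>0])
  have "(\<lambda>s. div_coeffs (vconv (m s) (vham f2 g2 v m s)) k) \<in> borel_measurable (lebesgue_on {0..T})"
    unfolding div_coeffs_vconv vham_component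
    by (intro borel_measurable_sum borel_measurable_times borel_measurable_const cm)
  moreover have "(\<lambda>s. exp (- ((knorm k)\<^sup>2 * (t - s)))) \<in> borel_measurable (lebesgue_on {0..T})"
    by (intro continuous_imp_measurable_on_sets_lebesgue continuous_intros) auto
  ultimately have meas: "(\<lambda>s. heat (t - s) (div_coeffs (vconv (m s) (vham f2 g2 v m s))) k)
      \<in> borel_measurable (lebesgue_on {0..T})"
    unfolding heat_def by (intro borel_measurable_scaleR)
  let ?C = "\<Sum>i\<in>UNIV. knorm k * (?N * infsum (?w i) UNIV)"
  show ?thesis
  proof (rule integrable_on_of_bounded_measurable[OF meas])
    fix s assume s: "s \<in> {0..t}"
    then have s': "s \<in> {0..T}" using t by auto
    have c: "cmod (conv (m s) (ham f2 (g2c i) v m s) k) \<le> ?N * infsum (?w i) UNIV" for i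
      by (rule conv_bound(2)[OF sw hw[OF s'], of "m s" "\<lambda>_. ?N"])
         (auto intro: cmod_le_norm_PMt[OF m s' \<alpha>0])
    have "exp (- ((knorm k)\<^sup>2 * (t - s))) \<le> 1" using s by auto
    then have "cmod (heat (t - s) (div_coeffs (vconv (m s) (vham f2 g2 v m s))) k)
      \<le> 1 * cmod (div_coeffs (vconv (m s) (vham f2 g2 v m s)) k)"
      unfolding heat_def norm_scaleR by (intro mult_right_mono) auto
    also have "\<dots> \<le> ?C"
      unfolding div_coeffs_vconv vham_component mult_1_left
      by (rule sum_norm_le) (auto simp: norm_mult intro!: mult_mono component_le_knorm c)
    finally show "cmod (heat (t - s) (div_coeffs (vconv (m s) (vham f2 g2 v m s))) k) \<le> ?C" .
  qed (use t in auto)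
qed

lemma ham1_integrable:
  assumes v: "in_Bvec \<beta> T v" and m: "in_PMt \<alpha> T m" and t: "t \<in> {0..T}"
  shows "(\<lambda>s. heat (s - t) (ham f1 g1 v m s) k) integrable_on {t..T}"
proof -
  let ?N = "norm_PMt \<alpha> T m"
  let ?C = "coeff_sup \<beta> T (compose g1 v) k * (?N * norm_B \<beta> T (compose f1 v))"
  have "(\<lambda>s. ham f1 g1 v m s k) \<in> borel_measurable (lebesgue_on {0..T})"
    unfolding ham_def by (rule ham_measurable[OF in_B_compose(1)[OF v] in_B_compose(3)[OF v] \<beta> m \<alpha>0])
  moreover have "(\<lambda>s. exp (- ((knorm k)\<^sup>2 * (s - t)))) \<in> borel_measurable (lebesgue_on {0..T})"
    by (intro continuous_imp_measurable_on_sets_lebesgue continuous_intros) auto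
  ultimately have meas: "(\<lambda>s. heat (s - t) (ham f1 g1 v m s) k) \<in> borel_measurable (lebesgue_on {0..T})"
    unfolding heat_def by (intro borel_measurable_scaleR)
  show ?thesis
  proof (rule integrable_on_of_bounded_measurable[OF meas])
    fix s assume s: "s \<in> {t..T}"
    then have s': "s \<in> {0..T}" using t by auto
    have "exp (- ((knorm k)\<^sup>2 * (s - t))) \<le> 1" using s by auto
    then have "cmod (heat (s - t) (ham f1 g1 v m s) k) \<le> 1 * cmod (ham f1 g1 v m s k)"
      unfolding heat_def norm_scaleR by (intro mult_right_mono) auto
    also have "\<dots> \<le> exp (\<beta> * knorm k) * cmod (ham f1 g1 v m s k)"
      using le_weighted by simp
    also have "\<dots> \<le> ?C"
      unfolding ham_def
      by (rule ham_coeff_bound[OF in_B_compose(1)[OF v] in_B_compose(3)[OF v] \<beta> s'])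
         (rule cmod_le_norm_PMt[OF m s' \<alpha>0])
    finally show "cmod (heat (s - t) (ham f1 g1 v m s) k) \<le> ?C" .
  qed (use t in auto)
qed

text \<open>
  Duhamel's formula with the weight \<open>exp (\<alpha> t |k|)\<close> distributed as
  \<open>exp (\<alpha> s |k|) exp (\<alpha> (t - s) |k|)\<close>: the first factor is used up by the flux, the second one slows down the
  heat kernel to the rate \<open>|k|\<^sup>2 - \<alpha> |k|\<close>, which is positive because \<open>\<alpha> < 1 \<le> |k|\<close>.
\<close>

lemma forward_diff_le:
  assumes t: "t \<in> {0..T}" and k: "k \<noteq> 0"
  shows "exp (\<alpha> * t * knorm k) * cmod (ma t k - mb t k)
    \<le> exp (\<alpha> * t * knorm k - (knorm k)\<^sup>2 * t) * cmod (\<mu>a k - \<mu>b k) + flux_bound k / (knorm k - \<alpha>)"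
proof -
  define \<kappa> where "\<kappa> = knorm k"
  have \<kappa>: "1 \<le> \<kappa>" unfolding \<kappa>_def by (rule knorm_ge_1[OF k])
  define \<rho> where "\<rho> = \<kappa>\<^sup>2 - \<alpha> * \<kappa>"
  have \<rho>_eq: "\<rho> = \<kappa> * (\<kappa> - \<alpha>)" by (simp add: \<rho>_def power2_eq_square algebra_simps)
  then have \<rho>: "0 < \<rho>" using \<kappa> \<alpha> by auto
  let ?da = "\<lambda>s. div_coeffs (vconv (ma s) (vham f2 g2 va ma s))"
  let ?db = "\<lambda>s. div_coeffs (vconv (mb s) (vham f2 g2 vb mb s))"
  let ?F = "\<lambda>s. heat (t - s) (?da s) k - heat (t - s) (?db s) k"
  note int = flux_integrable[OF in_va in_ma t, of k] flux_integrable[OF in_vb in_mb t, of k]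
  let ?C = "\<kappa> * flux_bound k * exp (- (\<alpha> * t * \<kappa>))"
  have "cmod (integral {0..t} ?F) \<le> ?C / \<rho>"
  proof (rule integral_exp_kernel_le)
    fix s assume s: "s \<in> {0..t}"
    then have s': "s \<in> {0..T}" using t by auto
    \<comment> \<open>Splits the heat kernel into the weight at time \<open>t\<close>, an integrable kernel and the weight at time \<open>s\<close>.\<close>
    have e: "exp (- (\<kappa>\<^sup>2 * (t - s))) = exp (- (\<alpha> * t * \<kappa>)) * exp (- (\<rho> * (t - s))) * exp (\<alpha> * s * \<kappa>)"
      by (simp add: exp_add[symmetric] \<rho>_def algebra_simps)
    have "cmod (?F s) = exp (- (\<kappa>\<^sup>2 * (t - s))) * cmod (?da s k - ?db s k)"
      by (simp add: heat_def \<kappa>_def scaleR_diff_right[symmetric])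
    also have "\<dots> = exp (- (\<alpha> * t * \<kappa>)) * exp (- (\<rho> * (t - s))) * (exp (\<alpha> * s * \<kappa>) * cmod (?da s k - ?db s k))"
      unfolding e by (simp add: mult_ac)
    also have "\<dots> \<le> exp (- (\<alpha> * t * \<kappa>)) * exp (- (\<rho> * (t - s))) * (\<kappa> * flux_bound k)"
      unfolding \<kappa>_def by (intro mult_left_mono flux_diff_le s') auto
    finally show "cmod (?F s) \<le> ?C * exp (- (\<rho> * (t - s)))" by (simp add: mult_ac)
  qed (use t \<rho> \<kappa> flux_bound_nonneg[of k] integrable_diff[OF int] in auto)
  moreover have "ma t k - mb t k = heat t \<mu>a k - heat t \<mu>b k - integral {0..t} ?F"
    using sol_a sol_b t unfolding mild_solution_def by (simp add: integral_diff[OF int])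
  ultimately have "cmod (ma t k - mb t k) \<le> cmod (heat t \<mu>a k - heat t \<mu>b k) + ?C / \<rho>"
    by (smt (verit) norm_triangle_ineq4)
  also have "cmod (heat t \<mu>a k - heat t \<mu>b k) = exp (- (\<kappa>\<^sup>2 * t)) * cmod (\<mu>a k - \<mu>b k)"
    by (simp add: heat_def \<kappa>_def scaleR_diff_right[symmetric])
  finally have "exp (\<alpha> * t * \<kappa>) * cmod (ma t k - mb t k)
      \<le> exp (\<alpha> * t * \<kappa>) * (exp (- (\<kappa>\<^sup>2 * t)) * cmod (\<mu>a k - \<mu>b k) + ?C / \<rho>)"
    by (rule mult_left_mono) simp
  also have "\<dots> = (exp (\<alpha> * t * \<kappa>) * exp (- (\<kappa>\<^sup>2 * t))) * cmod (\<mu>a k - \<mu>b k)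
      + (exp (\<alpha> * t * \<kappa>) * exp (- (\<alpha> * t * \<kappa>))) * (\<kappa> * flux_bound k / \<rho>)"
    by (simp add: algebra_simps)
  also have "\<dots> = exp (\<alpha> * t * \<kappa> - \<kappa>\<^sup>2 * t) * cmod (\<mu>a k - \<mu>b k) + \<kappa> * flux_bound k / \<rho>"
    by (simp add: exp_add[symmetric] mult.commute)
  also have "\<kappa> * flux_bound k / \<rho> = flux_bound k / (\<kappa> - \<alpha>)"
    unfolding \<rho>_eq using \<kappa> by simp
  finally show ?thesis by (simp add: \<kappa>_def)
qed

text \<open>
  The divergence has mean zero, so the total mass is conserved. This is the frequency that
  the heat kernel does not damp.
\<close>

lemma mean_diff:
  assumes t: "t \<in> {0..T}" shows "ma t 0 - mb t 0 = \<mu>a 0 - \<mu>b 0"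
proof -
  have z: "div_coeffs (vconv a b) 0 = 0" for a :: "'d coeffs" and b
    by (simp add: div_coeffs_def)
  have "ma t 0 = heat t \<mu>a 0 - integral {0..t} (\<lambda>s. heat (t - s) (div_coeffs (vconv (ma s) (vham f2 g2 va ma s))) 0)"
    "mb t 0 = heat t \<mu>b 0 - integral {0..t} (\<lambda>s. heat (t - s) (div_coeffs (vconv (mb s) (vham f2 g2 vb mb s))) 0)"
    using sol_a sol_b t unfolding mild_solution_def by blast+
  then show ?thesis by (simp add: z heat_def)
qed

lemma A_forward: "A k \<le> cmod (\<mu>a k - \<mu>b k) + flux_bound k / (1 - \<alpha>)"
proof (rule A_leI)
  fix t assume t: "t \<in> {0..T}"
  show "exp (\<alpha> * t * knorm k) * cmod (ma t k - mb t k) \<le> cmod (\<mu>a k - \<mu>b k) + flux_bound k / (1 - \<alpha>)"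
  proof (cases "k = 0")
    case True
    then show ?thesis using mean_diff[OF t] flux_bound_nonneg[of k] \<alpha> by simp
  next
    case False
    have \<kappa>: "1 \<le> knorm k" by (rule knorm_ge_1[OF False])
    have "\<alpha> * t * knorm k \<le> (knorm k)\<^sup>2 * t"
    proof -
      have "\<alpha> * (t * knorm k) \<le> knorm k * (t * knorm k)" using \<kappa> \<alpha> t by (intro mult_right_mono) auto
      then show ?thesis by (simp add: power2_eq_square mult_ac)
    qed
    then have "exp (\<alpha> * t * knorm k - (knorm k)\<^sup>2 * t) * cmod (\<mu>a k - \<mu>b k) \<le> 1 * cmod (\<mu>a k - \<mu>b k)"
      by (intro mult_right_mono) auto
    moreover have "flux_bound k / (knorm k - \<alpha>) \<le> flux_bound k / (1 - \<alpha>)"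
      using \<kappa> \<alpha> flux_bound_nonneg[of k] by (intro divide_left_mono) auto
    ultimately show ?thesis using forward_diff_le[OF t False] by linarith
  qed
qed

text \<open>
  The weight \<open>1 + |k|\<close> in the norm for the payoff pays for the gradient in the terminal condition.
\<close>

lemma terminal_diff_le:
  "(\<lambda>k. (1 + knorm k) * exp (\<beta> * knorm k) * cmod (G (ma T) k - G (mb T) k)) summable_on UNIV"
  "(\<Sum>\<^sub>\<infinity>k. (1 + knorm k) * exp (\<beta> * knorm k) * cmod (G (ma T) k - G (mb T) k))
    \<le> ctG * \<Psi>2 (2 * M) * norm_PM \<beta> (\<lambda>k. ma T k - mb T k)"
  "0 \<le> ctG * \<Psi>2 (2 * M)"
proof -
  note a = in_PM_of_in_PMt[OF in_ma T0] and b = in_PM_of_in_PMt[OF in_mb T0]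
  have pm0: "0 \<le> norm_PM \<beta> m" if "in_PM \<beta> m" for m :: "'d coeffs"
    unfolding norm_PM_def using that by (intro cSUP_upper2[of _ _ 0]) (auto simp: in_PM_def)
  have "in_B1 \<beta> (G (ma T))" "in_B1 \<beta> (G (mb T))"
    using payoff a b by (auto simp: payoff_assumption_def)
  then have s: "(\<lambda>k. (1 + knorm k) * exp (\<beta> * knorm k) * cmod (G (ma T) k)
      + (1 + knorm k) * exp (\<beta> * knorm k) * cmod (G (mb T) k)) summable_on UNIV"
    by (intro summable_on_add) (auto simp: in_B1_def)
  show "(\<lambda>k. (1 + knorm k) * exp (\<beta> * knorm k) * cmod (G (ma T) k - G (mb T) k)) summable_on UNIV"
    by (rule summable_on_comparison_test[OF s])
       (auto simp: distrib_left[symmetric] intro!: mult_left_mono norm_triangle_ineq4)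
  have \<Psi>: "mono_on {0..} \<Psi>2" "\<forall>r\<ge>0. \<Psi>2 r \<ge> 0" "ctG > 0"
    using payoff by (auto simp: payoff_assumption_def)
  then show "0 \<le> ctG * \<Psi>2 (2 * M)" using M0 by simp
  have "\<Psi>2 (norm_PM \<beta> (ma T) + norm_PM \<beta> (mb T)) \<le> \<Psi>2 (2 * M)"
    using a b pm0[OF a(1)] pm0[OF b(1)] ma_le mb_le by (intro mono_onD[OF \<Psi>(1)]) auto
  moreover have "0 \<le> norm_PM \<beta> (\<lambda>k. ma T k - mb T k)"
  proof -
    have "bdd_above (range (\<lambda>k. exp (\<beta> * knorm k) * cmod (ma T k - mb T k)))"
      using weighted_diff_le_2M[of T] T by (intro bdd_aboveI2[where M = "2 * M"]) auto
    then show ?thesis unfolding norm_PM_def by (intro cSUP_upper2[of _ _ 0]) auto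
  qed
  ultimately have "ctG * norm_PM \<beta> (\<lambda>k. ma T k - mb T k) * \<Psi>2 (norm_PM \<beta> (ma T) + norm_PM \<beta> (mb T))
      \<le> ctG * norm_PM \<beta> (\<lambda>k. ma T k - mb T k) * \<Psi>2 (2 * M)"
    using \<Psi> by (intro mult_left_mono) auto
  moreover have "norm_B1 \<beta> (\<lambda>k. G (ma T) k - G (mb T) k)
      \<le> ctG * norm_PM \<beta> (\<lambda>k. ma T k - mb T k) * \<Psi>2 (norm_PM \<beta> (ma T) + norm_PM \<beta> (mb T))"
    using payoff a b by (auto simp: payoff_assumption_def)
  ultimately show "(\<Sum>\<^sub>\<infinity>k. (1 + knorm k) * exp (\<beta> * knorm k) * cmod (G (ma T) k - G (mb T) k))
    \<le> ctG * \<Psi>2 (2 * M) * norm_PM \<beta> (\<lambda>k. ma T k - mb T k)"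
    by (simp add: norm_B1_def mult_ac)
qed

text \<open>
  The weight \<open>exp (\<alpha> T |k|)\<close> is constant in time here, so the full rate \<open>|k|\<^sup>2\<close> of the heat kernel is
  available and one factor \<open>|k|\<close> is recovered with constant 1.
\<close>

lemma backward_diff_le:
  assumes t: "t \<in> {0..T}"
  shows "exp (\<beta> * knorm k) * cmod (va t k $ i - vb t k $ i)
    \<le> (1 + knorm k) * exp (\<beta> * knorm k) * cmod (G (ma T) k - G (mb T) k)
      + ham_diff_majorant f1 g1 F1 k"
proof -
  define \<kappa> where "\<kappa> = knorm k"
  define e where "e = exp (\<beta> * \<kappa>)"
  let ?ha = "ham f1 g1 va ma" and ?hb = "ham f1 g1 vb mb"
  let ?F = "\<lambda>s. heat (s - t) (?ha s) k - heat (s - t) (?hb s) k"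
  let ?h = "ham_diff_majorant f1 g1 F1 k"
  have h0: "0 \<le> ?h"
    by (rule ham_diff_majorant_nonneg[OF bounds(1)]) (auto intro: in_B_compose in_va in_vb)
  note int = ham1_integrable[OF in_va in_ma t, of k] ham1_integrable[OF in_vb in_mb t, of k]
  have I: "\<kappa> * cmod (integral {t..T} ?F) \<le> ?h / e"
  proof (cases "k = 0")
    case True
    then show ?thesis using h0 by (simp add: \<kappa>_def e_def)
  next
    case False
    have \<kappa>: "1 \<le> \<kappa>" unfolding \<kappa>_def by (rule knorm_ge_1[OF False])
    have "cmod (integral {t..T} ?F) \<le> (?h / e) / \<kappa>\<^sup>2"
    proof (rule integral_exp_kernel_le')
      fix s assume s: "s \<in> {t..T}"
      then have s': "s \<in> {0..T}" using t by auto
      have "e * cmod (?ha s k - ?hb s k) \<le> ?h"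
        unfolding e_def \<kappa>_def
        by (rule ham_diff_le_majorant[OF bounds(1) _ _ _ _ s']) (intro in_B_compose in_va in_vb)+
      then have "cmod (?ha s k - ?hb s k) \<le> ?h / e" by (simp add: e_def field_simps)
      then have "exp (- (\<kappa>\<^sup>2 * (s - t))) * cmod (?ha s k - ?hb s k) \<le> exp (- (\<kappa>\<^sup>2 * (s - t))) * (?h / e)"
        by (rule mult_left_mono) simp
      then show "cmod (?F s) \<le> ?h / e * exp (- (\<kappa>\<^sup>2 * (s - t)))"
        by (simp add: heat_def \<kappa>_def scaleR_diff_right[symmetric] mult.commute)
    qed (use t \<kappa> h0 integrable_diff[OF int] in \<open>auto simp: e_def\<close>)
    then have "\<kappa> * cmod (integral {t..T} ?F) \<le> \<kappa> * ((?h / e) / \<kappa>\<^sup>2)"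
      using \<kappa> by (intro mult_left_mono) auto
    also have "\<dots> = (?h / e) / \<kappa>" using \<kappa> by (simp add: power2_eq_square)
    also have "\<dots> \<le> (?h / e) / 1" using \<kappa> h0 by (intro divide_left_mono) (auto simp: e_def)
    finally show ?thesis by simp
  qed
  define g where "g = G (ma T) k - G (mb T) k"
  have comp: "va t k $ i = heat (T - t) (grad_coeffs (G (ma T))) k $ i
      + \<i> * of_int (k $ i) * integral {t..T} (\<lambda>s. heat (s - t) (?ha s) k)"
    "vb t k $ i = heat (T - t) (grad_coeffs (G (mb T))) k $ i
      + \<i> * of_int (k $ i) * integral {t..T} (\<lambda>s. heat (s - t) (?hb s) k)"
    using sol_a sol_b t unfolding mild_solution_def
    by (simp_all add: grad_coeffs_integral[OF int(1), symmetric] grad_coeffs_integral[OF int(2), symmetric])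
  have "va t k $ i - vb t k $ i
      = exp (- (\<kappa>\<^sup>2 * (T - t))) *\<^sub>R (\<i> * of_int (k $ i) * g) + \<i> * of_int (k $ i) * integral {t..T} ?F"
    unfolding comp integral_diff[OF int]
    by (simp add: heat_def grad_coeffs_def g_def \<kappa>_def algebra_simps)
  then have "cmod (va t k $ i - vb t k $ i) \<le> exp (- (\<kappa>\<^sup>2 * (T - t))) * (\<bar>real_of_int (k $ i)\<bar> * cmod g)
      + \<bar>real_of_int (k $ i)\<bar> * cmod (integral {t..T} ?F)"
    by (metis (no_types, lifting) norm_triangle_ineq norm_scaleR norm_mult norm_ii norm_of_int mult_1 abs_exp_cancel)
  also have "\<dots> \<le> 1 * ((1 + \<kappa>) * cmod g) + \<kappa> * cmod (integral {t..T} ?F)"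
    using t component_le_knorm[of k i] unfolding \<kappa>_def
    by (intro add_mono mult_mono) auto
  also have "\<dots> \<le> (1 + \<kappa>) * cmod g + ?h / e" using I by simp
  finally have "e * cmod (va t k $ i - vb t k $ i) \<le> e * ((1 + \<kappa>) * cmod g + ?h / e)"
    by (rule mult_left_mono) (simp add: e_def)
  also have "\<dots> = (1 + \<kappa>) * e * cmod g + ?h" by (simp add: e_def algebra_simps)
  finally show ?thesis by (simp add: e_def \<kappa>_def g_def)
qed

lemma D_backward:
  "D \<le> real CARD('d) * (ctG * \<Psi>2 (2 * M) * norm_PM \<beta> (\<lambda>k. ma T k - mb T k) + ham_diff_bound f1 F1 G1)"
proof -
  note s = terminal_diff_le(1) ham_diff_majorant_summable(1)[OF in_B_compose(3)[OF in_va] in_B_compose(3)[OF in_vb], of f1 F1]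
  have "norm_B \<beta> T (\<lambda>t k. va t k $ i - vb t k $ i)
    \<le> ctG * \<Psi>2 (2 * M) * norm_PM \<beta> (\<lambda>k. ma T k - mb T k) + ham_diff_bound f1 F1 G1" for i
  proof -
    have "norm_B \<beta> T (\<lambda>t k. va t k $ i - vb t k $ i)
      \<le> (\<Sum>\<^sub>\<infinity>k. (1 + knorm k) * exp (\<beta> * knorm k) * cmod (G (ma T) k - G (mb T) k)
          + ham_diff_majorant f1 g1 F1 k)"
      by (rule majorant_norm_B[OF T0 backward_diff_le summable_on_add[OF s]])
    also have "\<dots> \<le> ctG * \<Psi>2 (2 * M) * norm_PM \<beta> (\<lambda>k. ma T k - mb T k) + ham_diff_bound f1 F1 G1"
      unfolding infsum_add[OF s] by (intro add_mono terminal_diff_le(2) ham1_diff_bound)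
    finally show ?thesis .
  qed
  then have "(\<Sum>i\<in>(UNIV :: 'd set). norm_B \<beta> T (\<lambda>t k. va t k $ i - vb t k $ i))
    \<le> (\<Sum>i\<in>(UNIV :: 'd set). ctG * \<Psi>2 (2 * M) * norm_PM \<beta> (\<lambda>k. ma T k - mb T k) + ham_diff_bound f1 F1 G1)"
    by (intro sum_mono)
  then show ?thesis by (simp add: D_def norm_Bvec_def)
qed

end

section \<open>Convergence of the coefficients\<close>

text \<open>
  The coefficient with which the Hamiltonian built from \<open>f\<close> and \<open>g\<close> (labels \<open>l\<close> and \<open>l'\<close>) feeds the
  differences of the solutions back into themselves. Every summand contains a size or a Lipschitz
  bound of each of \<open>f\<close> and \<open>g\<close>, but never two Lipschitz bounds.
\<close>

definition interaction_strength ::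
    "(ham_label \<Rightarrow> real) \<Rightarrow> (ham_label \<Rightarrow> real) \<Rightarrow> (ham_label \<Rightarrow> real) \<Rightarrow> (ham_label \<Rightarrow> real) \<Rightarrow>
      real \<Rightarrow> ham_label \<Rightarrow> ham_label \<Rightarrow> real" where
  "interaction_strength c p ct pt R l l' =
     lipschitz_bound ct pt R l' * size_bound c p R l + size_bound c p R l' * lipschitz_bound ct pt R l
     + size_bound c p R l' * size_bound c p R l"

locale mild_sequence =
  fixes T \<alpha> R M cG ctG :: real and \<Psi>1 \<Psi>2 :: "real \<Rightarrow> real"
    and G :: "'d::finite coeffs \<Rightarrow> 'd coeffs"
    and f1 f2 g1 :: "real ^ 'd \<Rightarrow> real" and g2 :: "real ^ 'd \<Rightarrow> real ^ 'd"
    and c p ct pt :: "ham_label \<Rightarrow> real"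
    and \<mu> :: "nat \<Rightarrow> 'd coeffs" and \<mu>_lim :: "'d coeffs"
    and v :: "nat \<Rightarrow> real \<Rightarrow> 'd vcoeffs" and v_lim :: "real \<Rightarrow> 'd vcoeffs"
    and m :: "nat \<Rightarrow> real \<Rightarrow> 'd coeffs" and m_lim :: "real \<Rightarrow> 'd coeffs"
  assumes pairs: "\<And>n. mild_pair T \<alpha> R M cG ctG \<Psi>1 \<Psi>2 G f1 f2 g1 g2 c p ct pt
      (\<mu> n) \<mu>_lim (v n) v_lim (m n) m_lim"
    and initial: "\<And>k. (\<lambda>n. \<mu> n k) \<longlonglongrightarrow> \<mu>_lim k"
begin

sublocale pair: mild_pair T \<alpha> R M cG ctG \<Psi>1 \<Psi>2 G f1 f2 g1 g2 c p ct pt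
    "\<mu> n" \<mu>_lim "v n" v_lim "m n" m_lim for n
  by (rule pairs)

abbreviation "\<beta> \<equiv> \<alpha> * T"
abbreviation "bnd \<equiv> size_bound c p R"
abbreviation "lip \<equiv> lipschitz_bound ct pt R"

abbreviation "strength \<equiv> interaction_strength c p ct pt R"

text \<open>
  One constant that asymptotically bounds all frequencies and \<open>v\<close> together. The order of quantifiers
  matters: the index from which the bound holds may depend on the frequency.
\<close>

definition close :: "real \<Rightarrow> bool" where
  "close C \<longleftrightarrow> 0 \<le> C \<and> (\<forall>k. asymp_le (\<lambda>n. pair.A n k) C) \<and> asymp_le pair.D C"

lemma initial_diff: "asymp_le (\<lambda>n. cmod (\<mu> n k - \<mu>_lim k)) 0"
  by (rule asymp_le_tendsto_0) (use initial in \<open>auto intro!: tendsto_norm_zero LIM_zero\<close>)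

lemma asymp_fluct:
  assumes C: "close C" and f: "in_B \<beta> T (compose f v_lim)" "norm_B \<beta> T (compose f v_lim) \<le> b"
  shows "asymp_le (\<lambda>n. pair.fluct n f) (C * b)"
proof -
  have "asymp_le (\<lambda>n. \<Sum>\<^sub>\<infinity>j. pair.A n j * coeff_sup \<beta> T (compose f v_lim) (- j)) (C * norm_B \<beta> T (compose f v_lim))"
    unfolding norm_B_eq
    by (rule asymp_le_infsum_bij[where B = "2 * M"])
       (use C f pair.T0 in \<open>auto simp: close_def pair.A0 pair.A_le bij_uminus_lattice
           intro: in_B_summable coeff_sup_nonneg\<close>)
  moreover have "pair.fluct n f = (\<Sum>\<^sub>\<infinity>j. pair.A n j * coeff_sup \<beta> T (compose f v_lim) (- j))" for n
    unfolding pair.fluct_def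
    using infsum_reindex_bij_betw[OF bij_uminus_lattice,
        of "\<lambda>j. pair.A n (- j) * coeff_sup \<beta> T (compose f v_lim) j"] by simp
  ultimately have "asymp_le (\<lambda>n. pair.fluct n f) (C * norm_B \<beta> T (compose f v_lim))" by simp
  then show ?thesis
    by (rule asymp_le_trans) (use C f in \<open>auto simp: close_def intro: mult_left_mono\<close>)
qed

lemma asymp_ham_diff:
  assumes C: "close C" and f: "in_B \<beta> T (compose f v_lim)" "norm_B \<beta> T (compose f v_lim) \<le> bnd l"
    and nn: "0 \<le> bnd l" "0 \<le> lip l" "0 \<le> bnd l'" "0 \<le> lip l'"
  shows "asymp_le (\<lambda>n. pair.ham_diff_bound n f l l') (C * ((M + 1) * strength l l'))"
proof -
  have D: "asymp_le pair.D C" and C0: "0 \<le> C" using C by (auto simp: close_def)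
  have "asymp_le (\<lambda>n. (lip l' * (M * bnd l) + bnd l' * (M * lip l)) * pair.D n + bnd l' * pair.fluct n f)
      ((lip l' * (M * bnd l) + bnd l' * (M * lip l)) * C + bnd l' * (C * bnd l))"
    using nn pair.M0 by (intro asymp_le_add asymp_le_cmult D asymp_fluct[OF C f]) auto
  then show ?thesis
  proof (rule asymp_le_trans)
    show "pair.ham_diff_bound n f l l'
        \<le> (lip l' * (M * bnd l) + bnd l' * (M * lip l)) * pair.D n + bnd l' * pair.fluct n f" for n
      by (simp add: pair.ham_diff_bound_def algebra_simps)
    have "0 \<le> C * (bnd l' * lip l + lip l' * bnd l + M * (bnd l' * bnd l))"
      using C0 nn pair.M0 by auto
    then show "(lip l' * (M * bnd l) + bnd l' * (M * lip l)) * C + bnd l' * (C * bnd l)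
        \<le> C * ((M + 1) * strength l l')"
      by (simp add: interaction_strength_def algebra_simps)
  qed
qed

lemma norm_g2_le:
  "(\<Sum>i\<in>UNIV. norm_B \<beta> T (compose (\<lambda>y. g2 y $ i) v_lim)) \<le> bnd G2"
  using pair.vector_bounds(1)[OF pair.bounds(4)] by (simp add: norm_Bvec_def vcompose_def)

lemma asymp_flux:
  assumes C: "close C"
  shows "asymp_le (\<lambda>n. pair.flux_bound n k) (C * (M * (M + 2) * strength F2 G2))"
proof -
  let ?w = "\<lambda>i j. coeff_sup \<beta> T (compose (\<lambda>y. g2 y $ i) v_lim) j * (M * bnd F2)"
  have C0: "0 \<le> C" using C by (auto simp: close_def)
  have M0: "0 \<le> M" by (rule pair.M0)
  note nn = pair.bounds_nonneg
  have iw: "infsum (?w i) UNIV = norm_B \<beta> T (compose (\<lambda>y. g2 y $ i) v_lim) * (M * bnd F2)" for i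
    by (simp add: infsum_cmult_left' norm_B_eq)
  have 1: "asymp_le (\<lambda>n. \<Sum>i\<in>UNIV. \<Sum>\<^sub>\<infinity>j. pair.A n j * ?w i (k - j))
      (\<Sum>i\<in>UNIV. C * infsum (?w i) UNIV)"
  proof (rule asymp_le_sum)
    fix i
    have s: "?w i summable_on UNIV"
      by (intro summable_on_cmult_left in_B_summable pair.in_B_compose pair.in_vb)
    have w0: "0 \<le> ?w i j" for j
      using M0 nn pair.T0 by (intro mult_nonneg_nonneg coeff_sup_nonneg pair.in_B_compose pair.in_vb)
    show "asymp_le (\<lambda>n. \<Sum>\<^sub>\<infinity>j. pair.A n j * ?w i (k - j)) (C * infsum (?w i) UNIV)"
      using C by (intro asymp_le_infsum_bij[where B = "2 * M", OF _ pair.A0 pair.A_le s w0 bij_reflect])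
        (auto simp: close_def)
  qed
  have 2: "asymp_le (\<lambda>n. M * pair.ham_diff_bound n f2 F2 G2) (M * (C * ((M + 1) * strength F2 G2)))"
    by (intro asymp_le_cmult asymp_ham_diff[OF C] pair.in_B_compose pair.in_vb
        pair.scalar_bounds(2)[OF pair.bounds(2)] nn M0)
  show ?thesis
  proof (rule asymp_le_trans[OF asymp_le_add[OF 1 2]])
    have "(\<Sum>i\<in>UNIV. C * infsum (?w i) UNIV)
        = C * (M * bnd F2) * (\<Sum>i\<in>UNIV. norm_B \<beta> T (compose (\<lambda>y. g2 y $ i) v_lim))"
      unfolding iw by (simp add: sum_distrib_left mult_ac)
    also have "\<dots> \<le> C * (M * bnd F2) * bnd G2"
      using C0 M0 nn by (intro mult_left_mono norm_g2_le) auto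
    also have "\<dots> \<le> C * M * strength F2 G2"
      using C0 M0 nn by (simp add: interaction_strength_def algebra_simps)
    finally show "(\<Sum>i\<in>UNIV. C * infsum (?w i) UNIV) + M * (C * ((M + 1) * strength F2 G2))
        \<le> C * (M * (M + 2) * strength F2 G2)"
      by (simp add: algebra_simps)
  qed (simp add: pair.flux_bound_def)
qed

lemma flux_uniformly_bounded: "\<exists>E\<ge>0. \<forall>n k. pair.flux_bound n k \<le> E"
proof -
  let ?w = "\<lambda>i j. coeff_sup \<beta> T (compose (\<lambda>y. g2 y $ i) v_lim) j * (M * bnd F2)"
  have M0: "0 \<le> M" by (rule pair.M0)
  note nn = pair.bounds_nonneg
  let ?H = "lip G2 * (2 * R) * (M * bnd F2)
      + bnd G2 * (M * (lip F2 * (2 * R)) + 2 * M * norm_B \<beta> T (compose f2 v_lim))"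
  let ?E = "(\<Sum>i\<in>UNIV. 2 * M * infsum (?w i) UNIV) + M * ?H"
  have "pair.flux_bound n k \<le> ?E" for n k
    unfolding pair.flux_bound_def
  proof (intro add_mono sum_mono mult_left_mono M0)
    fix i
    have s: "?w i summable_on UNIV"
      by (intro summable_on_cmult_left in_B_summable pair.in_B_compose pair.in_vb)
    have w0: "0 \<le> ?w i j" for j
      using M0 nn pair.T0 by (intro mult_nonneg_nonneg coeff_sup_nonneg pair.in_B_compose pair.in_vb)
    have "(\<Sum>\<^sub>\<infinity>j. pair.A n j * ?w i (k - j)) \<le> 2 * M * (\<Sum>\<^sub>\<infinity>j. ?w i (k - j))"
      by (rule bounded_mult_summable(2)[OF summable_on_reflect[OF s]])
         (rule w0 pair.A0 pair.A_le)+
    then show "(\<Sum>\<^sub>\<infinity>j. pair.A n j * ?w i (k - j)) \<le> 2 * M * infsum (?w i) UNIV"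
      using infsum_reflect[of "?w i" k] by simp
  next
    show "pair.ham_diff_bound n f2 F2 G2 \<le> ?H"
      unfolding pair.ham_diff_bound_def
      using nn M0 pair.D_le pair.fluct_bounds(2)[OF pair.in_B_compose(2)[OF pair.in_vb]]
      by (intro add_mono mult_left_mono mult_right_mono) auto
  qed
  then show ?thesis by (intro exI[of _ "max 0 ?E"]) (auto simp: le_max_iff_disj)
qed

lemma asymp_A:
  assumes "close C"
  shows "asymp_le (\<lambda>n. pair.A n k) (C * (M * (M + 2) * strength F2 G2 / (1 - \<alpha>)))"
proof -
  have "asymp_le (\<lambda>n. cmod (\<mu> n k - \<mu>_lim k) + 1 / (1 - \<alpha>) * pair.flux_bound n k)
      (0 + 1 / (1 - \<alpha>) * (C * (M * (M + 2) * strength F2 G2)))"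
    using pair.\<alpha> by (intro asymp_le_add initial_diff asymp_le_cmult asymp_flux[OF assms]) auto
  then show ?thesis
    by (rule asymp_le_trans) (use pair.A_forward in \<open>auto simp: field_simps\<close>)
qed

lemma initial_diff_le: "cmod (\<mu> n k - \<mu>_lim k) \<le> 2 * M"
proof -
  have "m n 0 k = \<mu> n k" "m_lim 0 k = \<mu>_lim k"
    using pair.sol_a[of n] pair.sol_b pair.T by (auto simp: mild_solution_def heat_def)
  with pair.weighted_diff_le_2M[of 0 k n] pair.T show ?thesis by simp
qed

lemma exp_minus_le:
  assumes "0 < y" shows "exp (- y) \<le> 1 / (y :: real)"
proof -
  have "y \<le> exp y" using exp_ge_add_one_self[of y] by linarith
  then show ?thesis using assms by (simp add: exp_minus inverse_eq_divide frac_le)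
qed

text \<open>
  Uniformly in \<open>n\<close>, both terms of \<open>forward_diff_le\<close> at time \<open>T\<close> are of order \<open>1 / (|k| - \<alpha>)\<close>. This is
  where \<open>T > 0\<close> is essential: at time zero there is no decay of the data.
\<close>

lemma high_frequencies:
  assumes "\<eta> > 0"
  obtains K where "\<And>n k. K \<le> knorm k \<Longrightarrow> exp (\<beta> * knorm k) * cmod (m n T k - m_lim T k) \<le> \<eta>"
proof -
  obtain E where E: "0 \<le> E" "\<And>n k. pair.flux_bound n k \<le> E"
    using flux_uniformly_bounded by blast
  \<comment> \<open>The first summand bounds the damped datum, by \<open>exp (- y) \<le> 1 / y\<close>; the second one bounds the flux.\<close>
  define Q where "Q = 2 * M / ((1 - \<alpha>) * T) + E"
  have Q0: "0 \<le> Q" unfolding Q_def using E(1) pair.M0 pair.T pair.\<alpha> by auto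
  show ?thesis
  proof (rule that[of "1 + \<alpha> + Q / \<eta>"])
    fix n and k :: "int ^ 'd" assume K: "1 + \<alpha> + Q / \<eta> \<le> knorm k"
    define \<kappa> where "\<kappa> = knorm k"
    have "0 \<le> Q / \<eta>" using Q0 assms by simp
    then have \<kappa>: "1 \<le> \<kappa>" "0 < \<kappa> - \<alpha>" "Q / \<eta> \<le> \<kappa> - \<alpha>"
      using K pair.\<alpha> by (auto simp: \<kappa>_def)
    then have "k \<noteq> 0" by (auto simp: \<kappa>_def)
    then have "exp (\<beta> * \<kappa>) * cmod (m n T k - m_lim T k)
      \<le> exp (\<beta> * \<kappa> - \<kappa>\<^sup>2 * T) * cmod (\<mu> n k - \<mu>_lim k) + pair.flux_bound n k / (\<kappa> - \<alpha>)"
      unfolding \<kappa>_def using pair.forward_diff_le[of T k n] pair.T0 by auto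
    also have "\<dots> \<le> 1 / ((1 - \<alpha>) * T * (\<kappa> - \<alpha>)) * (2 * M) + E / (\<kappa> - \<alpha>)"
    proof (intro add_mono mult_mono initial_diff_le divide_right_mono E(2))
      have y: "0 < (1 - \<alpha>) * T * (\<kappa> - \<alpha>)" using pair.\<alpha> pair.T \<kappa> by simp
      have "(1 - \<alpha>) * T * (\<kappa> - \<alpha>) \<le> (\<kappa> - \<alpha>) * T * \<kappa>"
        using pair.\<alpha> pair.T \<kappa> by (simp add: mult_ac mult_mono)
      also have "\<dots> = \<kappa>\<^sup>2 * T - \<beta> * \<kappa>" by (simp add: power2_eq_square algebra_simps)
      finally have "exp (\<beta> * \<kappa> - \<kappa>\<^sup>2 * T) \<le> exp (- ((1 - \<alpha>) * T * (\<kappa> - \<alpha>)))" by simp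
      also have "\<dots> \<le> 1 / ((1 - \<alpha>) * T * (\<kappa> - \<alpha>))"
        by (rule exp_minus_le[OF y])
      finally show "exp (\<beta> * \<kappa> - \<kappa>\<^sup>2 * T) \<le> 1 / ((1 - \<alpha>) * T * (\<kappa> - \<alpha>))" .
      show "0 \<le> 1 / ((1 - \<alpha>) * T * (\<kappa> - \<alpha>))" using y by simp
    qed (use \<kappa> in auto)
    also have "\<dots> = Q / (\<kappa> - \<alpha>)" by (simp add: Q_def field_simps add_divide_distrib)
    also have "\<dots> \<le> \<eta>" using \<kappa> assms by (simp add: field_simps)
    finally show "exp (\<beta> * knorm k) * cmod (m n T k - m_lim T k) \<le> \<eta>" by (simp add: \<kappa>_def)
  qed
qed

text \<open>
  At the terminal time the frequency-wise bounds combine into a bound for the norm.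
\<close>

lemma asymp_terminal:
  assumes C: "close C" and B: "\<And>k. asymp_le (\<lambda>n. pair.A n k) B" "0 \<le> B"
  shows "asymp_le (\<lambda>n. norm_PM \<beta> (\<lambda>k. m n T k - m_lim T k)) B"
  unfolding asymp_le_def
proof (intro allI impI)
  fix \<eta> :: real assume \<eta>: "\<eta> > 0"
  obtain K where K: "\<And>n k. K \<le> knorm k \<Longrightarrow> exp (\<beta> * knorm k) * cmod (m n T k - m_lim T k) \<le> \<eta>"
    using high_frequencies[OF \<eta>] by blast
  have "\<forall>\<^sub>F n in sequentially. \<forall>k\<in>{k. knorm k \<le> K}. pair.A n k \<le> B + \<eta>"
    using B(1) \<eta> by (intro eventually_ball_finite finite_knorm_le) (simp add: asymp_le_def)
  then show "\<forall>\<^sub>F n in sequentially. norm_PM \<beta> (\<lambda>k. m n T k - m_lim T k) \<le> B + \<eta>"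
  proof eventually_elim
    case (elim n)
    have "exp (\<beta> * knorm k) * cmod (m n T k - m_lim T k) \<le> B + \<eta>" for k
    proof (cases "knorm k \<le> K")
      case True
      then show ?thesis using elim pair.le_A[of T k n] pair.T0 by force
    next
      case False
      then show ?thesis using K[of k n] B(2) by simp
    qed
    then show ?case unfolding norm_PM_def by (intro cSUP_least) auto
  qed
qed

lemma strength_nonneg: "0 \<le> strength F1 G1" "0 \<le> strength F2 G2"
  using pair.bounds_nonneg by (auto simp: interaction_strength_def)

text \<open>
  The payoff contributes the asymptotic bound of \<open>asymp_A\<close> with the factor \<open>ctG * \<Psi>2 (2 * M)\<close>, so
  even this term is proportional to an interaction strength.
\<close>

lemma asymp_D:
  assumes C: "close C"
  shows "asymp_le pair.D (C * (real CARD('d) * (ctG * \<Psi>2 (2 * M) * (M * (M + 2) * strength F2 G2 / (1 - \<alpha>))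
      + (M + 1) * strength F1 G1)))"
proof -
  have C0: "0 \<le> C" using C by (auto simp: close_def)
  let ?B = "C * (M * (M + 2) * strength F2 G2 / (1 - \<alpha>))"
  have B0: "0 \<le> ?B" using C0 pair.M0 pair.\<alpha> strength_nonneg by simp
  have "asymp_le (\<lambda>n. real CARD('d) * (ctG * \<Psi>2 (2 * M) * norm_PM \<beta> (\<lambda>k. m n T k - m_lim T k)
        + pair.ham_diff_bound n f1 F1 G1))
      (real CARD('d) * (ctG * \<Psi>2 (2 * M) * ?B + C * ((M + 1) * strength F1 G1)))"
    by (intro asymp_le_cmult asymp_le_add asymp_terminal[OF C asymp_A[OF C] B0] pair.terminal_diff_le(3)
        asymp_ham_diff[OF C] pair.in_B_compose pair.in_vb
        pair.scalar_bounds(2)[OF pair.bounds(1)] pair.bounds_nonneg) auto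
  then show ?thesis
    by (rule asymp_le_trans[OF _ pair.D_backward]) (simp add: algebra_simps)
qed

text \<open>
  The two smallness conditions say that the factors in \<open>asymp_A\<close> and \<open>asymp_D\<close> are at most \<open>1 / 2\<close>. The
  iteration starts from the bounds that hold for every index.
\<close>

lemma convergence:
  assumes s1: "M * (M + 2) * strength F2 G2 / (1 - \<alpha>) \<le> 1 / 2"
    and s2: "real CARD('d) * (ctG * \<Psi>2 (2 * M) * (M * (M + 2) * strength F2 G2 / (1 - \<alpha>))
      + (M + 1) * strength F1 G1) \<le> 1 / 2"
  shows "(\<lambda>n. pair.A n k) \<longlonglongrightarrow> 0" and "pair.D \<longlonglongrightarrow> 0"
proof -
  have halve: "close (C / 2)" if C: "close C" for C
  proof -
    have C0: "0 \<le> C" using C by (auto simp: close_def)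
    show ?thesis
      unfolding close_def
    proof (intro conjI allI)
      show "asymp_le (\<lambda>n. pair.A n k) (C / 2)" for k
        by (rule asymp_le_trans[OF asymp_A[OF C]]) (use mult_left_mono[OF s1 C0] in auto)
      show "asymp_le pair.D (C / 2)"
        by (rule asymp_le_trans[OF asymp_D[OF C]]) (use mult_left_mono[OF s2 C0] in auto)
    qed (use C0 in auto)
  qed
  let ?C = "2 * M + 2 * R"
  have "close (?C / 2 ^ j)" for j
  proof (induction j)
    case 0
    show ?case
      using pair.M0 pair.R0 pair.A_le pair.D_le
      by (auto simp: close_def intro!: asymp_leI_le) (smt (verit))+
  next
    case (Suc j)
    then show ?case using halve[OF Suc] by (simp add: field_simps)
  qed
  then have a: "asymp_le (\<lambda>n. pair.A n k) (?C / 2 ^ j)" "asymp_le pair.D (?C / 2 ^ j)" for j k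
    by (auto simp: close_def)
  show "(\<lambda>n. pair.A n k) \<longlonglongrightarrow> 0" by (rule asymp_le_all_tendsto_0[OF a(1) pair.A0])
  show "pair.D \<longlonglongrightarrow> 0" by (rule asymp_le_all_tendsto_0[OF a(2) pair.D0])
qed

end

section \<open>Absolutely convergent Fourier series as measures\<close>

definition enum_lattice :: "nat \<Rightarrow> int ^ 'd::finite" where
  "enum_lattice = from_nat_into UNIV"

lemma bij_enum_lattice: "bij enum_lattice"
  unfolding enum_lattice_def by (rule bij_betw_from_nat_into) (auto simp: infinite_lattice)

abbreviation abs_summable_coeffs :: "'d::finite coeffs \<Rightarrow> bool" where
  "abs_summable_coeffs a \<equiv> (\<lambda>k. cmod (a k)) summable_on UNIV"

lemma fourier_series_summable:
  assumes "abs_summable_coeffs a"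
  shows "(\<lambda>k. a k * cis (freq k \<bullet> x)) summable_on UNIV"
  by (rule abs_summable_summable) (use assms in \<open>simp add: norm_mult\<close>)

text \<open>
  The symmetry of the coefficients makes the series equal to its own conjugate.
\<close>

lemma of_real_synth:
  assumes a: "abs_summable_coeffs a" "real_coeffs a"
  shows "complex_of_real (synth a x) = (\<Sum>\<^sub>\<infinity>k. a k * cis (freq k \<bullet> x))"
proof -
  let ?S = "\<Sum>\<^sub>\<infinity>k. a k * cis (freq k \<bullet> x)"
  have "cnj ?S = (\<Sum>\<^sub>\<infinity>k. a (- k) * cis (freq (- k) \<bullet> x))"
    using a(2) by (simp add: infsum_cnj[symmetric] real_coeffs_def cis_cnj freq_uminus)
  also have "\<dots> = ?S"
    by (rule infsum_reindex_bij_betw[OF bij_uminus_lattice, of "\<lambda>k. a k * cis (freq k \<bullet> x)"])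
  finally have "Im (cnj ?S) = Im ?S" by (rule arg_cong)
  then have "Im ?S = 0" by simp
  then show ?thesis by (simp add: synth_def complex_eq_iff)
qed

lemma synth_diff_le:
  assumes "abs_summable_coeffs a" "abs_summable_coeffs b"
    and w: "w summable_on UNIV" "\<And>k. cmod (a k - b k) \<le> w k"
  shows "\<bar>synth a x - synth b x\<bar> \<le> infsum w UNIV"
proof -
  note s = fourier_series_summable[OF assms(1), of x] fourier_series_summable[OF assms(2), of x]
  have "(\<Sum>\<^sub>\<infinity>k. a k * cis (freq k \<bullet> x)) - (\<Sum>\<^sub>\<infinity>k. b k * cis (freq k \<bullet> x))
      = (\<Sum>\<^sub>\<infinity>k. a k * cis (freq k \<bullet> x) + - (b k * cis (freq k \<bullet> x)))"
    using s by (subst infsum_add) (auto simp: summable_on_uminus infsum_uminus)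
  also have "\<dots> = (\<Sum>\<^sub>\<infinity>k. (a k - b k) * cis (freq k \<bullet> x))" by (simp add: left_diff_distrib)
  finally have eq: "synth a x - synth b x = Re (\<Sum>\<^sub>\<infinity>k. (a k - b k) * cis (freq k \<bullet> x))"
    unfolding synth_def minus_complex.sel(1)[symmetric] by (rule arg_cong)
  have "(\<lambda>k. (a k - b k) * cis (freq k \<bullet> x)) summable_on UNIV"
    by (rule abs_summable_summable, rule summable_on_comparison_test[OF w(1)])
       (auto simp: norm_mult w(2))
  then have "cmod (\<Sum>\<^sub>\<infinity>k. (a k - b k) * cis (freq k \<bullet> x)) \<le> infsum w UNIV"
    by (intro norm_infsum_le[OF has_sum_infsum has_sum_infsum[OF w(1)]]) (auto simp: norm_mult w(2))
  with abs_Re_le_cmod show ?thesis unfolding eq by (rule order_trans)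
qed

lemma synth_bounded:
  assumes "abs_summable_coeffs a"
  shows "\<bar>synth a x\<bar> \<le> (\<Sum>\<^sub>\<infinity>k. cmod (a k))"
  using synth_diff_le[OF assms, of "\<lambda>_. 0" "\<lambda>k. cmod (a k)" x] assms by (simp add: synth_def)

lemma synth_measurable [measurable]:
  assumes "abs_summable_coeffs a"
  shows "synth a \<in> borel_measurable borel"
proof -
  have "(\<lambda>x. a k * cis (freq k \<bullet> x)) \<in> borel_measurable borel" for k
    by (intro borel_measurable_continuous_onI continuous_intros)
  then have "(\<lambda>x. \<Sum>\<^sub>\<infinity>k. a k * cis (freq k \<bullet> x)) \<in> borel_measurable borel"
    by (rule borel_measurable_infsum_lattice) (rule fourier_series_summable[OF assms])
  then show ?thesis unfolding synth_def[abs_def] by measurable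
qed

definition cell_measure :: "(real ^ 'd::finite) measure" where
  "cell_measure = restrict_space lborel torus_cell"

lemma torus_cell_borel [measurable]: "torus_cell \<in> sets borel"
proof -
  have "(torus_cell :: (real ^ 'd) set) = (\<Inter>i. {x. 0 \<le> x $ i} \<inter> {x. x $ i < 2 * pi})"
    by (auto simp: torus_cell_def)
  also have "\<dots> \<in> sets borel"
    by (intro sets.countable_INT'' sets.Int borel_closed borel_open closed_Collect_le open_Collect_less
        continuous_intros) auto
  finally show ?thesis .
qed

lemma torus_cell_subset: "(torus_cell :: (real ^ 'd::finite) set) \<subseteq> cbox 0 (\<chi> i. 2 * pi)"
  by (auto simp: torus_cell_def mem_box_cart less_imp_le)

lemma finite_cell_measure: "finite_measure (cell_measure :: (real ^ 'd::finite) measure)"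
proof (rule finite_measureI)
  have "emeasure lborel (torus_cell :: (real ^ 'd) set) \<le> emeasure lborel (cbox 0 (\<chi> i. 2 * pi) :: (real ^ 'd) set)"
    by (rule emeasure_mono[OF torus_cell_subset]) simp
  also have "\<dots> < \<infinity>" by (rule emeasure_lborel_cbox_finite)
  finally show "emeasure (cell_measure :: (real ^ 'd) measure) (space cell_measure) \<noteq> \<infinity>"
    by (simp add: cell_measure_def space_restrict_space emeasure_restrict_space)
qed

lemma sets_cell_measure: "sets cell_measure = sets (restrict_space borel torus_cell)"
  unfolding cell_measure_def by (rule sets_restrict_space_cong) simp

lemma measurable_cell: "f \<in> borel_measurable borel \<Longrightarrow> f \<in> borel_measurable cell_measure"
  unfolding cell_measure_def by (intro measurable_restrict_space1) simp

lemma integral_exp_circle: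
  fixes n :: real
  assumes "n \<in> \<int>"
  shows "(\<integral>y. indicator {0..<2 * pi} y *\<^sub>R cis (n * y) \<partial>lborel) = (if n = 0 then 2 * pi else 0)"
    and "integrable lborel (\<lambda>y. indicator {0..<2 * pi} y *\<^sub>R cis (n * y))"
proof -
  have ae: "AE y in lborel. indicator {0..<2 * pi} y *\<^sub>R cis (n * y) = indicator {0..2 * pi} y *\<^sub>R cis (n * y)"
    using AE_lborel_singleton[of "2 * pi"] by eventually_elim (auto simp: indicator_def)
  have m: "(\<lambda>y. cis (n * y)) \<in> borel_measurable borel"
    by (intro borel_measurable_continuous_onI continuous_intros)
  have i: "integrable lborel (\<lambda>y. indicator {0..2 * pi} y *\<^sub>R cis (n * y))"
    using borel_integrable_atLeastAtMost'[of 0 "2 * pi" "\<lambda>y. cis (n * y)"]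
    by (simp add: set_integrable_def continuous_intros)
  show "integrable lborel (\<lambda>y. indicator {0..<2 * pi} y *\<^sub>R cis (n * y))"
    using i ae m by (subst integrable_cong_AE[OF _ _ ae]) auto
  have "(\<integral>y. indicator {0..<2 * pi} y *\<^sub>R cis (n * y) \<partial>lborel)
      = (\<integral>y. indicator {0..2 * pi} y *\<^sub>R cis (n * y) \<partial>lborel)"
    using m by (intro integral_cong_AE ae) auto
  also have "\<dots> = (if n = 0 then 2 * pi else 0)"
  proof (cases "n = 0")
    case True
    then show ?thesis by (simp add: scaleR_conv_of_real)
  next
    case False
    let ?F = "\<lambda>y. cis (n * y) / (\<i> * n)"
    have "(\<integral>y. indicator {0..2 * pi} y *\<^sub>R cis (n * y) \<partial>lborel) = ?F (2 * pi) - ?F 0"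
    proof (rule integral_FTC_Icc)
      fix y
      have "((\<lambda>z. exp (\<i> * (of_real n * z)) / (\<i> * of_real n)) has_field_derivative exp (\<i> * (of_real n * of_real y)))
          (at (complex_of_real y))"
        using False by (auto intro!: derivative_eq_intros simp: algebra_simps)
      from has_vector_derivative_real_field[OF this]
      show "(?F has_vector_derivative cis (n * y)) (at y within {0..2 * pi})"
        by (simp add: cis_conv_exp)
    qed (auto intro!: continuous_intros)
    also have "\<dots> = 0" using assms by (simp add: mult.commute[of n])
    finally show ?thesis using False by simp
  qed
  finally show "(\<integral>y. indicator {0..<2 * pi} y *\<^sub>R cis (n * y) \<partial>lborel) = (if n = 0 then 2 * pi else 0)" .
qed

lemma cis_sum: "finite I \<Longrightarrow> cis (\<Sum>i\<in>I. f i) = (\<Prod>i\<in>I. cis (f i))"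
  by (induct rule: finite_induct) (auto simp: cis_mult[symmetric])

text \<open>
  Orthogonality of the characters. The Lebesgue measure is a product over the basis, and the
  indicator of the cell as well as the character factorise accordingly.
\<close>

lemma integral_cis_cell:
  fixes k :: "int ^ 'd::finite"
  shows "(\<integral>x. cis (freq k \<bullet> x) \<partial>cell_measure) = (if k = 0 then complex_of_real (2 * pi) ^ CARD('d) else 0)"
proof -
  let ?B = "Basis :: (real ^ 'd) set"
  define h where "h b y = indicator {0..<2 * pi} y *\<^sub>R cis ((freq k \<bullet> b) * y)" for b :: "real ^ 'd" and y :: real
  have int: "freq k \<bullet> b \<in> \<int>" if "b \<in> ?B" for b
    using that by (auto simp: Basis_vec_def inner_axis freq_def)
  interpret product_sigma_finite "\<lambda>_ :: real ^ 'd. lborel :: real measure"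
    by standard
  have split: "indicator torus_cell x *\<^sub>R cis (freq k \<bullet> x) = (\<Prod>b\<in>?B. h b (x \<bullet> b))" for x :: "real ^ 'd"
  proof -
    have "x \<in> torus_cell \<longleftrightarrow> (\<forall>b\<in>?B. x \<bullet> b \<in> {0..<2 * pi})"
      by (auto simp: torus_cell_def Basis_vec_def inner_axis)
    then have "indicator torus_cell x = (\<Prod>b\<in>?B. indicator {0..<2 * pi} (x \<bullet> b) :: real)"
      by (cases "x \<in> torus_cell") (auto simp: indicator_def intro!: prod.neutral[symmetric])
    moreover have "cis (freq k \<bullet> x) = (\<Prod>b\<in>?B. cis ((freq k \<bullet> b) * (x \<bullet> b)))"
      by (subst euclidean_inner) (simp add: cis_sum)
    ultimately show ?thesis
      by (simp add: h_def scaleR_conv_of_real prod.distrib)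
  qed
  have hm: "h b \<in> borel_measurable borel" for b
  proof -
    have "(\<lambda>y. cis ((freq k \<bullet> b) * y)) \<in> borel_measurable borel"
      by (intro borel_measurable_continuous_onI continuous_intros)
    then show ?thesis unfolding h_def by measurable
  qed
  have "(\<integral>x. cis (freq k \<bullet> x) \<partial>cell_measure) = (\<integral>x. (\<Prod>b\<in>?B. h b (x \<bullet> b)) \<partial>lborel)"
    unfolding cell_measure_def by (subst integral_restrict_space) (auto simp: split)
  also have "\<dots> = (\<integral>f. (\<Prod>b\<in>?B. h b ((\<Sum>c\<in>?B. f c *\<^sub>R c) \<bullet> b)) \<partial>(\<Pi>\<^sub>M b\<in>?B. lborel))"
    by (subst lborel_eq, subst integral_distr) (auto intro!: borel_measurable_prod measurable_compose[OF _ hm])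
  also have "\<dots> = (\<integral>f. (\<Prod>b\<in>?B. h b (f b)) \<partial>(\<Pi>\<^sub>M b\<in>?B. lborel))"
    by (intro Bochner_Integration.integral_cong refl prod.cong) (simp_all add: inner_sum_left_Basis)
  also have "\<dots> = (\<Prod>b\<in>?B. integral\<^sup>L lborel (h b))"
    by (rule product_integral_prod) (auto simp: h_def[abs_def] integral_exp_circle(2) int)
  also have "\<dots> = (\<Prod>b\<in>?B. if freq k \<bullet> b = 0 then complex_of_real (2 * pi) else 0)"
    by (intro prod.cong refl) (simp add: h_def[abs_def] integral_exp_circle(1) int)
  also have "\<dots> = (if k = 0 then complex_of_real (2 * pi) ^ CARD('d) else 0)"
  proof (cases "k = 0")
    case False
    then obtain i where "k $ i \<noteq> 0" by (auto simp: vec_eq_iff)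
    then have "freq k \<bullet> axis i 1 \<noteq> 0" "axis i 1 \<in> ?B"
      by (auto simp: inner_axis freq_def Basis_vec_def)
    then show ?thesis using False by (auto intro!: prod_zero bexI[of _ "axis i 1"])
  qed simp
  finally show ?thesis .
qed

lemma fourier_inversion:
  fixes a :: "'d::finite coeffs"
  assumes a: "abs_summable_coeffs a" "real_coeffs a"
  shows "(\<integral>x. synth a x *\<^sub>R cis (- (freq k \<bullet> x)) \<partial>cell_measure)
    = complex_of_real ((2 * pi) ^ CARD('d)) * a k"
proof -
  interpret finite_measure "cell_measure :: (real ^ 'd) measure" by (rule finite_cell_measure)
  define \<phi> where "\<phi> = (enum_lattice :: nat \<Rightarrow> int ^ 'd)"
  have \<phi>: "bij \<phi>" unfolding \<phi>_def by (rule bij_enum_lattice)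
  define f where "f i x = a (\<phi> i) * cis (freq (\<phi> i - k) \<bullet> x)" for i and x :: "real ^ 'd"
  have fm: "f i \<in> borel_measurable cell_measure" for i
    unfolding f_def by (intro measurable_cell borel_measurable_continuous_onI continuous_intros)
  have nf: "norm (f i x) = cmod (a (\<phi> i))" for i x by (simp add: f_def norm_mult)
  have sa: "summable (\<lambda>i. cmod (a (\<phi> i)))"
    using a(1) summable_on_reindex_bij_betw[OF \<phi>, of "\<lambda>k. cmod (a k)"]
    by (auto intro: summable_on_imp_summable)
  have sum: "synth a x *\<^sub>R cis (- (freq k \<bullet> x)) = (\<Sum>i. f i x)" for x
  proof -
    have "((\<lambda>k. a k * cis (freq k \<bullet> x)) has_sum complex_of_real (synth a x)) UNIV"
      unfolding of_real_synth[OF a] by (intro has_sum_infsum fourier_series_summable a)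
    then have "((\<lambda>i. a (\<phi> i) * cis (freq (\<phi> i) \<bullet> x)) has_sum complex_of_real (synth a x)) UNIV"
      using has_sum_reindex_bij_betw[OF \<phi>, of "\<lambda>k. a k * cis (freq k \<bullet> x)"] by simp
    then have "(\<lambda>i. a (\<phi> i) * cis (freq (\<phi> i) \<bullet> x)) sums complex_of_real (synth a x)"
      by (rule has_sum_imp_sums)
    from sums_mult2[OF this, of "cis (- (freq k \<bullet> x))"] show ?thesis
      by (simp add: f_def freq_diff inner_diff_left scaleR_conv_of_real mult.assoc cis_mult sums_iff)
  qed
  have int: "(\<integral>x. f i x \<partial>cell_measure) = (if \<phi> i = k then complex_of_real ((2 * pi) ^ CARD('d)) * a k else 0)" for i
    unfolding f_def by (simp add: integral_cis_cell)
  have L: "(\<lambda>i. \<integral>x. f i x \<partial>cell_measure) sums (\<integral>x. (\<Sum>i. f i x) \<partial>cell_measure)"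
  proof (rule sums_integral)
    show "integrable cell_measure (f i)" for i
      by (rule integrable_const_bound[of _ "cmod (a (\<phi> i))"]) (auto simp: nf fm)
    show "summable (\<lambda>i. \<integral>x. norm (f i x) \<partial>cell_measure)"
      unfolding nf using sa by (simp add: summable_mult)
  qed (use sa in \<open>simp add: nf\<close>)
  obtain i0 where i0: "\<phi> i0 = k" using surjD[OF bij_is_surj[OF \<phi>], of k] by auto
  let ?c = "complex_of_real ((2 * pi) ^ CARD('d)) * a k"
  have eq: "\<phi> i = k \<longleftrightarrow> i = i0" for i
    using inj_eq[OF bij_is_inj[OF \<phi>], of i i0] i0 by simp
  have "(\<lambda>i. \<integral>x. f i x \<partial>cell_measure) sums ?c"
    unfolding int eq by (rule sums_single)
  with L have "(\<integral>x. (\<Sum>i. f i x) \<partial>cell_measure) = ?c" by (rule sums_unique2)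
  then show ?thesis unfolding sum .
qed

text \<open>
  The measure whose density with respect to normalised Lebesgue measure is the Fourier series,
  represented by the positive and negative parts of the density.
\<close>

definition series_measure :: "'d::finite coeffs \<Rightarrow> 'd smeasure" where
  "series_measure a =
     (density cell_measure (\<lambda>x. ennreal (max 0 (synth a x) / (2 * pi) ^ CARD('d))),
      density cell_measure (\<lambda>x. ennreal (max 0 (- synth a x) / (2 * pi) ^ CARD('d))))"

lemma series_measure_integral:
  fixes a :: "'d::finite coeffs" and \<psi> :: "real ^ 'd \<Rightarrow> 'b::{banach, second_countable_topology}"
  assumes a: "abs_summable_coeffs a" and \<psi>: "\<psi> \<in> borel_measurable borel" "\<And>x. x \<in> torus_cell \<Longrightarrow> norm (\<psi> x) \<le> B"
  shows "smeasure_integral (series_measure a) \<psi>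
      = (\<integral>x. (synth a x / (2 * pi) ^ CARD('d)) *\<^sub>R \<psi> x \<partial>cell_measure)"
    and "integrable cell_measure (\<lambda>x. (synth a x / (2 * pi) ^ CARD('d)) *\<^sub>R \<psi> x)"
proof -
  interpret finite_measure "cell_measure :: (real ^ 'd) measure" by (rule finite_cell_measure)
  let ?P = "(2 * pi) ^ CARD('d) :: real"
  let ?N = "\<Sum>\<^sub>\<infinity>k. cmod (a k)"
  have P: "0 < ?P" by simp
  have i: "integrable cell_measure (\<lambda>x. (u x / ?P) *\<^sub>R \<psi> x)"
    if "u \<in> borel_measurable borel" "\<And>x. \<bar>u x\<bar> \<le> ?N" for u
  proof (rule integrable_const_bound)
    show "(\<lambda>x. (u x / ?P) *\<^sub>R \<psi> x) \<in> borel_measurable cell_measure"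
      by (intro measurable_cell borel_measurable_scaleR borel_measurable_divide that \<psi>) auto
    show "AE x in cell_measure. norm ((u x / ?P) *\<^sub>R \<psi> x) \<le> (?N / ?P) * B"
    proof (rule AE_I2)
      fix x :: "real ^ 'd" assume "x \<in> space cell_measure"
      then have "x \<in> torus_cell" by (simp add: cell_measure_def space_restrict_space)
      then show "norm ((u x / ?P) *\<^sub>R \<psi> x) \<le> (?N / ?P) * B"
        using that(2)[of x] P \<psi>(2)[of x]
        unfolding norm_scaleR by (intro mult_mono) (auto simp: divide_right_mono intro: order_trans[OF abs_ge_zero])
    qed
  qed
  have m: "synth a \<in> borel_measurable borel" by (rule synth_measurable[OF a])
  have i2: "integrable cell_measure (\<lambda>x. (max 0 (synth a x) / ?P) *\<^sub>R \<psi> x)"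
    "integrable cell_measure (\<lambda>x. (max 0 (- synth a x) / ?P) *\<^sub>R \<psi> x)"
  proof -
    have "\<bar>max 0 (synth a x)\<bar> \<le> ?N" "\<bar>max 0 (- synth a x)\<bar> \<le> ?N" for x
      using synth_bounded[OF a, of x] by linarith+
    note b = this
    show "integrable cell_measure (\<lambda>x. (max 0 (synth a x) / ?P) *\<^sub>R \<psi> x)"
      by (rule i[OF borel_measurable_max[OF m borel_measurable_const] b(1)])
    show "integrable cell_measure (\<lambda>x. (max 0 (- synth a x) / ?P) *\<^sub>R \<psi> x)"
      by (rule i[OF borel_measurable_max[OF borel_measurable_uminus[OF m] borel_measurable_const] b(2)])
  qed
  show "integrable cell_measure (\<lambda>x. (synth a x / ?P) *\<^sub>R \<psi> x)"
    by (intro i m synth_bounded a)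
  have d: "integral\<^sup>L (density cell_measure (\<lambda>x. ennreal (u x / ?P))) \<psi> = (\<integral>x. (u x / ?P) *\<^sub>R \<psi> x \<partial>cell_measure)"
    if "u \<in> borel_measurable borel" "\<And>x. 0 \<le> u x" for u
  proof (rule integral_density)
    show "(\<lambda>x. u x / ?P) \<in> borel_measurable cell_measure"
      by (rule measurable_cell[OF borel_measurable_divide[OF that(1) borel_measurable_const]])
    show "AE x in cell_measure. 0 \<le> u x / ?P"
      by (rule AE_I2) (simp add: that(2))
  qed (rule measurable_cell[OF \<psi>(1)])
  have "smeasure_integral (series_measure a) \<psi>
      = (\<integral>x. (max 0 (synth a x) / ?P) *\<^sub>R \<psi> x \<partial>cell_measure) - (\<integral>x. (max 0 (- synth a x) / ?P) *\<^sub>R \<psi> x \<partial>cell_measure)"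
    unfolding smeasure_integral_def series_measure_def fst_conv snd_conv
    unfolding d[OF borel_measurable_max[OF m borel_measurable_const] max.cobounded1]
      d[OF borel_measurable_max[OF borel_measurable_uminus[OF m] borel_measurable_const] max.cobounded1] ..
  also have "\<dots> = (\<integral>x. (max 0 (synth a x) / ?P) *\<^sub>R \<psi> x - (max 0 (- synth a x) / ?P) *\<^sub>R \<psi> x \<partial>cell_measure)"
    by (rule Bochner_Integration.integral_diff[OF i2, symmetric])
  also have "\<dots> = (\<integral>x. (synth a x / ?P) *\<^sub>R \<psi> x \<partial>cell_measure)"
    by (intro Bochner_Integration.integral_cong refl) (auto simp: max_def scaleR_left_diff_distrib[symmetric])
  finally show "smeasure_integral (series_measure a) \<psi> = (\<integral>x. (synth a x / ?P) *\<^sub>R \<psi> x \<partial>cell_measure)" .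
qed

lemma series_measure_BM:
  fixes a :: "'d::finite coeffs"
  assumes a: "abs_summable_coeffs a"
  shows "series_measure a \<in> BM"
proof -
  interpret finite_measure "cell_measure :: (real ^ 'd) measure" by (rule finite_cell_measure)
  let ?P = "(2 * pi) ^ CARD('d) :: real"
  let ?N = "\<Sum>\<^sub>\<infinity>k. cmod (a k)"
  have "torus_measure (density cell_measure (\<lambda>x. ennreal (u x / ?P)))"
    if "u \<in> borel_measurable borel" "\<And>x. 0 \<le> u x" "\<And>x. u x \<le> ?N" for u :: "real ^ 'd \<Rightarrow> real"
    unfolding torus_measure_def
  proof
    have um: "(\<lambda>x. ennreal (u x / ?P)) \<in> borel_measurable cell_measure"
      using that(1) by (intro measurable_cell) simp
    have "emeasure (density cell_measure (\<lambda>x. ennreal (u x / ?P))) (space cell_measure)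
        = (\<integral>\<^sup>+x. ennreal (u x / ?P) * indicator (space cell_measure) x \<partial>cell_measure)"
      by (rule emeasure_density[OF um]) simp
    also have "\<dots> \<le> (\<integral>\<^sup>+x. ennreal (?N / ?P) \<partial>(cell_measure :: (real ^ 'd) measure))"
      using that by (intro nn_integral_mono) (auto simp: indicator_def divide_right_mono intro!: ennreal_leI)
    also have "\<dots> = ennreal (?N / ?P) * emeasure cell_measure (space (cell_measure :: (real ^ 'd) measure))"
      by simp
    also have "\<dots> < \<infinity>"
      by (simp add: emeasure_eq_measure ennreal_mult_less_top)
    finally show "finite_measure (density cell_measure (\<lambda>x. ennreal (u x / ?P)))"
      by (intro finite_measureI) simp
  qed (simp add: sets_cell_measure)
  moreover have "max 0 (synth a x) \<le> ?N" "max 0 (- synth a x) \<le> ?N" for x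
    using synth_bounded[OF a, of x] by auto
  ultimately show ?thesis
    unfolding BM_def series_measure_def using synth_measurable[OF a] by auto
qed

lemma series_measure_coeffs:
  fixes a :: "'d::finite coeffs"
  assumes a: "abs_summable_coeffs a" "real_coeffs a"
  shows "smeasure_coeffs (series_measure a) = a"
proof
  fix k :: "int ^ 'd"
  have m: "(\<lambda>x. cis (- (freq k \<bullet> x))) \<in> borel_measurable borel"
    by (intro borel_measurable_continuous_onI continuous_intros)
  have "smeasure_coeffs (series_measure a) k
      = (\<integral>x. (synth a x / (2 * pi) ^ CARD('d)) *\<^sub>R cis (- (freq k \<bullet> x)) \<partial>cell_measure)"
    unfolding smeasure_coeffs_def by (rule series_measure_integral(1)[OF a(1) m, of 1]) simp
  also have "\<dots> = (\<integral>x. (1 / (2 * pi) ^ CARD('d)) *\<^sub>R (synth a x *\<^sub>R cis (- (freq k \<bullet> x))) \<partial>cell_measure)"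
    by simp
  also have "\<dots> = (1 / (2 * pi) ^ CARD('d)) *\<^sub>R (complex_of_real ((2 * pi) ^ CARD('d)) * a k)"
    unfolding integral_scaleR_right fourier_inversion[OF a] ..
  also have "\<dots> = a k" by (simp add: scaleR_conv_of_real)
  finally show "smeasure_coeffs (series_measure a) k = a k" .
qed

text \<open>
  If the coefficients converge in \<open>l1\<close>, then the densities converge uniformly, and integrating against
  a bounded function on a set of finite measure preserves the limit.
\<close>

lemma weak_star_series:
  fixes a :: "nat \<Rightarrow> 'd::finite coeffs"
  assumes a: "\<And>n. abs_summable_coeffs (a n)" "\<And>n. real_coeffs (a n)"
    and b: "abs_summable_coeffs b" "real_coeffs b"
    and w: "\<And>n. w n summable_on UNIV" "\<And>n k. cmod (a n k - b k) \<le> w n k" "(\<lambda>n. infsum (w n) UNIV) \<longlonglongrightarrow> 0"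
  shows "weak_star_coeffs a b"
  unfolding weak_star_coeffs_def
proof (intro exI conjI allI)
  show "series_measure (a n) \<in> BM" "smeasure_coeffs (series_measure (a n)) = a n" for n
    by (intro series_measure_BM series_measure_coeffs a)+
  show "series_measure b \<in> BM" "smeasure_coeffs (series_measure b) = b"
    by (intro series_measure_BM series_measure_coeffs b)+
  show "weak_star (\<lambda>n. series_measure (a n)) (series_measure b)"
    unfolding weak_star_def
  proof
    fix \<psi> :: "real ^ 'd \<Rightarrow> real" assume "\<psi> \<in> torus_continuous"
    then have cont: "continuous_on UNIV \<psi>" by (simp add: torus_continuous_def)
    interpret finite_measure "cell_measure :: (real ^ 'd) measure" by (rule finite_cell_measure)
    let ?P = "(2 * pi) ^ CARD('d) :: real"
    let ?V = "measure cell_measure (space (cell_measure :: (real ^ 'd) measure))"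
    have m: "\<psi> \<in> borel_measurable borel" by (rule borel_measurable_continuous_onI[OF cont])
    have "bounded (\<psi> ` cbox 0 (\<chi> i. 2 * pi))"
      by (intro compact_imp_bounded compact_continuous_image continuous_on_subset[OF cont]) auto
    then obtain B where "\<And>x. x \<in> cbox 0 (\<chi> i. 2 * pi) \<Longrightarrow> norm (\<psi> x) \<le> B" "B > 0"
      by (auto simp: bounded_pos)
    then have B: "\<And>x. x \<in> torus_cell \<Longrightarrow> norm (\<psi> x) \<le> B" "B > 0"
      using torus_cell_subset by blast+
    have I: "smeasure_integral (series_measure c) \<psi> = (\<integral>x. (synth c x / ?P) *\<^sub>R \<psi> x \<partial>cell_measure)"
      "integrable cell_measure (\<lambda>x. (synth c x / ?P) *\<^sub>R \<psi> x)" if "abs_summable_coeffs c" for c :: "'d coeffs"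
      by (rule series_measure_integral[OF that m, of B]; rule B(1); assumption)+
    have "norm (smeasure_integral (series_measure (a n)) \<psi> - smeasure_integral (series_measure b) \<psi>)
        \<le> (B / ?P * ?V) * infsum (w n) UNIV" for n
    proof -
      have le: "norm ((synth (a n) x / ?P) *\<^sub>R \<psi> x - (synth b x / ?P) *\<^sub>R \<psi> x) \<le> B / ?P * infsum (w n) UNIV"
        if "x \<in> torus_cell" for x
      proof -
        have "(synth (a n) x / ?P) *\<^sub>R \<psi> x - (synth b x / ?P) *\<^sub>R \<psi> x = \<psi> x / ?P * (synth (a n) x - synth b x)"
          by (simp add: field_simps)
        also have "norm \<dots> = norm (\<psi> x) / ?P * \<bar>synth (a n) x - synth b x\<bar>" by (simp add: abs_mult)
        also have "\<dots> \<le> B / ?P * infsum (w n) UNIV"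
          using B that by (intro mult_mono divide_right_mono synth_diff_le a b w) auto
        finally show ?thesis .
      qed
      have "norm (smeasure_integral (series_measure (a n)) \<psi> - smeasure_integral (series_measure b) \<psi>)
        = norm (\<integral>x. (synth (a n) x / ?P) *\<^sub>R \<psi> x - (synth b x / ?P) *\<^sub>R \<psi> x \<partial>cell_measure)"
        unfolding I(1)[OF a(1)] I(1)[OF b(1)]
        by (rule arg_cong[where f = norm], rule Bochner_Integration.integral_diff[OF I(2)[OF a(1)] I(2)[OF b(1)], symmetric])
      also have "\<dots> \<le> (\<integral>x. B / ?P * infsum (w n) UNIV \<partial>(cell_measure :: (real ^ 'd) measure))"
      proof (rule Bochner_Integration.integral_norm_bound_integral)
        show "integrable cell_measure (\<lambda>x. (synth (a n) x / ?P) *\<^sub>R \<psi> x - (synth b x / ?P) *\<^sub>R \<psi> x)"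
          by (intro Bochner_Integration.integrable_diff I(2) a b)
      qed (rule integrable_const, rule le, simp add: cell_measure_def space_restrict_space)
      also have "\<dots> = (B / ?P * ?V) * infsum (w n) UNIV" by simp
      finally show ?thesis .
    qed
    then have "\<forall>\<^sub>F n in sequentially.
        norm (smeasure_integral (series_measure (a n)) \<psi> - smeasure_integral (series_measure b) \<psi>)
          \<le> (B / ?P * ?V) * infsum (w n) UNIV"
      by (rule always_eventually[OF allI])
    from Lim_null_comparison[OF this tendsto_mult_right_zero[OF w(3)]]
    show "(\<lambda>n. smeasure_integral (series_measure (a n)) \<psi>) \<longlonglongrightarrow> smeasure_integral (series_measure b) \<psi>"
      by (rule LIM_zero_cancel)
  qed
qed

text \<open>
  The real and imaginary parts of the characters are admissible test functions.
\<close>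

lemma smeasure_coeffs_tendsto:
  fixes \<mu> :: "nat \<Rightarrow> 'd::finite smeasure"
  assumes BM: "\<And>n. \<mu> n \<in> BM" "\<mu>' \<in> BM" and w: "weak_star \<mu> \<mu>'"
  shows "(\<lambda>n. smeasure_coeffs (\<mu> n) k) \<longlonglongrightarrow> smeasure_coeffs \<mu>' k"
proof -
  have int: "integrable N (\<lambda>x. cis (- (freq k \<bullet> x)))" if "torus_measure N" for N :: "(real ^ 'd) measure"
  proof -
    interpret finite_measure N using that by (simp add: torus_measure_def)
    have "(\<lambda>x. cis (- (freq k \<bullet> x))) \<in> borel_measurable (restrict_space borel torus_cell)"
      by (intro measurable_restrict_space1 borel_measurable_continuous_onI continuous_intros)
    then have "(\<lambda>x. cis (- (freq k \<bullet> x))) \<in> borel_measurable N"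
      using that by (simp add: torus_measure_def cong: measurable_cong_sets)
    then show ?thesis by (intro integrable_const_bound[of _ 1]) auto
  qed
  have re: "Re (smeasure_coeffs \<nu> k) = smeasure_integral \<nu> (\<lambda>x. cos (freq k \<bullet> x))"
    and im: "Im (smeasure_coeffs \<nu> k) = smeasure_integral \<nu> (\<lambda>x. - sin (freq k \<bullet> x))"
    if "\<nu> \<in> BM" for \<nu> :: "'d smeasure"
  proof -
    have "torus_measure (fst \<nu>)" "torus_measure (snd \<nu>)" using that by (auto simp: BM_def)
    note * = int[OF this(1)] int[OF this(2)]
    show "Re (smeasure_coeffs \<nu> k) = smeasure_integral \<nu> (\<lambda>x. cos (freq k \<bullet> x))"
      using integral_Re[OF *(1)] integral_Re[OF *(2)] by (simp add: smeasure_coeffs_def smeasure_integral_def)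
    show "Im (smeasure_coeffs \<nu> k) = smeasure_integral \<nu> (\<lambda>x. - sin (freq k \<bullet> x))"
      using integral_Im[OF *(1)] integral_Im[OF *(2)] by (simp add: smeasure_coeffs_def smeasure_integral_def)
  qed
  have per: "cis (freq k \<bullet> (x + (2 * pi) *\<^sub>R axis i 1)) = cis (freq k \<bullet> x)" for x i
    by (simp add: inner_add_right inner_axis freq_def cis_mult[symmetric])
  have tc: "(\<lambda>x. cos (freq k \<bullet> x)) \<in> torus_continuous" "(\<lambda>x. - sin (freq k \<bullet> x)) \<in> torus_continuous"
    unfolding torus_continuous_def
    using arg_cong[OF per, of Re] arg_cong[OF per, of Im]
    by (auto intro!: continuous_intros)
  show ?thesis
    unfolding tendsto_complex_iff re[OF BM(1)] re[OF BM(2)] im[OF BM(1)] im[OF BM(2)]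
    using w tc by (auto simp: weak_star_def)
qed

section \<open>The convergence theorem\<close>

lemma vsynth_diff_le:
  assumes v: "in_Bvec \<beta> T va" "in_Bvec \<beta> T vb" and t: "t \<in> {0..T}" and \<beta>: "0 \<le> \<beta>"
  shows "norm (vsynth (va t) x - vsynth (vb t) x) \<le> norm_Bvec \<beta> T (\<lambda>t k. va t k - vb t k)"
proof -
  have T: "0 \<le> T" using t by auto
  have "norm (vsynth (va t) x - vsynth (vb t) x) \<le> (\<Sum>i\<in>UNIV. \<bar>(vsynth (va t) x - vsynth (vb t) x) $ i\<bar>)"
    by (rule norm_le_l1_cart)
  also have "\<dots> \<le> norm_Bvec \<beta> T (\<lambda>t k. va t k - vb t k)"
    unfolding norm_Bvec_def
  proof (rule sum_mono)
    fix i
    have a: "in_B \<beta> T (\<lambda>t k. va t k $ i)" and b: "in_B \<beta> T (\<lambda>t k. vb t k $ i)"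
      using v by (auto simp: in_Bvec_def)
    have s: "abs_summable_coeffs (f t)" if "in_B \<beta> T f" for f :: "real \<Rightarrow> 'a coeffs"
      by (rule summable_on_comparison_test[OF in_B_summable[OF that]])
         (auto intro: cmod_le_coeff_sup[OF that t \<beta>])
    note d = in_B_diff[OF a b T]
    have "\<bar>synth (\<lambda>k. va t k $ i) x - synth (\<lambda>k. vb t k $ i) x\<bar>
        \<le> infsum (coeff_sup \<beta> T (\<lambda>t k. va t k $ i - vb t k $ i)) UNIV"
      by (rule synth_diff_le[OF s[OF a] s[OF b] in_B_summable[OF d] cmod_le_coeff_sup[OF d t \<beta>]])
    then show "\<bar>(vsynth (va t) x - vsynth (vb t) x) $ i\<bar> \<le> norm_B \<beta> T (\<lambda>t k. (va t k - vb t k) $ i)"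
      by (simp add: vsynth_def norm_B_eq)
  qed
  finally show ?thesis .
qed

context mild_sequence
begin

lemma uniform_limit_v:
  assumes "pair.D \<longlonglongrightarrow> 0"
  shows "uniform_limit (UNIV \<times> {0..T}) (\<lambda>n (x, t). vsynth (v n t) x) (\<lambda>(x, t). vsynth (v_lim t) x) sequentially"
proof (rule uniform_limitI)
  fix e :: real assume "e > 0"
  then have "\<forall>\<^sub>F n in sequentially. pair.D n < e" by (rule order_tendstoD(2)[OF assms])
  then show "\<forall>\<^sub>F n in sequentially. \<forall>z\<in>UNIV \<times> {0..T}.
      dist (case z of (x, t) \<Rightarrow> vsynth (v n t) x) (case z of (x, t) \<Rightarrow> vsynth (v_lim t) x) < e"
  proof eventually_elim
    case (elim n)
    show ?case
    proof (clarify)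
      fix x :: "real ^ 'd" and t assume "t \<in> {0..T}"
      with vsynth_diff_le[OF pair.in_va[of n] pair.in_vb this pair.\<beta>, of x] elim
      show "dist (vsynth (v n t) x) (vsynth (v_lim t) x) < e"
        by (simp add: dist_norm pair.D_def)
    qed
  qed
qed

lemma weak_star_positive_time:
  assumes A: "\<And>k. (\<lambda>n. pair.A n k) \<longlonglongrightarrow> 0" and t: "0 < t" "t \<le> T"
  shows "weak_star_coeffs (\<lambda>n. m n t) (m_lim t)"
proof -
  have t': "t \<in> {0..T}" using t by simp
  let ?e = "\<lambda>k :: int ^ 'd. exp (- (\<alpha> * t * knorm k))"
  have e: "?e summable_on UNIV"
    using exp_knorm_summable[of "\<alpha> * t"] t pair.\<alpha> by simp
  have decay: "cmod z \<le> X * ?e k" if "exp (\<alpha> * t * knorm k) * cmod z \<le> X" for z X k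
    using that by (simp add: exp_minus field_simps)
  have summ: "abs_summable_coeffs (u t)" if "in_PMt \<alpha> T u" for u :: "real \<Rightarrow> 'd coeffs"
    by (rule summable_on_comparison_test[OF summable_on_cmult_right[OF e, of "norm_PMt \<alpha> T u"]])
       (auto intro!: decay le_norm_PMt that t')
  have le: "cmod (m n t k - m_lim t k) \<le> pair.A n k * ?e k" for n k
    by (rule decay[OF pair.le_A[OF t']])
  have lim: "(\<lambda>n. \<Sum>\<^sub>\<infinity>k. pair.A n k * ?e k) \<longlonglongrightarrow> 0"
  proof (rule asymp_le_all_tendsto_0[where c = 0])
    show "asymp_le (\<lambda>n. \<Sum>\<^sub>\<infinity>k. pair.A n k * ?e k) (0 / 2 ^ j)" for j
      using asymp_le_infsum[of pair.A 0 "2 * M" ?e, OF asymp_le_tendsto_0[OF A] pair.A0 pair.A_le e]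
      by simp
  qed (intro infsum_nonneg mult_nonneg_nonneg pair.A0, simp)
  have "(\<lambda>k. pair.A n k * ?e k) summable_on UNIV" for n
    by (rule bounded_mult_summable(1)[OF e]) (auto simp: pair.A0 intro: pair.A_le)
  then show ?thesis
    by (rule weak_star_series[OF summ[OF pair.in_ma] in_PMt_real[OF pair.in_ma t'] summ[OF pair.in_mb]
          in_PMt_real[OF pair.in_mb t'] _ le lim])
qed

end

text \<open>
  Here \<open>K\<close> stands for the constant of the payoff and \<open>d\<close> for the dimension. The smallness conditions
  of \<open>convergence\<close> are linear in the two strengths, so one threshold serves both.
\<close>

lemma small_interaction_suffices:
  fixes \<alpha> M K d :: real
  assumes "\<alpha> < 1" "0 < M" "0 \<le> K" "0 \<le> d"
  obtains \<sigma> where "0 < \<sigma>"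
    "\<And>S1 S2. S1 \<le> \<sigma> \<Longrightarrow> S2 \<le> \<sigma> \<Longrightarrow> M * (M + 2) * S2 / (1 - \<alpha>) \<le> 1 / 2 \<and>
       d * (K * (M * (M + 2) * S2 / (1 - \<alpha>)) + (M + 1) * S1) \<le> 1 / 2"
proof -
  define L where "L = M * (M + 2) / (1 - \<alpha>)"
  have L: "0 < L" using assms by (simp add: L_def)
  define Z where "Z = L + d * (K * L + (M + 1))"
  have Z: "0 < Z" using L assms unfolding Z_def by (intro add_pos_nonneg mult_nonneg_nonneg add_nonneg_nonneg) auto
  show ?thesis
  proof (rule that[of "1 / (2 * Z)"])
    fix S1 S2 assume S: "S1 \<le> 1 / (2 * Z)" "S2 \<le> 1 / (2 * Z)"
    have LS: "M * (M + 2) * S2 / (1 - \<alpha>) = L * S2" by (simp add: L_def)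
    have "L * S2 \<le> L * (1 / (2 * Z))" using S L by (intro mult_left_mono) auto
    also have "\<dots> \<le> Z * (1 / (2 * Z))"
      using Z L assms unfolding Z_def by (intro mult_right_mono) auto
    finally have 1: "L * S2 \<le> 1 / 2" using Z by simp
    have "d * (K * (L * S2) + (M + 1) * S1) \<le> d * (K * (L * (1 / (2 * Z))) + (M + 1) * (1 / (2 * Z)))"
      using S L assms by (intro mult_left_mono add_mono) auto
    also have "\<dots> = (d * (K * L + (M + 1))) * (1 / (2 * Z))" by (simp add: algebra_simps add_divide_distrib)
    also have "\<dots> \<le> Z * (1 / (2 * Z))"
      using Z L unfolding Z_def by (intro mult_right_mono) auto
    finally have 2: "d * (K * (L * S2) + (M + 1) * S1) \<le> 1 / 2" using Z by simp
    show "M * (M + 2) * S2 / (1 - \<alpha>) \<le> 1 / 2 \<and>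
       d * (K * (M * (M + 2) * S2 / (1 - \<alpha>)) + (M + 1) * S1) \<le> 1 / 2"
      unfolding LS using 1 2 by simp
  qed (use Z in simp)
qed

text \<open>
  The three hypotheses are exactly that each of the three products contains a positive power of
  the radius.
\<close>

lemma interaction_strength_tendsto_0:
  assumes "p f + p g > 0" "p f + pt g > 0" "pt f + p g > 0"
  shows "((\<lambda>\<epsilon>. interaction_strength c p ct pt \<epsilon> f g) \<longlongrightarrow> 0) (at_right 0)"
proof -
  have prod: "((\<lambda>\<epsilon>. rpow \<epsilon> a * rpow \<epsilon> b) \<longlongrightarrow> 0) (at_right 0)" if "a + b > 0" for a b
  proof -
    have "((\<lambda>\<epsilon>::real. \<epsilon> powr (a + b)) \<longlongrightarrow> 0) (at_right 0)"
      by (rule tendsto_zero_powrI[OF tendsto_ident_at tendsto_const _ that])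
         (rule eventually_mono[OF eventually_at_right_less less_imp_le])
    moreover have "\<forall>\<^sub>F \<epsilon> in at_right 0. rpow \<epsilon> a * rpow \<epsilon> b = \<epsilon> powr (a + b)"
      using eventually_at_right_less[of 0] by eventually_elim (auto simp: rpow_def powr_add)
    ultimately show ?thesis by (simp add: tendsto_cong)
  qed
  have eq: "interaction_strength c p ct pt \<epsilon> f g
      = 2 * ct g * c f * (rpow \<epsilon> (p f) * rpow \<epsilon> (pt g)) + 2 * c g * ct f * (rpow \<epsilon> (pt f) * rpow \<epsilon> (p g))
        + c g * c f * (rpow \<epsilon> (p f) * rpow \<epsilon> (p g))" for \<epsilon>
    by (simp add: interaction_strength_def size_bound_def lipschitz_bound_def algebra_simps)
  show ?thesis
    unfolding eq
    using tendsto_add[OF tendsto_add[OF tendsto_mult_left[OF prod[OF assms(2)]] tendsto_mult_left[OF prod[OF assms(3)]]]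
        tendsto_mult_left[OF prod[OF assms(1)]], of "2 * ct g * c f" "2 * c g * ct f" "c g * c f"]
    by simp
qed

lemma interaction_strength_le:
  assumes c: "c f > 0" "c g > 0" "ct f > 0" "ct g > 0"
    and Q: "rpow R (p f) \<le> Q" "rpow R (p g) \<le> Q" "rpow R (pt f) \<le> Q" "rpow R (pt g) \<le> Q"
  shows "interaction_strength c p ct pt R f g \<le> 2 * Q\<^sup>2 * (c f * c g + ct f * c g + c f * ct g)"
proof -
  have prod: "x * y * (rpow R a * rpow R b) \<le> x * y * Q\<^sup>2"
    if "x > 0" "y > 0" "rpow R a \<le> Q" "rpow R b \<le> Q" for x y a b
    unfolding power2_eq_square using that
    by (intro mult_left_mono mult_mono) (auto intro: rpow_nonneg order_trans[OF rpow_nonneg])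
  have "interaction_strength c p ct pt R f g
      = 2 * (ct g * c f * (rpow R (p f) * rpow R (pt g))) + 2 * (c g * ct f * (rpow R (pt f) * rpow R (p g)))
        + c g * c f * (rpow R (p f) * rpow R (p g))"
    by (simp add: interaction_strength_def size_bound_def lipschitz_bound_def algebra_simps)
  also have "\<dots> \<le> 2 * (ct g * c f * Q\<^sup>2) + 2 * (c g * ct f * Q\<^sup>2) + c g * c f * Q\<^sup>2"
    by (intro add_mono mult_left_mono prod c Q) auto
  also have "\<dots> \<le> 2 * (ct g * c f * Q\<^sup>2) + 2 * (c g * ct f * Q\<^sup>2) + 2 * (c g * c f * Q\<^sup>2)"
    using c by simp
  also have "\<dots> = 2 * Q\<^sup>2 * (c f * c g + ct f * c g + c f * ct g)" by (simp add: algebra_simps)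
  finally show ?thesis .
qed

theorem theorem3:
  fixes \<alpha> M cG ctG :: real
    and \<Psi>1 \<Psi>2 :: "real \<Rightarrow> real"
    and G :: "'d::finite coeffs \<Rightarrow> 'd coeffs"
    and p pt :: "ham_label \<Rightarrow> real"
  assumes "0 < \<alpha>" "\<alpha> < 1" "M > 0"
  shows "\<exists>\<delta>>0. \<forall>c ct :: ham_label \<Rightarrow> real. \<exists>\<epsilon>>0.
    \<forall>(T :: real) (f1 :: real ^ 'd \<Rightarrow> real) (f2 :: real ^ 'd \<Rightarrow> real)
     (g1 :: real ^ 'd \<Rightarrow> real) (g2 :: real ^ 'd \<Rightarrow> real ^ 'd)
     (\<mu>0 :: nat \<Rightarrow> 'd smeasure) (\<mu>0_lim :: 'd smeasure)
     (v :: nat \<Rightarrow> real \<Rightarrow> 'd vcoeffs) (m :: nat \<Rightarrow> real \<Rightarrow> 'd coeffs)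
     (v_lim :: real \<Rightarrow> 'd vcoeffs) (m_lim :: real \<Rightarrow> 'd coeffs).
      T > 0 \<longrightarrow>
      hamiltonian_assumption f1 f2 g1 g2 \<longrightarrow>
      hamiltonian_at T \<alpha> f1 f2 g1 g2 c p ct pt \<longrightarrow>
      payoff_assumption T \<alpha> G cG ctG \<Psi>1 \<Psi>2 \<longrightarrow>
      (\<forall>n. \<mu>0 n \<in> BM) \<longrightarrow> \<mu>0_lim \<in> BM \<longrightarrow> weak_star \<mu>0 \<mu>0_lim \<longrightarrow>
      (\<forall>n. mild_solution T \<alpha> f1 f2 g1 g2 G (smeasure_coeffs (\<mu>0 n)) (v n) (m n)) \<longrightarrow>
      mild_solution T \<alpha> f1 f2 g1 g2 G (smeasure_coeffs \<mu>0_lim) v_lim m_lim \<longrightarrow>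
      (\<forall>n. norm_Bvec (\<alpha> * T) T (v n) \<le> M \<and> norm_PMt \<alpha> T (m n) \<le> M) \<longrightarrow>
      norm_Bvec (\<alpha> * T) T v_lim \<le> M \<longrightarrow> norm_PMt \<alpha> T m_lim \<le> M \<longrightarrow>
      ((\<forall>(f, g) \<in> {(F1, G1), (F2, G2)}.
           p f + p g > 0 \<and> p f + pt g > 0 \<and> pt f + p g > 0) \<and>
         (\<forall>n. norm_Bvec (\<alpha> * T) T (v n) < \<epsilon>) \<and> norm_Bvec (\<alpha> * T) T v_lim < \<epsilon>
       \<or>
       c F1 * c G1 + ct F1 * c G1 + c F1 * ct G1
         + c F2 * c G2 + ct F2 * c G2 + c F2 * ct G2 < \<delta>) \<longrightarrow>
      uniform_limit (UNIV \<times> {0..T})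
        (\<lambda>n (x, t). vsynth (v n t) x) (\<lambda>(x, t). vsynth (v_lim t) x) sequentially \<and>
      (\<forall>t\<in>{0..T}. weak_star_coeffs (\<lambda>n. m n t) (m_lim t))"
proof -
  \<comment> \<open>The modulus makes the choice of \<open>\<sigma>\<close> possible before the payoff assumption, which gives the sign, is available.\<close>
  define K where "K = \<bar>ctG * \<Psi>2 (2 * M)\<bar>"
  obtain \<sigma> where \<sigma>: "0 < \<sigma>" and small:
    "\<And>S1 S2. S1 \<le> \<sigma> \<Longrightarrow> S2 \<le> \<sigma> \<Longrightarrow> M * (M + 2) * S2 / (1 - \<alpha>) \<le> 1 / 2 \<and>
       real CARD('d) * (K * (M * (M + 2) * S2 / (1 - \<alpha>)) + (M + 1) * S1) \<le> 1 / 2"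
    using small_interaction_suffices[OF assms(2,3), of K "real CARD('d)"] by (auto simp: K_def)
  \<comment> \<open>A common bound for all powers of \<open>M\<close> that occur. It involves the exponents but not the constants, as \<open>\<delta>\<close> is chosen before these.\<close>
  define Q where "Q = (\<Sum>l\<leftarrow>[F1, F2, G1, G2]. rpow M (p l) + rpow M (pt l))"
  have Q: "rpow M (p l) \<le> Q" "rpow M (pt l) \<le> Q" for l
    using rpow_nonneg[of M "p F1"] rpow_nonneg[of M "p F2"] rpow_nonneg[of M "p G1"] rpow_nonneg[of M "p G2"]
      rpow_nonneg[of M "pt F1"] rpow_nonneg[of M "pt F2"] rpow_nonneg[of M "pt G1"] rpow_nonneg[of M "pt G2"]
    by (cases l; simp add: Q_def)+
  define \<delta> where "\<delta> = \<sigma> / (2 * Q\<^sup>2 + 1)"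
  have Q0: "0 \<le> 2 * Q\<^sup>2" by simp
  have \<delta>: "0 < \<delta>" unfolding \<delta>_def using \<sigma> Q0 by (intro divide_pos_pos add_nonneg_pos) auto
  have Q\<delta>: "2 * Q\<^sup>2 * \<delta> \<le> \<sigma>"
  proof -
    have "2 * Q\<^sup>2 / (2 * Q\<^sup>2 + 1) \<le> 1" by (subst divide_le_eq_1_pos) (use Q0 in linarith, simp)
    then have "\<sigma> * (2 * Q\<^sup>2 / (2 * Q\<^sup>2 + 1)) \<le> \<sigma> * 1" using \<sigma> by (intro mult_left_mono) auto
    then show ?thesis by (simp add: \<delta>_def mult.commute)
  qed
  have limit: "uniform_limit (UNIV \<times> {0..T})
        (\<lambda>n (x, t). vsynth (v n t) x) (\<lambda>(x, t). vsynth (v_lim t) x) sequentially \<and>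
      (\<forall>t\<in>{0..T}. weak_star_coeffs (\<lambda>n. m n t) (m_lim t))"
    if T: "T > 0" and ham: "hamiltonian_at T \<alpha> f1 f2 g1 g2 c p ct pt"
      and pay: "payoff_assumption T \<alpha> G cG ctG \<Psi>1 \<Psi>2"
      and BM: "\<forall>n. \<mu>0 n \<in> BM" "\<mu>0_lim \<in> BM" and ws: "weak_star \<mu>0 \<mu>0_lim"
      and sol: "\<forall>n. mild_solution T \<alpha> f1 f2 g1 g2 G (smeasure_coeffs (\<mu>0 n)) (v n) (m n)"
        "mild_solution T \<alpha> f1 f2 g1 g2 G (smeasure_coeffs \<mu>0_lim) v_lim m_lim"
      and M: "\<forall>n. norm_PMt \<alpha> T (m n) \<le> M" "norm_PMt \<alpha> T m_lim \<le> M"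
      and R: "\<forall>n. norm_Bvec (\<alpha> * T) T (v n) \<le> R" "norm_Bvec (\<alpha> * T) T v_lim \<le> R"
      and S: "interaction_strength c p ct pt R F1 G1 \<le> \<sigma>" "interaction_strength c p ct pt R F2 G2 \<le> \<sigma>"
    for T R :: real and f1 f2 g1 :: "real ^ 'd \<Rightarrow> real" and g2 :: "real ^ 'd \<Rightarrow> real ^ 'd"
      and c ct :: "ham_label \<Rightarrow> real"
      and \<mu>0 :: "nat \<Rightarrow> 'd smeasure" and \<mu>0_lim :: "'d smeasure"
      and v :: "nat \<Rightarrow> real \<Rightarrow> 'd vcoeffs" and m :: "nat \<Rightarrow> real \<Rightarrow> 'd coeffs"
      and v_lim :: "real \<Rightarrow> 'd vcoeffs" and m_lim :: "real \<Rightarrow> 'd coeffs"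
  proof -
    interpret mild_sequence T \<alpha> R M cG ctG \<Psi>1 \<Psi>2 G f1 f2 g1 g2 c p ct pt
      "\<lambda>n. smeasure_coeffs (\<mu>0 n)" "smeasure_coeffs \<mu>0_lim" v v_lim m m_lim
    proof
      show "(\<lambda>n. smeasure_coeffs (\<mu>0 n) k) \<longlonglongrightarrow> smeasure_coeffs \<mu>0_lim k" for k
        using BM by (intro smeasure_coeffs_tendsto ws) auto
    qed (use assms T ham pay sol M R in auto)
    have K: "K = ctG * \<Psi>2 (2 * M)"
      using pair.terminal_diff_le(3) by (simp add: K_def)
    note s = small[OF S, unfolded K]
    note lim = convergence[OF s[THEN conjunct1] s[THEN conjunct2]]
    have "weak_star_coeffs (\<lambda>n. m n t) (m_lim t)" if t: "t \<in> {0..T}" for t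
    proof (cases "t = 0")
      case True
      have "m n 0 = smeasure_coeffs (\<mu>0 n)" "m_lim 0 = smeasure_coeffs \<mu>0_lim" for n
        using sol T by (auto simp: mild_solution_def heat_def fun_eq_iff)
      then show ?thesis
        unfolding True weak_star_coeffs_def using BM ws
        by (intro exI[of _ \<mu>0] exI[of _ \<mu>0_lim]) simp
    next
      case False
      then show ?thesis using t by (intro weak_star_positive_time lim) auto
    qed
    with uniform_limit_v[OF lim(2)] show ?thesis by blast
  qed
  show ?thesis
  proof (rule exI[of _ \<delta>], intro conjI \<delta> allI)
    fix c ct :: "ham_label \<Rightarrow> real"
    let ?I = "\<lambda>\<epsilon>. interaction_strength c p ct pt \<epsilon>"
    let ?exps = "\<forall>(f, g) \<in> {(F1, G1), (F2, G2)}. p f + p g > 0 \<and> p f + pt g > 0 \<and> pt f + p g > 0"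
    obtain \<epsilon> where \<epsilon>: "0 < \<epsilon>" "?exps \<Longrightarrow> ?I \<epsilon> F1 G1 \<le> \<sigma> \<and> ?I \<epsilon> F2 G2 \<le> \<sigma>"
    proof (cases ?exps)
      case True
      then have "((\<lambda>\<epsilon>. ?I \<epsilon> F1 G1) \<longlongrightarrow> 0) (at_right 0)" "((\<lambda>\<epsilon>. ?I \<epsilon> F2 G2) \<longlongrightarrow> 0) (at_right 0)"
        by (auto intro!: interaction_strength_tendsto_0)
      then have "\<forall>\<^sub>F \<epsilon> in at_right 0. ?I \<epsilon> F1 G1 < \<sigma>" "\<forall>\<^sub>F \<epsilon> in at_right 0. ?I \<epsilon> F2 G2 < \<sigma>"
        using \<sigma> by (auto dest: order_tendstoD(2))
      then have "\<forall>\<^sub>F \<epsilon> in at_right 0. 0 < \<epsilon> \<and> ?I \<epsilon> F1 G1 \<le> \<sigma> \<and> ?I \<epsilon> F2 G2 \<le> \<sigma>"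
        using eventually_at_right_less[of 0] by eventually_elim auto
      then obtain \<epsilon> where "0 < \<epsilon> \<and> ?I \<epsilon> F1 G1 \<le> \<sigma> \<and> ?I \<epsilon> F2 G2 \<le> \<sigma>"
        using eventually_happens trivial_limit_at_right_real by blast
      then show ?thesis using that by blast
    next
      case False
      \<comment> \<open>In this situation the first case cannot occur, and any positive number will do.\<close>
      show ?thesis
        by (rule that[of 1]) (simp, erule notE[OF False])
    qed
    let ?c1 = "c F1 * c G1 + ct F1 * c G1 + c F1 * ct G1"
    let ?c2 = "c F2 * c G2 + ct F2 * c G2 + c F2 * ct G2"
    have case2: "?I M F1 G1 \<le> \<sigma> \<and> ?I M F2 G2 \<le> \<sigma>"
      if ham: "hamiltonian_at T \<alpha> f1 f2 g1 g2 c p ct pt" and sum: "?c1 + ?c2 < \<delta>"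
      for T and f1 f2 g1 :: "real ^ 'd \<Rightarrow> real" and g2 :: "real ^ 'd \<Rightarrow> real ^ 'd"
    proof -
      have c: "c l > 0" "ct l > 0" for l
        using ham by (cases l; simp add: hamiltonian_at_def ham_bounds_def vham_bounds_def)+
      have "?c1 > 0" "?c2 > 0" using c by (auto intro!: add_pos_pos)
      then have le: "?c1 \<le> \<delta>" "?c2 \<le> \<delta>" using sum by linarith+
      have "?I M F1 G1 \<le> 2 * Q\<^sup>2 * ?c1" "?I M F2 G2 \<le> 2 * Q\<^sup>2 * ?c2"
        by (intro interaction_strength_le c Q)+
      moreover have "2 * Q\<^sup>2 * ?c1 \<le> 2 * Q\<^sup>2 * \<delta>" "2 * Q\<^sup>2 * ?c2 \<le> 2 * Q\<^sup>2 * \<delta>"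
        using le Q0 by (auto intro: mult_left_mono)
      ultimately show ?thesis using Q\<delta> by linarith
    qed
    show "\<exists>\<epsilon>>0. \<forall>(T :: real) (f1 :: real ^ 'd \<Rightarrow> real) (f2 :: real ^ 'd \<Rightarrow> real)
     (g1 :: real ^ 'd \<Rightarrow> real) (g2 :: real ^ 'd \<Rightarrow> real ^ 'd)
     (\<mu>0 :: nat \<Rightarrow> 'd smeasure) (\<mu>0_lim :: 'd smeasure)
     (v :: nat \<Rightarrow> real \<Rightarrow> 'd vcoeffs) (m :: nat \<Rightarrow> real \<Rightarrow> 'd coeffs)
     (v_lim :: real \<Rightarrow> 'd vcoeffs) (m_lim :: real \<Rightarrow> 'd coeffs).
      T > 0 \<longrightarrow>
      hamiltonian_assumption f1 f2 g1 g2 \<longrightarrow>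
      hamiltonian_at T \<alpha> f1 f2 g1 g2 c p ct pt \<longrightarrow>
      payoff_assumption T \<alpha> G cG ctG \<Psi>1 \<Psi>2 \<longrightarrow>
      (\<forall>n. \<mu>0 n \<in> BM) \<longrightarrow> \<mu>0_lim \<in> BM \<longrightarrow> weak_star \<mu>0 \<mu>0_lim \<longrightarrow>
      (\<forall>n. mild_solution T \<alpha> f1 f2 g1 g2 G (smeasure_coeffs (\<mu>0 n)) (v n) (m n)) \<longrightarrow>
      mild_solution T \<alpha> f1 f2 g1 g2 G (smeasure_coeffs \<mu>0_lim) v_lim m_lim \<longrightarrow>
      (\<forall>n. norm_Bvec (\<alpha> * T) T (v n) \<le> M \<and> norm_PMt \<alpha> T (m n) \<le> M) \<longrightarrow>
      norm_Bvec (\<alpha> * T) T v_lim \<le> M \<longrightarrow> norm_PMt \<alpha> T m_lim \<le> M \<longrightarrow>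
      (?exps \<and> (\<forall>n. norm_Bvec (\<alpha> * T) T (v n) < \<epsilon>) \<and> norm_Bvec (\<alpha> * T) T v_lim < \<epsilon>
       \<or>
       c F1 * c G1 + ct F1 * c G1 + c F1 * ct G1
         + c F2 * c G2 + ct F2 * c G2 + c F2 * ct G2 < \<delta>) \<longrightarrow>
      uniform_limit (UNIV \<times> {0..T})
        (\<lambda>n (x, t). vsynth (v n t) x) (\<lambda>(x, t). vsynth (v_lim t) x) sequentially \<and>
      (\<forall>t\<in>{0..T}. weak_star_coeffs (\<lambda>n. m n t) (m_lim t))"
    proof (intro exI[of _ \<epsilon>] conjI[OF \<epsilon>(1)] allI impI)
      fix T :: real and f1 f2 g1 :: "real ^ 'd \<Rightarrow> real" and g2 :: "real ^ 'd \<Rightarrow> real ^ 'd"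
        and \<mu>0 :: "nat \<Rightarrow> 'd smeasure" and \<mu>0_lim :: "'d smeasure"
        and v :: "nat \<Rightarrow> real \<Rightarrow> 'd vcoeffs" and m :: "nat \<Rightarrow> real \<Rightarrow> 'd coeffs"
        and v_lim :: "real \<Rightarrow> 'd vcoeffs" and m_lim :: "real \<Rightarrow> 'd coeffs"
      assume T: "T > 0" and ham: "hamiltonian_at T \<alpha> f1 f2 g1 g2 c p ct pt"
        and pay: "payoff_assumption T \<alpha> G cG ctG \<Psi>1 \<Psi>2"
        and BM: "\<forall>n. \<mu>0 n \<in> BM" "\<mu>0_lim \<in> BM" and ws: "weak_star \<mu>0 \<mu>0_lim"
        and sol: "\<forall>n. mild_solution T \<alpha> f1 f2 g1 g2 G (smeasure_coeffs (\<mu>0 n)) (v n) (m n)"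
          "mild_solution T \<alpha> f1 f2 g1 g2 G (smeasure_coeffs \<mu>0_lim) v_lim m_lim"
        and bound: "\<forall>n. norm_Bvec (\<alpha> * T) T (v n) \<le> M \<and> norm_PMt \<alpha> T (m n) \<le> M"
          "norm_Bvec (\<alpha> * T) T v_lim \<le> M" "norm_PMt \<alpha> T m_lim \<le> M"
        and alt: "?exps \<and> (\<forall>n. norm_Bvec (\<alpha> * T) T (v n) < \<epsilon>) \<and> norm_Bvec (\<alpha> * T) T v_lim < \<epsilon> \<or>
          c F1 * c G1 + ct F1 * c G1 + c F1 * ct G1
            + c F2 * c G2 + ct F2 * c G2 + c F2 * ct G2 < \<delta>"
      note lim = limit[OF T ham pay BM ws sol _ bound(3)]
      from alt obtain R where "\<forall>n. norm_Bvec (\<alpha> * T) T (v n) \<le> R" "norm_Bvec (\<alpha> * T) T v_lim \<le> R"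
        "?I R F1 G1 \<le> \<sigma>" "?I R F2 G2 \<le> \<sigma>"
      proof
        assume "?exps \<and> (\<forall>n. norm_Bvec (\<alpha> * T) T (v n) < \<epsilon>) \<and> norm_Bvec (\<alpha> * T) T v_lim < \<epsilon>"
        then show ?thesis using \<epsilon>(2) by (intro that[of \<epsilon>]) (auto intro: less_imp_le)
      next
        assume "c F1 * c G1 + ct F1 * c G1 + c F1 * ct G1
            + c F2 * c G2 + ct F2 * c G2 + c F2 * ct G2 < \<delta>"
        then show ?thesis using case2[OF ham] bound by (intro that[of M]) auto
      qed
      with lim bound(1) show "uniform_limit (UNIV \<times> {0..T})
          (\<lambda>n (x, t). vsynth (v n t) x) (\<lambda>(x, t). vsynth (v_lim t) x) sequentially \<and>
        (\<forall>t\<in>{0..T}. weak_star_coeffs (\<lambda>n. m n t) (m_lim t))"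
        by blast
    qed
  qed
qed

end
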